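(* Let $R$ be a ring essentially of finite type over an excellent local ring and let $M$ be a finitely generated $R$-module. There exists a constant $C>0$ such that for all $P\in\operatorname{Spec}(R)$, all $q=p^e$, and all ideals $I,J$ of $R$ such that $IR_P\subseteq JR_P$ is a $PR_P$-primary pair of ideals, $$\lambda\left(\frac{J^{[q]}M_P}{I^{[q]}M_P}\right)\leq C\,q^{\dim(M_P)}\,\lambda\left(\frac{JR_P}{IR_P}\right).$$
   Context: All rings are commutative, Noetherian, with identity, and of prime characteristic $p$; $q=p^e$ with $e\ge0$; $\lambda$ denotes length (over $R_P$). $I^{[q]}$ is the ideal generated by the $q$th powers of elements of $I$. For a local ring $(S,\mathfrak m)$, an $\mathfrak m$-primary pair of ideals is a containment $I\subseteq J$ of ideals of $S$ with $I$ being $\mathfrak m$-primary ($J$ is then $\mathfrak m$-primary or equal to $S$). If $M_P=0$ the inequality is regarded as trivially true (both sides are $0$). *)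

theory Defs
  imports "HOL-Algebra.Algebra" "HOL-Library.Extended_Nonnegative_Real"
begin

section \<open>Chains, length and Krull dimension\<close>

text \<open>The supremum of all \<open>n\<close> such that there is a chain \<open>X\<^sub>0 \<subset> X\<^sub>1 \<subset> \<dots> \<subset> X\<^sub>n\<close> of members of \<open>F\<close>
  (so it is 0, and not a negative value, if \<open>F\<close> is empty).\<close>

definition chain_height :: "'a set set \<Rightarrow> enat" where
  "chain_height F =
     Sup {enat n | n. \<exists>xs. length xs = Suc n \<and> sorted_wrt (\<subset>) xs \<and> set xs \<subseteq> F}"

definition krull_dim :: "('a, 'c) ring_scheme \<Rightarrow> enat" where
  "krull_dim R = chain_height {P. primeideal P R}"

definition module_length ::
    "('a, 'c) ring_scheme \<Rightarrow> ('a, 'b, 'd) module_scheme \<Rightarrow> enat" where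
  "module_length R N = chain_height {H. submodule H R N}"

definition annihilator ::
    "('a, 'c) ring_scheme \<Rightarrow> ('a, 'b, 'd) module_scheme \<Rightarrow> 'a set" where
  "annihilator R N = {a \<in> carrier R. \<forall>x \<in> carrier N. a \<odot>\<^bsub>N\<^esub> x = \<zero>\<^bsub>N\<^esub>}"

text \<open>By the convention for \<^const>\<open>chain_height\<close>, the zero module gets dimension 0.\<close>

definition module_dim ::
    "('a, 'c) ring_scheme \<Rightarrow> ('a, 'b, 'd) module_scheme \<Rightarrow> enat" where
  "module_dim R N = krull_dim (R Quot annihilator R N)"


section \<open>Modules\<close>

definition submodule_span ::
    "('a, 'c) ring_scheme \<Rightarrow> ('a, 'b, 'd) module_scheme \<Rightarrow> 'b set \<Rightarrow> 'b set" where
  "submodule_span R N U = \<Inter>{H. submodule H R N \<and> U \<subseteq> H}"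

definition finitely_generated_module ::
    "('a, 'c) ring_scheme \<Rightarrow> ('a, 'b, 'd) module_scheme \<Rightarrow> bool" where
  "finitely_generated_module R N \<longleftrightarrow>
     (\<exists>U. finite U \<and> U \<subseteq> carrier N \<and> submodule_span R N U = carrier N)"

definition ideal_smult ::
    "('a, 'c) ring_scheme \<Rightarrow> 'a set \<Rightarrow> ('a, 'b, 'd) module_scheme \<Rightarrow> 'b set" where
  "ideal_smult R I N = submodule_span R N {a \<odot>\<^bsub>N\<^esub> x | a x. a \<in> I \<and> x \<in> carrier N}"

text \<open>The fields \<^const>\<open>monoid.mult\<close> and \<^const>\<open>one\<close> of a module record carry no meaning.\<close>

definition quot_module :: "('a, 'b, 'd) module_scheme \<Rightarrow> 'b set \<Rightarrow> ('a, 'b set) module" where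
  "quot_module N K =
     \<lparr>carrier = a_rcosets\<^bsub>N\<^esub> K, monoid.mult = undefined, one = undefined, ring.zero = K, add = set_add N,
      smult = (\<lambda>a U. \<Union>x\<in>U. K +>\<^bsub>N\<^esub> (a \<odot>\<^bsub>N\<^esub> x))\<rparr>"

definition subquotient ::
    "('a, 'b, 'd) module_scheme \<Rightarrow> 'b set \<Rightarrow> 'b set \<Rightarrow> ('a, 'b set) module" where
  "subquotient N H K = quot_module (N\<lparr>carrier := H\<rparr>) K"

definition module_via :: "('a \<Rightarrow> 'b) \<Rightarrow> ('b, 'c) ring_scheme \<Rightarrow> ('a, 'b) module" where
  "module_via f B =
     \<lparr>carrier = carrier B, monoid.mult = monoid.mult B, one = \<one>\<^bsub>B\<^esub>, ring.zero = \<zero>\<^bsub>B\<^esub>, add = add B,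
      smult = (\<lambda>a b. f a \<otimes>\<^bsub>B\<^esub> b)\<rparr>"

abbreviation self_module :: "('a, 'c) ring_scheme \<Rightarrow> ('a, 'a) module" where
  "self_module R \<equiv> module_via (\<lambda>a. a) R"


section \<open>Localization\<close>

text \<open>The fraction \<open>x / s\<close> is the set of all pairs \<open>(y, t)\<close> equivalent to \<open>(x, s)\<close>.\<close>

definition frac ::
    "('a, 'c) ring_scheme \<Rightarrow> 'a set \<Rightarrow> ('a, 'b, 'd) module_scheme \<Rightarrow> 'b \<Rightarrow> 'a \<Rightarrow> ('b \<times> 'a) set" where
  "frac R S N x s =
     {(y, t). y \<in> carrier N \<and> t \<in> S \<and>
        (\<exists>u\<in>S. u \<odot>\<^bsub>N\<^esub> (t \<odot>\<^bsub>N\<^esub> x) = u \<odot>\<^bsub>N\<^esub> (s \<odot>\<^bsub>N\<^esub> y))}"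

definition loc_ring :: "('a, 'c) ring_scheme \<Rightarrow> 'a set \<Rightarrow> ('a \<times> 'a) set ring" where
  "loc_ring R S = (let fr = frac R S (self_module R) in
     \<lparr>carrier = {fr a s | a s. a \<in> carrier R \<and> s \<in> S},
      monoid.mult = (\<lambda>U Y. \<Union>(a, s)\<in>U. \<Union>(b, t)\<in>Y. fr (a \<otimes>\<^bsub>R\<^esub> b) (s \<otimes>\<^bsub>R\<^esub> t)),
      one = fr \<one>\<^bsub>R\<^esub> \<one>\<^bsub>R\<^esub>,
      ring.zero = fr \<zero>\<^bsub>R\<^esub> \<one>\<^bsub>R\<^esub>,
      add = (\<lambda>U Y. \<Union>(a, s)\<in>U. \<Union>(b, t)\<in>Y.
               fr ((t \<otimes>\<^bsub>R\<^esub> a) \<oplus>\<^bsub>R\<^esub> (s \<otimes>\<^bsub>R\<^esub> b)) (s \<otimes>\<^bsub>R\<^esub> t))\<rparr>)"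

definition loc_map :: "('a, 'c) ring_scheme \<Rightarrow> 'a set \<Rightarrow> 'a \<Rightarrow> ('a \<times> 'a) set" where
  "loc_map R S a = frac R S (self_module R) a \<one>\<^bsub>R\<^esub>"

definition loc_module ::
    "('a, 'c) ring_scheme \<Rightarrow> 'a set \<Rightarrow> ('a, 'b, 'd) module_scheme \<Rightarrow>
     (('a \<times> 'a) set, ('b \<times> 'a) set) module" where
  "loc_module R S N =
     \<lparr>carrier = {frac R S N x s | x s. x \<in> carrier N \<and> s \<in> S},
      monoid.mult = undefined, one = undefined,
      ring.zero = frac R S N \<zero>\<^bsub>N\<^esub> \<one>\<^bsub>R\<^esub>,
      add = (\<lambda>U Y. \<Union>(x, s)\<in>U. \<Union>(y, t)\<in>Y.
               frac R S N ((t \<odot>\<^bsub>N\<^esub> x) \<oplus>\<^bsub>N\<^esub> (s \<odot>\<^bsub>N\<^esub> y)) (s \<otimes>\<^bsub>R\<^esub> t)),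
      smult = (\<lambda>U Y. \<Union>(a, s)\<in>U. \<Union>(y, t)\<in>Y. frac R S N (a \<odot>\<^bsub>N\<^esub> y) (s \<otimes>\<^bsub>R\<^esub> t))\<rparr>"

abbreviation loc_at :: "('a, 'c) ring_scheme \<Rightarrow> 'a set \<Rightarrow> ('a \<times> 'a) set ring" where
  "loc_at R P \<equiv> loc_ring R (carrier R - P)"

abbreviation loc_module_at ::
    "('a, 'c) ring_scheme \<Rightarrow> 'a set \<Rightarrow> ('a, 'b, 'd) module_scheme \<Rightarrow>
     (('a \<times> 'a) set, ('b \<times> 'a) set) module" where
  "loc_module_at R P N \<equiv> loc_module R (carrier R - P) N"

definition ext_at :: "('a, 'c) ring_scheme \<Rightarrow> 'a set \<Rightarrow> 'a set \<Rightarrow> ('a \<times> 'a) set set" where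
  "ext_at R P I = Idl\<^bsub>loc_at R P\<^esub> (loc_map R (carrier R - P) ` I)"

definition residue_field :: "('a, 'c) ring_scheme \<Rightarrow> 'a set \<Rightarrow> ('a \<times> 'a) set set ring" where
  "residue_field R P = loc_at R P Quot ext_at R P P"

definition residue_map :: "('a, 'c) ring_scheme \<Rightarrow> 'a set \<Rightarrow> 'a \<Rightarrow> ('a \<times> 'a) set set" where
  "residue_map R P a = ext_at R P P +>\<^bsub>loc_at R P\<^esub> loc_map R (carrier R - P) a"


section \<open>Ideals, characteristic and Frobenius powers\<close>

definition has_characteristic :: "('a, 'c) ring_scheme \<Rightarrow> nat \<Rightarrow> bool" where
  "has_characteristic R p \<longleftrightarrow> (\<forall>n::nat. [n] \<cdot>\<^bsub>R\<^esub> \<one>\<^bsub>R\<^esub> = \<zero>\<^bsub>R\<^esub> \<longleftrightarrow> p dvd n)"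

definition local_ring :: "('a, 'c) ring_scheme \<Rightarrow> bool" where
  "local_ring S \<longleftrightarrow> cring S \<and> (\<exists>!m. maximalideal m S)"

definition frobenius_power :: "('a, 'c) ring_scheme \<Rightarrow> nat \<Rightarrow> 'a set \<Rightarrow> 'a set" where
  "frobenius_power R q I = Idl\<^bsub>R\<^esub> ((\<lambda>x. x [^]\<^bsub>R\<^esub> q) ` I)"

definition radical :: "('a, 'c) ring_scheme \<Rightarrow> 'a set \<Rightarrow> 'a set" where
  "radical R I = {x \<in> carrier R. \<exists>n::nat. x [^]\<^bsub>R\<^esub> n \<in> I}"

definition primaryideal :: "'a set \<Rightarrow> ('a, 'c) ring_scheme \<Rightarrow> bool" where
  "primaryideal Q R \<longleftrightarrow> ideal Q R \<and> Q \<noteq> carrier R \<and>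
     (\<forall>a\<in>carrier R. \<forall>b\<in>carrier R. a \<otimes>\<^bsub>R\<^esub> b \<in> Q \<longrightarrow> a \<in> Q \<or> b \<in> radical R Q)"

definition primary_pair ::
    "('a, 'c) ring_scheme \<Rightarrow> 'a set \<Rightarrow> 'a set \<Rightarrow> 'a set \<Rightarrow> bool" where
  "primary_pair S m I J \<longleftrightarrow>
     ideal J S \<and> I \<subseteq> J \<and> primaryideal I S \<and> radical S I = m"


section \<open>Algebras of finite type\<close>

definition finite_type ::
    "('a, 'c) ring_scheme \<Rightarrow> ('a \<Rightarrow> 'b) \<Rightarrow> ('b, 'd) ring_scheme \<Rightarrow> bool" where
  "finite_type A f B \<longleftrightarrow> cring B \<and> f \<in> ring_hom A B \<and>
     (\<exists>U. finite U \<and> U \<subseteq> carrier B \<and> generate_ring B (f ` carrier A \<union> U) = carrier B)"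

text \<open>Quantification over all algebras of finite type over a ring with elements in \<open>'a\<close> is expressed
  by quantification over rings with elements in \<open>(nat multiset \<Rightarrow> 'a) set\<close>. This covers all of them up
  to isomorphism: polynomials over \<open>A\<close> in the indeterminates \<open>X\<^sub>0, X\<^sub>1, \<dots>\<close> are functions from monomials,
  which are multisets of indices, to \<open>A\<close>, and an algebra of finite type is isomorphic to a ring of
  cosets of such polynomials.\<close>

type_synonym 'a ft_algebra = "(nat multiset \<Rightarrow> 'a) set ring"

definition essentially_finite_type :: "'a ring \<Rightarrow> ('b, 'd) ring_scheme \<Rightarrow> bool" where
  "essentially_finite_type A R \<longleftrightarrow>
     (\<exists>(B :: 'a ft_algebra) f S. finite_type A f B \<and> submonoid S B \<and> loc_ring B S \<simeq> R)"


section \<open>Regular rings\<close>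

definition regular_local_ring :: "('a, 'c) ring_scheme \<Rightarrow> bool" where
  "regular_local_ring S \<longleftrightarrow> noetherian_ring S \<and> local_ring S \<and>
     (\<exists>U. finite U \<and> U \<subseteq> carrier S \<and> enat (card U) = krull_dim S \<and> maximalideal (Idl\<^bsub>S\<^esub> U) S)"

definition regular_ring :: "('a, 'c) ring_scheme \<Rightarrow> bool" where
  "regular_ring S \<longleftrightarrow> cring S \<and> noetherian_ring S \<and>
     (\<forall>P. primeideal P S \<longrightarrow> regular_local_ring (loc_at S P))"


section \<open>Tensor products of algebras\<close>

text \<open>The integral monoid ring of \<open>G\<close>: finitely supported functions under convolution.\<close>

definition integral_monoid_ring :: "('a, 'c) monoid_scheme \<Rightarrow> ('a \<Rightarrow> int) ring" where
  "integral_monoid_ring G =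
     \<lparr>carrier = {h. finite {x. h x \<noteq> 0} \<and> {x. h x \<noteq> 0} \<subseteq> carrier G},
      monoid.mult = (\<lambda>g h z. \<Sum>x | g x \<noteq> 0. \<Sum>y | h y \<noteq> 0. if x \<otimes>\<^bsub>G\<^esub> y = z then g x * h y else 0),
      one = (\<lambda>z. if z = \<one>\<^bsub>G\<^esub> then 1 else 0),
      ring.zero = (\<lambda>z. 0),
      add = (\<lambda>g h z. g z + h z)\<rparr>"

definition pure_pair :: "'b \<Rightarrow> 'c \<Rightarrow> 'b \<times> 'c \<Rightarrow> int" where
  "pure_pair b c = (\<lambda>z. if z = (b, c) then 1 else 0)"

definition tensor_relations ::
    "('a, 'u) ring_scheme \<Rightarrow> ('a \<Rightarrow> 'b) \<Rightarrow> ('b, 'v) ring_scheme \<Rightarrow> ('a \<Rightarrow> 'c) \<Rightarrow> ('c, 'w) ring_scheme \<Rightarrow>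
     ('b \<times> 'c \<Rightarrow> int) set" where
  "tensor_relations R f B g C =
     {(\<lambda>z. pure_pair (b \<oplus>\<^bsub>B\<^esub> b') c z - pure_pair b c z - pure_pair b' c z) | b b' c.
        b \<in> carrier B \<and> b' \<in> carrier B \<and> c \<in> carrier C} \<union>
     {(\<lambda>z. pure_pair b (c \<oplus>\<^bsub>C\<^esub> c') z - pure_pair b c z - pure_pair b c' z) | b c c'.
        b \<in> carrier B \<and> c \<in> carrier C \<and> c' \<in> carrier C} \<union>
     {(\<lambda>z. pure_pair (f r \<otimes>\<^bsub>B\<^esub> b) c z - pure_pair b (g r \<otimes>\<^bsub>C\<^esub> c) z) | r b c.
        r \<in> carrier R \<and> b \<in> carrier B \<and> c \<in> carrier C}"

text \<open>The free abelian group on \<open>B \<times> C\<close> is the monoid ring of the multiplicative monoid of \<open>B \<times> C\<close>,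
  and the subgroup spanned by the bilinearity relations is an ideal of it; the quotient is
  the \<open>R\<close>-algebra \<open>B \<otimes>\<^sub>R C\<close>, where \<open>f\<close> and \<open>g\<close> are the structure maps of \<open>B\<close> and \<open>C\<close>.\<close>

definition tensor_ideal ::
    "('a, 'u) ring_scheme \<Rightarrow> ('a \<Rightarrow> 'b) \<Rightarrow> ('b, 'v) ring_scheme \<Rightarrow> ('a \<Rightarrow> 'c) \<Rightarrow> ('c, 'w) ring_scheme \<Rightarrow>
     ('b \<times> 'c \<Rightarrow> int) set" where
  "tensor_ideal R f B g C = Idl\<^bsub>integral_monoid_ring (B \<times>\<times> C)\<^esub> (tensor_relations R f B g C)"

definition tensor_ring ::
    "('a, 'u) ring_scheme \<Rightarrow> ('a \<Rightarrow> 'b) \<Rightarrow> ('b, 'v) ring_scheme \<Rightarrow> ('a \<Rightarrow> 'c) \<Rightarrow> ('c, 'w) ring_scheme \<Rightarrow>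
     ('b \<times> 'c \<Rightarrow> int) set ring" where
  "tensor_ring R f B g C = integral_monoid_ring (B \<times>\<times> C) Quot tensor_ideal R f B g C"

definition tensor_inr ::
    "('a, 'u) ring_scheme \<Rightarrow> ('a \<Rightarrow> 'b) \<Rightarrow> ('b, 'v) ring_scheme \<Rightarrow> ('a \<Rightarrow> 'c) \<Rightarrow> ('c, 'w) ring_scheme \<Rightarrow>
     'c \<Rightarrow> ('b \<times> 'c \<Rightarrow> int) set" where
  "tensor_inr R f B g C c =
     tensor_ideal R f B g C +>\<^bsub>integral_monoid_ring (B \<times>\<times> C)\<^esub> pure_pair \<one>\<^bsub>B\<^esub> c"


section \<open>Formal fibres and excellent rings\<close>

text \<open>The \<open>m\<close>-adic completion, as the inverse limit of the rings \<open>S / m\<^sup>n\<close>. An element is a sequence of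
  cosets, and compatibility of consecutive cosets is inclusion.\<close>

definition completion :: "('a, 'c) ring_scheme \<Rightarrow> 'a set \<Rightarrow> (nat \<Rightarrow> 'a set) ring" where
  "completion S m = (let Q = (\<lambda>n::nat. S Quot (m [^]\<^bsub>ideals_set S\<^esub> n)) in
     \<lparr>carrier = {x. \<forall>n. x n \<in> carrier (Q n) \<and> x (Suc n) \<subseteq> x n},
      monoid.mult = (\<lambda>x y n. x n \<otimes>\<^bsub>Q n\<^esub> y n),
      one = (\<lambda>n. \<one>\<^bsub>Q n\<^esub>),
      ring.zero = (\<lambda>n. \<zero>\<^bsub>Q n\<^esub>),
      add = (\<lambda>x y n. x n \<oplus>\<^bsub>Q n\<^esub> y n)\<rparr>)"

definition completion_map :: "('a, 'c) ring_scheme \<Rightarrow> 'a set \<Rightarrow> 'a \<Rightarrow> nat \<Rightarrow> 'a set" where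
  "completion_map S m a = (\<lambda>n. (m [^]\<^bsub>ideals_set S\<^esub> n) +>\<^bsub>S\<^esub> a)"

text \<open>A finite extension \<open>L\<close> of \<open>k\<close> is isomorphic to some \<open>k\<^sup>d\<close> as a vector space over \<open>k\<close>, so up to
  isomorphism its elements can be taken in \<open>nat \<Rightarrow> 'k\<close>.\<close>

definition geometrically_regular ::
    "('k, 'u) ring_scheme \<Rightarrow> ('k \<Rightarrow> 'b) \<Rightarrow> ('b, 'v) ring_scheme \<Rightarrow> bool" where
  "geometrically_regular k f S \<longleftrightarrow>
     (\<forall>(L :: (nat \<Rightarrow> 'k) ring) g.
        field L \<and> g \<in> ring_hom k L \<and> finitely_generated_module k (module_via g L) \<longrightarrow>
        regular_ring (tensor_ring k f S g L))"

text \<open>The fibre of \<open>S \<rightarrow> S\<^sup>^\<close> over \<open>Q\<close> is the tensor product of the completion with the residue field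
  of \<open>Q\<close>.\<close>

definition formal_fibres_geometrically_regular :: "('a, 'c) ring_scheme \<Rightarrow> 'a set \<Rightarrow> bool" where
  "formal_fibres_geometrically_regular S m \<longleftrightarrow>
     (\<forall>Q. primeideal Q S \<longrightarrow>
        geometrically_regular (residue_field S Q)
          (tensor_inr S (completion_map S m) (completion S m) (residue_map S Q) (residue_field S Q))
          (tensor_ring S (completion_map S m) (completion S m) (residue_map S Q) (residue_field S Q)))"

definition G_ring :: "('a, 'c) ring_scheme \<Rightarrow> bool" where
  "G_ring A \<longleftrightarrow> noetherian_ring A \<and>
     (\<forall>P. primeideal P A \<longrightarrow> formal_fibres_geometrically_regular (loc_at A P) (ext_at A P P))"

text \<open>\<open>J_1\<close>: the regular locus is open in the Zariski topology.\<close>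

definition J_1 :: "('a, 'c) ring_scheme \<Rightarrow> bool" where
  "J_1 B \<longleftrightarrow> noetherian_ring B \<and>
     (\<exists>I. ideal I B \<and>
        {P. primeideal P B \<and> regular_local_ring (loc_at B P)} = {P. primeideal P B \<and> \<not> I \<subseteq> P})"

definition J_2 :: "'a ring \<Rightarrow> bool" where
  "J_2 A \<longleftrightarrow> (\<forall>(B :: 'a ft_algebra) f. finite_type A f B \<longrightarrow> J_1 B)"

definition prime_chains :: "('a, 'c) ring_scheme \<Rightarrow> 'a set \<Rightarrow> 'a set \<Rightarrow> 'a set list set" where
  "prime_chains B P Q =
     {xs. xs \<noteq> [] \<and> sorted_wrt (\<subset>) xs \<and> (\<forall>U\<in>set xs. primeideal U B) \<and> hd xs = P \<and> last xs = Q}"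

definition maximal_prime_chains :: "('a, 'c) ring_scheme \<Rightarrow> 'a set \<Rightarrow> 'a set \<Rightarrow> 'a set list set" where
  "maximal_prime_chains B P Q =
     {xs \<in> prime_chains B P Q. \<not> (\<exists>ys \<in> prime_chains B P Q. set xs \<subset> set ys)}"

definition catenary :: "('a, 'c) ring_scheme \<Rightarrow> bool" where
  "catenary B \<longleftrightarrow>
     (\<forall>P Q. primeideal P B \<and> primeideal Q B \<and> P \<subseteq> Q \<longrightarrow>
        (\<exists>n. \<forall>xs \<in> prime_chains B P Q. length xs \<le> n) \<and>
        (\<forall>xs \<in> maximal_prime_chains B P Q. \<forall>ys \<in> maximal_prime_chains B P Q.
            length xs = length ys))"

definition universally_catenary :: "'a ring \<Rightarrow> bool" where
  "universally_catenary A \<longleftrightarrow> (\<forall>(B :: 'a ft_algebra) f. finite_type A f B \<longrightarrow> catenary B)"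

definition excellent_ring :: "'a ring \<Rightarrow> bool" where
  "excellent_ring A \<longleftrightarrow>
     cring A \<and> noetherian_ring A \<and> universally_catenary A \<and> G_ring A \<and> J_2 A"

end

theory Submission
  imports Defs
begin

text \<open>Of the excellence of \<open>A\<close> only two consequences are used: regular loci of finite type
  \<open>A\<close>-algebras are open, and such algebras are catenary. Let \<open>R\<close> be a localization of
  \<open>B\<close> of finite type over \<open>A\<close>.

  Filtering \<open>J/I\<close> with cyclic steps killed by \<open>P\<close>, a step \<open>J = I + (x)\<close> makes
  \<open>J\<^sup>[\<^sup>q\<^sup>]M/I\<^sup>[\<^sup>q\<^sup>]M\<close> generated by \<open>x\<^sup>q\<close> times generators of \<open>M\<close>, and these are killed by
  \<open>P\<^sup>[\<^sup>q\<^sup>]\<close> and by the annihilator \<open>a\<close> of \<open>M\<close>. So it suffices to bound the length of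
  \<open>B\<^sub>P/(a + P\<^sup>[\<^sup>q\<^sup>])\<close> by \<open>C q\<^sup>h\<close>, where \<open>h\<close> is the length of some chain of primes between \<open>a\<close> and
  \<open>P\<close>, with \<open>C\<close> independent of \<open>P\<close>. This is done by Noetherian induction on \<open>a\<close>. If \<open>x y \<in> a\<close>,
  the length is at most the sum of the lengths for \<open>a + (x)\<close> and \<open>a + (y)\<close>. If \<open>a\<close> is prime, there is
  \<open>f \<notin> a\<close> such that \<open>B\<^sub>P/a\<close> is regular whenever \<open>f \<notin> P\<close>: then \<open>P\<close> is generated by \<open>h\<close> elements
  modulo \<open>a\<close> and the length is at most \<open>q\<^sup>h\<close>. For \<open>f \<in> P\<close>, the powers \<open>f\<^sup>0, \<dots>, f\<^sup>q\<close> show that the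
  length is at most \<open>q\<close> times the one for \<open>a + (f)\<close>, while chains of primes above \<open>a + (f)\<close>
  can be prolonged by \<open>a\<close>.\<close>

section \<open>Filtrations of modules\<close>

text \<open>Lengths are not computed inside the argument. They are replaced by filtrations with
  \<open>n\<close> steps, each killed by the maximal ideal; these can be concatenated, pushed
  forward and padded, and are exchanged for lengths only at the two ends: the length of
  \<open>JR_P/IR_P\<close> becomes a filtration, and the resulting filtration becomes a bound on
  chains. The obstacle is that excellence speaks about finite type algebras over \<open>A\<close>,
  hence about \<open>B\<close>, whereas the theorem speaks about \<open>R_P\<close>. The estimates
  are therefore made for ideals and primes of \<open>B\<close>, and \<open>R_P\<close> enters only
  through a map from \<open>B\<close> that behaves like a localization at the contraction of
  \<open>P\<close>. The exponent is kept as the length of an explicit chain of primes of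
  \<open>B\<close> because such a chain survives in \<open>R_P/Ann(M_P)\<close>, which is the
  comparison with \<open>dim M_P\<close> that is wanted. Catenarity enters through the boundedness
  of chains of primes below a given prime; this makes \<open>dim M_P\<close> finite, so that
  \<open>the_enat\<close> of it has its intended value.\<close>

definition adjoin ::
    "('a, 'c) ring_scheme \<Rightarrow> ('a, 'b, 'd) module_scheme \<Rightarrow> 'b set \<Rightarrow> 'b \<Rightarrow> 'b set" where
  "adjoin R N L x = {l \<oplus>\<^bsub>N\<^esub> a \<odot>\<^bsub>N\<^esub> x | l a. l \<in> L \<and> a \<in> carrier R}"

text \<open>A certificate that \<open>H/K\<close> has length at most \<open>n\<close>: every step
  adjoins one element that \<open>m\<close> multiplies into the previous submodule. The new element
  may already lie there, so \<open>n\<close> is only an upper bound. What \<open>m\<close> has to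
  satisfy is left to the lemmas that compare filtrations with chains.\<close>

inductive filtration ::
    "('a, 'c) ring_scheme \<Rightarrow> ('a, 'b, 'd) module_scheme \<Rightarrow> 'a set \<Rightarrow> 'b set \<Rightarrow> 'b set \<Rightarrow> nat \<Rightarrow> bool"
  for R N m where
  base: "submodule K R N \<Longrightarrow> filtration R N m K K 0"
| step: "filtration R N m K L n \<Longrightarrow> x \<in> carrier N \<Longrightarrow> (\<And>a. a \<in> carrier R \<Longrightarrow> a \<in> m \<Longrightarrow> a \<odot>\<^bsub>N\<^esub> x \<in> L) \<Longrightarrow>
    filtration R N m K (adjoin R N L x) (Suc n)"

context module
begin

abbreviation module_add (infixl \<open>+\<^sub>M\<close> 65) where "x +\<^sub>M y \<equiv> x \<oplus>\<^bsub>M\<^esub> y"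
abbreviation module_smult (infixl \<open>*\<^sub>M\<close> 70) where "a *\<^sub>M x \<equiv> a \<odot>\<^bsub>M\<^esub> x"
abbreviation module_zero (\<open>0\<^sub>M\<close>) where "0\<^sub>M \<equiv> \<zero>\<^bsub>M\<^esub>"

lemma submodule_zero: "submodule H R M \<Longrightarrow> 0\<^sub>M \<in> H"
  using subgroup.one_closed[OF submodule.axioms(1)] by fastforce

lemma submodule_carrier: "submodule H R M \<Longrightarrow> x \<in> H \<Longrightarrow> x \<in> carrier M"
  using submoduleE(1) by blast

lemmas submodule_add = submoduleE(5)
lemmas submodule_smult = submoduleE(4)

lemma submodule_intro:
  assumes "H \<subseteq> carrier M" "0\<^sub>M \<in> H" "\<And>x y. x \<in> H \<Longrightarrow> y \<in> H \<Longrightarrow> x +\<^sub>M y \<in> H"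
    and smult: "\<And>a x. a \<in> carrier R \<Longrightarrow> x \<in> H \<Longrightarrow> a *\<^sub>M x \<in> H"
  shows "submodule H R M"
proof (rule submoduleI)
  fix x assume "x \<in> H"
  then show "\<ominus>\<^bsub>M\<^esub> x \<in> H"
    using smult[of "\<ominus> \<one>" x] assms(1) by (simp add: smult_l_minus subset_iff)
qed (use assms in auto)

lemma submodule_add_cancel:
  assumes "submodule H R M" "x \<in> H" "y \<in> carrier M" "x +\<^sub>M y \<in> H"
  shows "y \<in> H"
proof -
  have "\<ominus>\<^bsub>M\<^esub> x +\<^sub>M (x +\<^sub>M y) \<in> H"
    using submodule_add[OF assms(1) submoduleE(3)[OF assms(1,2)] assms(4)] .
  then show ?thesis
    using M.r_neg1[of x y] assms submodule_carrier by auto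
qed

lemma smult_add_swap:
  assumes "l \<in> carrier M" "l' \<in> carrier M" "a \<in> carrier R" "b \<in> carrier R" "x \<in> carrier M"
  shows "(l +\<^sub>M a *\<^sub>M x) +\<^sub>M (l' +\<^sub>M b *\<^sub>M x) = (l +\<^sub>M l') +\<^sub>M (a \<oplus> b) *\<^sub>M x"
  using assms by (simp add: smult_l_distr M.a_ac)

lemma adjoin_submodule:
  assumes L: "submodule L R M" and x: "x \<in> carrier M"
  shows "submodule (adjoin R M L x) R M"
proof (rule submodule_intro)
  note Lc = submodule_carrier[OF L]
  show "adjoin R M L x \<subseteq> carrier M"
    using Lc x by (auto simp: adjoin_def)
  have "0\<^sub>M = 0\<^sub>M +\<^sub>M \<zero> *\<^sub>M x" using x by simp
  then show "0\<^sub>M \<in> adjoin R M L x"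
    unfolding adjoin_def using submodule_zero[OF L] by blast
  fix a assume "a \<in> adjoin R M L x"
  then obtain l c where a: "a = l +\<^sub>M c *\<^sub>M x" "l \<in> L" "c \<in> carrier R"
    unfolding adjoin_def by blast
  { fix b assume "b \<in> adjoin R M L x"
    then obtain l' d where b: "b = l' +\<^sub>M d *\<^sub>M x" "l' \<in> L" "d \<in> carrier R"
      unfolding adjoin_def by blast
    have "a +\<^sub>M b = (l +\<^sub>M l') +\<^sub>M (c \<oplus> d) *\<^sub>M x"
      using a b x Lc smult_add_swap by simp
    then show "a +\<^sub>M b \<in> adjoin R M L x"
      unfolding adjoin_def using a b submodule_add[OF L] by blast }
  fix r assume r: "r \<in> carrier R"
  have "r *\<^sub>M a = r *\<^sub>M l +\<^sub>M (r \<otimes> c) *\<^sub>M x"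
    using r a x Lc by (simp add: smult_r_distr smult_assoc1)
  then show "r *\<^sub>M a \<in> adjoin R M L x"
    unfolding adjoin_def using a r submodule_smult[OF L] by blast
qed

lemma subset_adjoin:
  assumes "submodule L R M" "x \<in> carrier M"
  shows "L \<subseteq> adjoin R M L x"
proof
  fix l assume "l \<in> L"
  moreover from this have "l = l +\<^sub>M \<zero> *\<^sub>M x"
    using assms submodule_carrier by simp
  ultimately show "l \<in> adjoin R M L x" unfolding adjoin_def by blast
qed

lemma mem_adjoin:
  assumes "submodule L R M" "x \<in> carrier M"
  shows "x \<in> adjoin R M L x"
proof -
  have "x = 0\<^sub>M +\<^sub>M \<one> *\<^sub>M x" using assms by simp
  then show ?thesis unfolding adjoin_def using submodule_zero[OF assms(1)] by blast
qed

lemma adjoin_minimal: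
  assumes "submodule H R M" "L \<subseteq> H" "x \<in> H"
  shows "adjoin R M L x \<subseteq> H"
  using assms submodule_add submodule_smult unfolding adjoin_def by blast

lemma filtration_submodule:
  assumes "filtration R M m K H n"
  shows "submodule K R M \<and> submodule H R M \<and> K \<subseteq> H"
  using assms
  by induction (use adjoin_submodule subset_adjoin in blast)+

lemma filtration_trans:
  assumes "filtration R M m L H b" "filtration R M m K L a"
  shows "filtration R M m K H (a + b)"
  using assms by induction (auto intro: filtration.intros)

text \<open>Adjoining zero is an admissible step, so a filtration can be padded.\<close>

lemma filtration_mono:
  assumes "filtration R M m K H n" "n \<le> n'"
  shows "filtration R M m K H n'"
  using assms(2,1)
proof (induction rule: dec_induct)
  case (step k)
  then have f: "filtration R M m K H k" and H: "submodule H R M"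
    using filtration_submodule by blast+
  have "adjoin R M H 0\<^sub>M = H"
    using subset_adjoin[OF H] adjoin_minimal[OF H] submodule_zero[OF H] M.zero_closed by blast
  moreover have "filtration R M m K (adjoin R M H 0\<^sub>M) (Suc k)"
    using submodule_zero[OF H] by (intro filtration.step[OF f]) auto
  ultimately show ?case by simp
qed simp


lemma filtration_refl_mono: "submodule K R M \<Longrightarrow> filtration R M m K K n"
  using filtration_mono[OF filtration.base] by blast

lemma filtration_adjoin:
  assumes "submodule L R M" "x \<in> carrier M" "\<And>a. a \<in> carrier R \<Longrightarrow> a \<in> m \<Longrightarrow> a *\<^sub>M x \<in> L"
  shows "filtration R M m L (adjoin R M L x) 1"
  using filtration.step[OF filtration.base[OF assms(1)] assms(2,3)] by simp

lemma set_add_submodule: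
  assumes "submodule K R M" "submodule H R M"
  shows "submodule (K <+>\<^bsub>M\<^esub> H) R M"
proof (rule submodule_intro)
  note Kc = submodule_carrier[OF assms(1)] and Hc = submodule_carrier[OF assms(2)]
  show "K <+>\<^bsub>M\<^esub> H \<subseteq> carrier M"
    using Kc Hc by (auto simp: set_add_def')
  show "0\<^sub>M \<in> K <+>\<^bsub>M\<^esub> H"
    using assms[THEN submodule_zero] M.r_zero[OF M.zero_closed, symmetric]
    unfolding set_add_def' by blast
  fix a assume "a \<in> K <+>\<^bsub>M\<^esub> H"
  then obtain k h where a: "a = k +\<^sub>M h" "k \<in> K" "h \<in> H"
    unfolding set_add_def' by blast
  { fix b assume "b \<in> K <+>\<^bsub>M\<^esub> H"
    then obtain k' h' where b: "b = k' +\<^sub>M h'" "k' \<in> K" "h' \<in> H"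
      unfolding set_add_def' by blast
    have "a +\<^sub>M b = (k +\<^sub>M k') +\<^sub>M (h +\<^sub>M h')"
      using a b Kc Hc by (simp add: M.a_ac)
    then show "a +\<^sub>M b \<in> K <+>\<^bsub>M\<^esub> H"
      using submodule_add[OF assms(1) a(2) b(2)] submodule_add[OF assms(2) a(3) b(3)]
      unfolding set_add_def' by blast }
  fix r assume r: "r \<in> carrier R"
  then have "r *\<^sub>M a = r *\<^sub>M k +\<^sub>M r *\<^sub>M h"
    using a Kc Hc by (simp add: smult_r_distr)
  then show "r *\<^sub>M a \<in> K <+>\<^bsub>M\<^esub> H"
    using submodule_smult[OF assms(1) r a(2)] submodule_smult[OF assms(2) r a(3)]
    unfolding set_add_def' by blast
qed

lemma set_add_absorb:
  assumes "submodule H R M" "submodule K R M" "K \<subseteq> H"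
  shows "H <+>\<^bsub>M\<^esub> K = H"
proof -
  have "h = h +\<^sub>M 0\<^sub>M" if "h \<in> H" for h
    using that submodule_carrier[OF assms(1)] by simp
  then show ?thesis
    using assms submodule_add[OF assms(1)] submodule_zero[OF assms(2)]
    unfolding set_add_def' by blast
qed

end

text \<open>Forming \<open>U + f(L)\<close> commutes with adjoining an element:
  \<open>U + f(L + Rx) = (U + f(L)) + R f(x)\<close>. The offset \<open>U\<close> makes one
  statement cover both the passage from \<open>R\<close> to a cyclic module and the enlargement of
  the lower end of a filtration.\<close>

lemma filtration_image:
  fixes N :: "('a, 'b, 'd) module_scheme" and N' :: "('a, 'b', 'd') module_scheme"
  assumes N: "module R N" and N': "module R N'"
    and f: "\<And>x. x \<in> carrier N \<Longrightarrow> f x \<in> carrier N'"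
    and add: "\<And>x y. x \<in> carrier N \<Longrightarrow> y \<in> carrier N \<Longrightarrow> f (x \<oplus>\<^bsub>N\<^esub> y) = f x \<oplus>\<^bsub>N'\<^esub> f y"
    and smult: "\<And>a x. a \<in> carrier R \<Longrightarrow> x \<in> carrier N \<Longrightarrow> f (a \<odot>\<^bsub>N\<^esub> x) = a \<odot>\<^bsub>N'\<^esub> f x"
    and U: "submodule U R N'"
    and filt: "filtration R N m K H n"
  shows "filtration R N' m (U <+>\<^bsub>N'\<^esub> f ` K) (U <+>\<^bsub>N'\<^esub> f ` H) n"
proof -
  interpret N: module R N by (rule N)
  interpret N': module R N' by (rule N')
  have zero: "f \<zero>\<^bsub>N\<^esub> = \<zero>\<^bsub>N'\<^esub>"
    using smult[of "\<zero>\<^bsub>R\<^esub>" "\<zero>\<^bsub>N\<^esub>"] f by auto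
  have img: "submodule (f ` L) R N'" if L: "submodule L R N" for L
  proof -
    note Lc = N.submodule_carrier[OF L]
    show ?thesis
    proof (rule N'.submodule_intro)
      show "\<zero>\<^bsub>N'\<^esub> \<in> f ` L" using N.submodule_zero[OF L] zero by force
      show "f ` L \<subseteq> carrier N'" using f Lc by blast
    next
      fix y z assume "y \<in> f ` L" "z \<in> f ` L"
      then show "y \<oplus>\<^bsub>N'\<^esub> z \<in> f ` L"
        using add[OF Lc Lc] N.submodule_add[OF L] by force
    next
      fix a y assume "a \<in> carrier R" "y \<in> f ` L"
      then show "a \<odot>\<^bsub>N'\<^esub> y \<in> f ` L"
        using smult[OF _ Lc] N.submodule_smult[OF L] by force
    qed
  qed
  from filt show ?thesis
  proof induction
    case (base K)
    then show ?case by (intro filtration.base N'.set_add_submodule U img)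
  next
    case (step K L n x)
    then have L: "submodule L R N" and K: "submodule K R N"
      using N.filtration_submodule by blast+
    let ?L = "U <+>\<^bsub>N'\<^esub> f ` L"
    note Lc = N.submodule_carrier[OF L] and Uc = N'.submodule_carrier[OF U]
    have eq: "U <+>\<^bsub>N'\<^esub> f ` adjoin R N L x = adjoin R N' ?L (f x)"
    proof (intro equalityI subsetI)
      fix y assume "y \<in> U <+>\<^bsub>N'\<^esub> f ` adjoin R N L x"
      then obtain u l a where y: "u \<in> U" "l \<in> L" "a \<in> carrier R" "y = u \<oplus>\<^bsub>N'\<^esub> f (l \<oplus>\<^bsub>N\<^esub> a \<odot>\<^bsub>N\<^esub> x)"
        unfolding set_add_def' adjoin_def by blast
      then have "y = (u \<oplus>\<^bsub>N'\<^esub> f l) \<oplus>\<^bsub>N'\<^esub> a \<odot>\<^bsub>N'\<^esub> f x"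
        using Lc Uc step.hyps by (simp add: f add smult N'.M.a_assoc)
      then show "y \<in> adjoin R N' ?L (f x)"
        unfolding set_add_def' adjoin_def using y by blast
    next
      fix y assume "y \<in> adjoin R N' ?L (f x)"
      then obtain u l a where y: "u \<in> U" "l \<in> L" "a \<in> carrier R" "y = (u \<oplus>\<^bsub>N'\<^esub> f l) \<oplus>\<^bsub>N'\<^esub> a \<odot>\<^bsub>N'\<^esub> f x"
        unfolding set_add_def' adjoin_def by blast
      then have "y = u \<oplus>\<^bsub>N'\<^esub> f (l \<oplus>\<^bsub>N\<^esub> a \<odot>\<^bsub>N\<^esub> x)"
        using Lc Uc step.hyps by (simp add: f add smult N'.M.a_assoc)
      then show "y \<in> U <+>\<^bsub>N'\<^esub> f ` adjoin R N L x"
        unfolding set_add_def' adjoin_def using y by blast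
    qed
    show ?case
      unfolding eq
    proof (rule filtration.step[OF step.IH])
      show "f x \<in> carrier N'" using f step.hyps by blast
      fix a assume a: "a \<in> carrier R" "a \<in> m"
      then have "a \<odot>\<^bsub>N'\<^esub> f x = \<zero>\<^bsub>N'\<^esub> \<oplus>\<^bsub>N'\<^esub> f (a \<odot>\<^bsub>N\<^esub> x)"
        using step.hyps by (simp add: f smult)
      then show "a \<odot>\<^bsub>N'\<^esub> f x \<in> ?L"
        using step.hyps(3)[OF a] N'.submodule_zero[OF U] unfolding set_add_def' by blast
    qed
  qed
qed

text \<open>\<open>H/K'\<close> is a quotient of \<open>H/K\<close>: the identity is taken as the
  map and \<open>K'\<close> as the offset.\<close>

lemma (in module) filtration_enlarge:
  assumes "filtration R M m K H n" "submodule K' R M" "K \<subseteq> K'" "K' \<subseteq> H"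
  shows "filtration R M m K' H n"
proof -
  have K: "submodule K R M" and H: "submodule H R M"
    using filtration_submodule[OF assms(1)] by auto
  have "filtration R M m (K' <+>\<^bsub>M\<^esub> (\<lambda>x. x) ` K) (K' <+>\<^bsub>M\<^esub> (\<lambda>x. x) ` H) n"
    by (rule filtration_image[OF module_axioms module_axioms _ _ _ assms(2,1)]) auto
  moreover have "K' <+>\<^bsub>M\<^esub> H = H"
  proof
    show "K' <+>\<^bsub>M\<^esub> H \<subseteq> H"
      using submodule_add[OF H] assms(4) unfolding set_add_def' by blast
    show "H \<subseteq> K' <+>\<^bsub>M\<^esub> H"
    proof
      fix h assume "h \<in> H"
      moreover from this have "h = 0\<^sub>M +\<^sub>M h" using submodule_carrier[OF H] by simp
      ultimately show "h \<in> K' <+>\<^bsub>M\<^esub> H"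
        using submodule_zero[OF assms(2)] unfolding set_add_def' by blast
    qed
  qed
  ultimately show ?thesis
    using set_add_absorb[OF assms(2) K assms(3)] by simp
qed

section \<open>Ideals as submodules of the ring, and filtrations of cyclic modules\<close>

lemma self_module_simps [simp]:
  "carrier (self_module R) = carrier R" "add (self_module R) = add R"
  "\<zero>\<^bsub>self_module R\<^esub> = \<zero>\<^bsub>R\<^esub>" "a \<odot>\<^bsub>self_module R\<^esub> b = a \<otimes>\<^bsub>R\<^esub> b"
  by (simp_all add: module_via_def)

lemma (in cring) module_self_module: "module R (self_module R)"
proof (rule moduleI)
  show "abelian_group (self_module R)"
    proof (rule abelian_groupI)
    show "\<exists>y\<in>carrier (self_module R). y \<oplus>\<^bsub>self_module R\<^esub> x = \<zero>\<^bsub>self_module R\<^esub>"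
      if "x \<in> carrier (self_module R)" for x
      using l_neg[of x] a_inv_closed[of x] that by auto
  qed (auto simp: a_ac)
qed (auto simp: cring_axioms l_distr r_distr m_assoc)

lemma (in cring) a_inv_self_module: "x \<in> carrier R \<Longrightarrow> \<ominus>\<^bsub>self_module R\<^esub> x = \<ominus> x"
proof -
  interpret N: module R "self_module R" by (rule module_self_module)
  show "\<ominus>\<^bsub>self_module R\<^esub> x = \<ominus> x" if "x \<in> carrier R"
    using N.M.minus_equality[of "\<ominus> x" x] l_neg[of x] that by simp
qed

lemma (in cring) submodule_self_module_iff: "submodule I R (self_module R) \<longleftrightarrow> ideal I R"
proof
  interpret N: module R "self_module R" by (rule module_self_module)
  assume I: "submodule I R (self_module R)"
  note Ic = N.submodule_carrier[OF I, simplified]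
  show "ideal I R"
  proof (rule idealI)
    show "subgroup I (add_monoid R)"
      using Ic N.submodule_zero[OF I] N.submodule_add[OF I] N.submoduleE(3)[OF I] a_inv_self_module
      by (intro add.subgroupI) (auto simp flip: a_inv_def)
    fix a x assume "a \<in> I" "x \<in> carrier R"
    then show "x \<otimes> a \<in> I" "a \<otimes> x \<in> I"
      using N.submodule_smult[OF I, of x a] Ic m_comm by auto
  qed (rule ring_axioms)
next
  interpret N: module R "self_module R" by (rule module_self_module)
  assume "ideal I R"
  then interpret I: ideal I R .
  show "submodule I R (self_module R)"
    using I.Icarr I.I_l_closed by (intro N.submodule_intro) auto
qed

text \<open>\<open>(K + Rx)/K\<close> is an image of \<open>R/c\<close> under the map sending
  \<open>a\<close> to \<open>a x\<close>, so a filtration of \<open>R/c\<close> is carried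
  over.\<close>

lemma (in module) filtration_cyclic:
  assumes filt: "filtration R (self_module R) m c (carrier R) n"
    and K: "submodule K R M" and x: "x \<in> carrier M"
    and cx: "\<And>a. a \<in> c \<Longrightarrow> a *\<^sub>M x \<in> K"
  shows "filtration R M m K (adjoin R M K x) n"
proof -
  interpret S: module R "self_module R" by (rule module_self_module)
  have c: "ideal c R"
    using S.filtration_submodule[OF filt] submodule_self_module_iff by blast
  have "filtration R M m (K <+>\<^bsub>M\<^esub> (\<lambda>a. a *\<^sub>M x) ` c) (K <+>\<^bsub>M\<^esub> (\<lambda>a. a *\<^sub>M x) ` carrier R) n"
    using x by (intro filtration_image[OF S.module_axioms module_axioms _ _ _ K filt])
      (auto simp: smult_l_distr smult_assoc1)
  moreover have "K <+>\<^bsub>M\<^esub> (\<lambda>a. a *\<^sub>M x) ` c = K"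
  proof
    show "K <+>\<^bsub>M\<^esub> (\<lambda>a. a *\<^sub>M x) ` c \<subseteq> K"
      using submodule_add[OF K] cx unfolding set_add_def' by blast
    have "k = k +\<^sub>M \<zero> *\<^sub>M x" if "k \<in> K" for k
      using that x submodule_carrier[OF K] by simp
    moreover have "\<zero> \<in> c"
      using c by (simp add: additive_subgroup.zero_closed ideal.axioms(1))
    ultimately show "K \<subseteq> K <+>\<^bsub>M\<^esub> (\<lambda>a. a *\<^sub>M x) ` c"
      unfolding set_add_def' by blast
  qed
  moreover have "K <+>\<^bsub>M\<^esub> (\<lambda>a. a *\<^sub>M x) ` carrier R = adjoin R M K x"
    unfolding set_add_def' adjoin_def by blast
  ultimately show ?thesis by simp
qed

text \<open>One generator is adjoined at a time, and \<open>c\<close> still multiplies each of them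
  into the submodule reached so far. Minimality of \<open>H\<close> is recorded in place of a
  formula for the span.\<close>

lemma (in module) filtration_finite:
  assumes filt: "filtration R (self_module R) m c (carrier R) n"
    and K: "submodule K R M" and U: "finite U" "U \<subseteq> carrier M"
    and cU: "\<And>a u. a \<in> c \<Longrightarrow> u \<in> U \<Longrightarrow> a *\<^sub>M u \<in> K"
  obtains H where "filtration R M m K H (card U * n)" "U \<subseteq> H"
    "\<And>H'. submodule H' R M \<Longrightarrow> K \<subseteq> H' \<Longrightarrow> U \<subseteq> H' \<Longrightarrow> H \<subseteq> H'"
  using U cU
proof (induction arbitrary: thesis rule: finite_induct)
  case empty
  then show ?case using filtration.base[OF K] by force
next
  case (insert u U)
  obtain H where H: "filtration R M m K H (card U * n)" "U \<subseteq> H"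
    "\<And>H'. submodule H' R M \<Longrightarrow> K \<subseteq> H' \<Longrightarrow> U \<subseteq> H' \<Longrightarrow> H \<subseteq> H'"
    using insert by (metis insertCI insert_subset)
  have Hs: "submodule H R M" and KH: "K \<subseteq> H"
    using filtration_submodule[OF H(1)] by auto
  have u: "u \<in> carrier M" using insert by simp
  have "filtration R M m H (adjoin R M H u) n"
    using filtration_cyclic[OF filt Hs u] insert.prems(3) KH by blast
  from filtration_trans[OF this H(1)]
  have "filtration R M m K (adjoin R M H u) (card (insert u U) * n)"
    using insert.hyps by (simp add: add.commute)
  moreover have "insert u U \<subseteq> adjoin R M H u"
    using subset_adjoin[OF Hs u] mem_adjoin[OF Hs u] H(2) by blast
  moreover have "adjoin R M H u \<subseteq> H'" if "submodule H' R M" "K \<subseteq> H'" "insert u U \<subseteq> H'" for H'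
    using adjoin_minimal[OF that(1) H(3)] that by blast
  ultimately show ?case using insert.prems(1) by blast
qed

lemma (in cring) adjoin_self_module:
  assumes "ideal c R" "f \<in> carrier R"
  shows "adjoin R (self_module R) c f = Idl (insert f c)"
proof -
  interpret S: module R "self_module R" by (rule module_self_module)
  have c: "submodule c R (self_module R)" using assms submodule_self_module_iff by blast
  have sub: "insert f c \<subseteq> carrier R" using assms(2) ideal.Icarr[OF assms(1)] by blast
  have "ideal (adjoin R (self_module R) c f) R"
    using S.adjoin_submodule[OF c] assms submodule_self_module_iff by simp
  moreover have "insert f c \<subseteq> adjoin R (self_module R) c f"
    using S.subset_adjoin[OF c, of f] S.mem_adjoin[OF c, of f] assms by simp
  ultimately have "Idl (insert f c) \<subseteq> adjoin R (self_module R) c f"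
    by (rule genideal_minimal)
  moreover have "adjoin R (self_module R) c f \<subseteq> Idl (insert f c)"
    using S.adjoin_minimal[of "Idl (insert f c)" c f] genideal_ideal[OF sub] genideal_self[OF sub]
      submodule_self_module_iff by simp
  ultimately show ?thesis by blast
qed

text \<open>Between \<open>c\<close> and \<open>R\<close> lie the ideals \<open>c + (f^i)\<close>.
  The quotient of the one for \<open>i\<close> by the one for \<open>i + 1\<close> is generated by
  \<open>f^i\<close> and killed by \<open>c + (f)\<close>, so it takes \<open>n\<close> steps; there
  are \<open>q\<close> such quotients because \<open>f^q\<close> is already in
  \<open>c\<close>.\<close>

lemma (in cring) filtration_power:
  assumes filt: "filtration R (self_module R) m (Idl (insert f c)) (carrier R) n"
    and c: "ideal c R" and f: "f \<in> carrier R" and fq: "f [^] q \<in> c"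
  shows "filtration R (self_module R) m c (carrier R) (q * n)"
proof -
  interpret S: module R "self_module R" by (rule module_self_module)
  interpret c: ideal c R by (rule c)
  note [simp del] = nat_pow_Suc
  let ?c = "\<lambda>i::nat. Idl (insert (f [^] i) c)"
  have sub: "insert (f [^] i) c \<subseteq> carrier R" for i :: nat using f c.Icarr by auto
  have id: "ideal (?c i) R" and sup: "insert (f [^] i) c \<subseteq> ?c i" for i
    using genideal_ideal[OF sub] genideal_self[OF sub] by auto
  have "filtration R (self_module R) m (?c i) (carrier R) (i * n)" for i
  proof (induction i)
    case 0
    have "?c 0 = carrier R" using id[of 0] sup[of 0] by (simp add: ideal.one_imp_carrier)
    then show ?case using filtration.base S.carrier_is_submodule by fastforce
  next
    case (Suc i)
    have "a \<otimes> f [^] i \<in> ?c (Suc i)" if "a \<in> Idl (insert f c)" for a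
    proof -
      have "a \<in> adjoin R (self_module R) c f"
        using adjoin_self_module[OF c f] that by simp
      then obtain l b where a: "l \<in> c" "b \<in> carrier R" "a = l \<oplus> b \<otimes> f"
        unfolding adjoin_def by auto
      have "a \<otimes> f [^] i = l \<otimes> f [^] i \<oplus> b \<otimes> f [^] Suc i"
        using a f c.Icarr m_comm[of f "f [^] i"] by (simp add: l_distr m_assoc nat_pow_Suc)
      moreover have "l \<otimes> f [^] i \<in> ?c (Suc i)"
        using a f sup[of "Suc i"] c.I_r_closed by auto
      moreover have "b \<otimes> f [^] Suc i \<in> ?c (Suc i)"
        using ideal.I_l_closed[OF id] sup[of "Suc i"] a by blast
      ultimately show ?thesis
        using additive_subgroup.a_closed[OF ideal.axioms(1)[OF id[of "Suc i"]]] by simp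
    qed
    then have "filtration R (self_module R) m (?c (Suc i)) (adjoin R (self_module R) (?c (Suc i)) (f [^] i)) n"
      using S.filtration_cyclic[OF filt, of "?c (Suc i)" "f [^] i"] id[of "Suc i"] f submodule_self_module_iff by simp
    moreover have "adjoin R (self_module R) (?c (Suc i)) (f [^] i) = ?c i"
    proof -
      have "f [^] Suc i \<in> ?c i"
        using ideal.I_r_closed[OF id[of i]] sup[of i] f by (simp add: nat_pow_Suc)
      then have "?c (Suc i) \<subseteq> ?c i"
        using genideal_minimal[OF id[of i], of "insert (f [^] Suc i) c"] sup[of i] by blast
      then have "Idl (insert (f [^] i) (?c (Suc i))) \<subseteq> ?c i"
        using genideal_minimal[OF id[of i], of "insert (f [^] i) (?c (Suc i))"] sup[of i] by blast
      moreover have "?c i \<subseteq> Idl (insert (f [^] i) (?c (Suc i)))"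
      proof -
        have *: "insert (f [^] i) (?c (Suc i)) \<subseteq> carrier R" using f ideal.Icarr[OF id] by blast
        show ?thesis
          using genideal_minimal[OF genideal_ideal[OF *], of "insert (f [^] i) c"] genideal_self[OF *] sup[of "Suc i"]
          by blast
      qed
      ultimately show ?thesis
        using adjoin_self_module[OF id[of "Suc i"] nat_pow_closed[OF f, of i]] by (metis subset_antisym)
    qed
    ultimately show ?case
      using S.filtration_trans[OF Suc.IH] by simp
  qed
  moreover have "?c q = c"
  proof
    show "?c q \<subseteq> c" using genideal_minimal[OF c, of "insert (f [^] q) c"] fq by blast
    show "c \<subseteq> ?c q" using sup by blast
  qed
  ultimately show ?thesis by metis
qed

lemma (in cring) Idl_insert_Idl:
  assumes "A \<subseteq> carrier R" "B \<subseteq> carrier R"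
  shows "Idl (A \<union> Idl B) = Idl (A \<union> B)"
proof
  have AB: "A \<union> B \<subseteq> carrier R" using assms by blast
  have I: "ideal (Idl (A \<union> B)) R" "A \<union> B \<subseteq> Idl (A \<union> B)"
    using genideal_ideal[OF AB] genideal_self[OF AB] by auto
  have "Idl B \<subseteq> Idl (A \<union> B)" using genideal_minimal[OF I(1)] I(2) by blast
  then show "Idl (A \<union> Idl B) \<subseteq> Idl (A \<union> B)" using genideal_minimal[OF I(1)] I(2) by blast
  have *: "A \<union> Idl B \<subseteq> carrier R" using assms ideal.Icarr[OF genideal_ideal[OF assms(2)]] by blast
  show "Idl (A \<union> B) \<subseteq> Idl (A \<union> Idl B)"
    using genideal_minimal[OF genideal_ideal[OF *]] genideal_self[OF *] genideal_self[OF assms(2)] by blast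
qed

text \<open>Each \<open>f\<close> in \<open>F\<close> costs a factor \<open>q\<close>. The
  hypothesis on \<open>q\<close>-th powers passes to the larger ideal \<open>c + (f)\<close>, to
  which the induction hypothesis is applied.\<close>

lemma (in cring) filtration_powers:
  assumes "finite F" "F \<subseteq> carrier R" "ideal c R" "\<And>f. f \<in> F \<Longrightarrow> f [^] q \<in> c"
    and "filtration R (self_module R) m (Idl (c \<union> F)) (carrier R) n"
  shows "filtration R (self_module R) m c (carrier R) (q ^ card F * n)"
  using assms
proof (induction F arbitrary: c rule: finite_induct)
  case empty
  moreover have "Idl c = c" using genideal_minimal[OF empty(2)] genideal_self[of c] ideal.Icarr[OF empty(2)] by blast
  ultimately show ?case by simp
next
  case (insert f F)
  interpret c: ideal c R by (rule insert)
  have fc: "insert f c \<subseteq> carrier R" using insert.prems c.Icarr by auto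
  have "Idl (Idl (insert f c) \<union> F) = Idl (c \<union> insert f F)"
    using Idl_insert_Idl[of F "insert f c"] fc insert.prems by (simp add: Un_commute)
  then have "filtration R (self_module R) m (Idl (insert f c)) (carrier R) (q ^ card F * n)"
    using insert.prems genideal_self[OF fc] by (intro insert.IH genideal_ideal[OF fc]) auto
  then have "filtration R (self_module R) m c (carrier R) (q * (q ^ card F * n))"
    by (rule filtration_power) (use insert.prems in auto)
  then show ?case using insert.hyps by (simp add: mult.assoc)
qed


section \<open>Chains of submodules and length\<close>

lemma chain_height_leI:
  assumes "\<And>xs. sorted_wrt (\<subset>) xs \<Longrightarrow> set xs \<subseteq> F \<Longrightarrow> length xs \<le> Suc n"
  shows "chain_height F \<le> enat n"
  unfolding chain_height_def using assms by (intro Sup_least) force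

lemma chain_height_geI:
  assumes "sorted_wrt (\<subset>) xs" "set xs \<subseteq> F" "length xs = Suc n"
  shows "enat n \<le> chain_height F"
  unfolding chain_height_def using assms by (intro Sup_upper) blast

lemma chain_height_leD:
  assumes "chain_height F \<le> enat n" "sorted_wrt (\<subset>) xs" "set xs \<subseteq> F"
  shows "length xs \<le> Suc n"
proof (cases xs)
  case (Cons y ys)
  then have "enat (length ys) \<le> chain_height F"
    by (intro chain_height_geI[OF assms(2,3)]) simp
  with assms(1) have "enat (length ys) \<le> enat n" by (rule order_trans[rotated])
  then show ?thesis using Cons by simp
qed simp

text \<open>A nonempty set of extended naturals with finite supremum is finite, so the supremum is a
  member. For empty \<open>F\<close> the height is 0 as well, but there is no chain with one member,
  hence the second assumption.\<close>

lemma chain_height_attained: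
  assumes "chain_height F = enat n" "F \<noteq> {}"
  obtains xs where "sorted_wrt (\<subset>) xs" "set xs \<subseteq> F" "length xs = Suc n"
proof -
  let ?A = "{enat n | n. \<exists>xs. length xs = Suc n \<and> sorted_wrt (\<subset>) xs \<and> set xs \<subseteq> F}"
  obtain X0 where "X0 \<in> F" using assms by blast
  then have "enat 0 \<in> ?A" by (force intro: exI[of _ "[X0]"])
  then have ne: "?A \<noteq> {}" by blast
  then have "finite ?A"
    using assms(1) unfolding chain_height_def Sup_enat_def by (auto split: if_splits)
  with ne have "Sup ?A \<in> ?A"
    unfolding Sup_enat_def using Max_in[of ?A] by presburger
  then have "enat n \<in> ?A" using assms(1) unfolding chain_height_def by simp
  then show thesis using that by blast
qed

lemma chain_height_map_le:
  assumes "\<And>A. A \<in> F \<Longrightarrow> f A \<in> G"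
    and "\<And>A B. A \<in> F \<Longrightarrow> B \<in> F \<Longrightarrow> A \<subset> B \<Longrightarrow> f A \<subset> f B"
  shows "chain_height F \<le> chain_height G"
proof -
  have "enat n \<le> chain_height G" if xs: "length xs = Suc n" "sorted_wrt (\<subset>) xs" "set xs \<subseteq> F" for n xs
  proof (rule chain_height_geI)
    show "sorted_wrt (\<subset>) (map f xs)"
      unfolding sorted_wrt_map
      by (rule sorted_wrt_mono_rel[OF _ xs(2)], rule assms(2)) (use xs(3) in auto)
  qed (use assms(1) xs in auto)
  then show ?thesis unfolding chain_height_def[of F] by (intro Sup_least) auto
qed

context module
begin

text \<open>Each step of the filtration accounts for at most one member of a chain, because
  \<open>(L + Rx)/L\<close> is zero or simple when the elements outside \<open>m\<close> are units.
  The members contained in \<open>L\<close> are kept, the first member \<open>v\<close> outside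
  \<open>L\<close> is dropped, and the later ones are replaced by their traces on \<open>L\<close>;
  the induction hypothesis applies to the result.\<close>

lemma chain_length_le_filtration:
  assumes "filtration R M m K H n" "\<And>t. t \<in> carrier R \<Longrightarrow> t \<notin> m \<Longrightarrow> t \<in> Units R"
    and "sorted_wrt (\<subset>) xs" "\<And>A. A \<in> set xs \<Longrightarrow> submodule A R M \<and> K \<subseteq> A \<and> A \<subseteq> H"
  shows "length xs \<le> Suc n"
  using assms(1,3,4)
proof (induction arbitrary: xs)
  case (base K)
  show ?case
  proof (rule ccontr)
    assume "\<not> length xs \<le> Suc 0"
    then obtain A B ys where "xs = A # B # ys" by (cases xs rule: remdups_adj.cases) auto
    then have "A \<subset> B" "A = K" "B = K"
      using base.prems(1) base.prems(2)[of A] base.prems(2)[of B] by auto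
    then show False by blast
  qed
next
  case (step K L n x)
  have L: "submodule L R M" and KL: "K \<subseteq> L"
    using filtration_submodule[OF step.hyps(1)] by auto
  define us where "us = takeWhile (\<lambda>A. A \<subseteq> L) xs"
  have us: "set us \<subseteq> set xs" "\<And>A. A \<in> set us \<Longrightarrow> A \<subseteq> L"
    unfolding us_def by (auto dest: set_takeWhileD)
  show ?case
  proof (cases "dropWhile (\<lambda>A. A \<subseteq> L) xs")
    case Nil
    then have "\<And>A. A \<in> set xs \<Longrightarrow> A \<subseteq> L" by simp
    then show ?thesis using step.IH[of xs] step.prems by fastforce
  next
    case (Cons v vs)
    then have xs: "xs = us @ v # vs"
      unfolding us_def by (metis takeWhile_dropWhile_id)
    have v: "\<not> v \<subseteq> L" using hd_dropWhile[of "\<lambda>A. A \<subseteq> L" xs] Cons by simp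
    \<comment> \<open>beyond the first member outside \<open>L\<close>, traces on \<open>L\<close> still increase strictly\<close>
    have cut: "A \<inter> L \<subset> B \<inter> L"
      if A: "submodule A R M" "\<not> A \<subseteq> L" and B: "submodule B R M" "A \<subset> B" "A \<subseteq> adjoin R M L x" "B \<subseteq> adjoin R M L x" for A B
    proof -
      obtain y where y: "y \<in> A" "y \<notin> L" using A by blast
      then obtain l a where la: "y = l +\<^sub>M a *\<^sub>M x" "l \<in> L" "a \<in> carrier R"
        using B(3) unfolding adjoin_def by blast
      \<comment> \<open>If \<open>a\<close> were in \<open>m\<close>, then \<open>a x\<close>, and
        with it \<open>y\<close>, would lie in \<open>L\<close>.\<close>
      have "a \<notin> m"
        using la y step.hyps(3) submodule_add[OF L] by auto
      then have a: "a \<in> Units R" using assms(2) la by blast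
      obtain b where b: "b \<in> B" "b \<notin> A" using B(2) by blast
      then obtain l' c where lc: "b = l' +\<^sub>M c *\<^sub>M x" "l' \<in> L" "c \<in> carrier R"
        using B(4) unfolding adjoin_def by blast
      note Lc = submodule_carrier[OF L]
      \<comment> \<open>The multiple \<open>d y\<close> cancels the \<open>x\<close>-part of
        \<open>b\<close>, so \<open>b + d y\<close> lies in \<open>L\<close>, while it stays in
        \<open>B\<close> and outside \<open>A\<close>.\<close>
      define d where "d = \<ominus> (c \<otimes> inv a)"
      have d: "d \<in> carrier R" using a lc by (simp add: d_def)
      have "d \<otimes> a = \<ominus> c"
        using a lc la(3) by (simp add: d_def R.l_minus R.m_assoc)
      then have "d *\<^sub>M y = d *\<^sub>M l +\<^sub>M (\<ominus> c) *\<^sub>M x"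
        using la d Lc step.hyps(2) by (simp add: smult_r_distr flip: smult_assoc1)
      moreover have "c *\<^sub>M x +\<^sub>M (\<ominus> c) *\<^sub>M x = 0\<^sub>M"
        using lc step.hyps(2) by (simp add: smult_l_minus M.r_neg)
      ultimately have "b +\<^sub>M d *\<^sub>M y = l' +\<^sub>M d *\<^sub>M l"
        using smult_add_swap[of l' "d *\<^sub>M l" c "\<ominus> c" x] lc d la Lc step.hyps(2)
        by (simp add: R.r_neg)
      then have inL: "b +\<^sub>M d *\<^sub>M y \<in> L"
        using submodule_add[OF L lc(2) submodule_smult[OF L d la(2)]] by simp
      have dy: "d *\<^sub>M y \<in> A" using submodule_smult[OF A(1) d y(1)] .
      have "b +\<^sub>M d *\<^sub>M y \<in> B"
        using submodule_add[OF B(1) b(1)] dy B(2) by blast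
      moreover have "b +\<^sub>M d *\<^sub>M y \<notin> A"
        using submodule_add_cancel[OF A(1) dy, of b] b submodule_carrier[OF B(1)] submodule_carrier[OF A(1) dy] M.a_comm by auto
      ultimately show ?thesis using inL B(2) by blast
    qed
    have "length (us @ map (\<lambda>A. A \<inter> L) vs) \<le> Suc n"
    proof (rule step.IH)
      have sorted: "sorted_wrt (\<subset>) us" "sorted_wrt (\<subset>) vs" "\<And>A. A \<in> set vs \<Longrightarrow> v \<subset> A"
        "\<And>A. A \<in> set us \<Longrightarrow> A \<subset> v"
        using step.prems(1) unfolding xs by (auto simp: sorted_wrt_append)
      have mem: "submodule A R M" "K \<subseteq> A" "A \<subseteq> adjoin R M L x" if "A \<in> set us \<union> insert v (set vs)" for A
        using step.prems(2)[of A] that unfolding xs by auto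
      have "sorted_wrt (\<lambda>A B. A \<inter> L \<subset> B \<inter> L) vs"
      proof (rule sorted_wrt_mono_rel[OF _ sorted(2)])
        fix A B assume AB: "A \<in> set vs" "B \<in> set vs" "A \<subset> B"
        then show "A \<inter> L \<subset> B \<inter> L"
          using cut[of A B] mem[of A] mem[of B] sorted(3)[of A] v by blast
      qed
      then have "sorted_wrt (\<subset>) (map (\<lambda>A. A \<inter> L) vs)"
        unfolding sorted_wrt_map .
      moreover have "A \<subset> B \<inter> L" if "A \<in> set us" "B \<in> set vs" for A B
      proof -
        have "v \<inter> L \<subset> B \<inter> L"
          using cut[of v B] mem[of v] mem[of B] sorted(3)[of B] v that by blast
        then show ?thesis using us(2)[OF that(1)] sorted(4)[OF that(1)] by blast
      qed
      ultimately show "sorted_wrt (\<subset>) (us @ map (\<lambda>A. A \<inter> L) vs)"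
        using sorted(1) by (auto simp: sorted_wrt_append)
      have int: "submodule (A \<inter> L) R M" if "submodule A R M" for A
      proof (rule submodule_intro)
        show "A \<inter> L \<subseteq> carrier M" using submoduleE(1)[OF L] by blast
        show "0\<^sub>M \<in> A \<inter> L" using submodule_zero[OF L] submodule_zero[OF that] by blast
        show "a +\<^sub>M b \<in> A \<inter> L" if "a \<in> A \<inter> L" "b \<in> A \<inter> L" for a b
          using that submodule_add[OF L, of a b] submodule_add[OF \<open>submodule A R M\<close>, of a b] by simp
        show "r *\<^sub>M a \<in> A \<inter> L" if "r \<in> carrier R" "a \<in> A \<inter> L" for r a
          using that submodule_smult[OF L, of r a] submodule_smult[OF \<open>submodule A R M\<close>, of r a] by simp
      qed
      show "submodule A R M \<and> K \<subseteq> A \<and> A \<subseteq> L" if Ain: "A \<in> set (us @ map (\<lambda>A. A \<inter> L) vs)" for A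
      proof (cases "A \<in> set us")
        case True
        then show ?thesis using mem[of A] us(2)[of A] by simp
      next
        case False
        then obtain B where "B \<in> set vs" "A = B \<inter> L" using Ain by auto
        then show ?thesis using mem[of B] int[of B] KL by auto
      qed
    qed
    then show ?thesis by (simp add: xs)
  qed
qed

text \<open>The converse of \<open>chain_length_le_filtration\<close>. A longest chain of submodules
  strictly below \<open>H\<close> ends in some \<open>L\<close> with no submodule properly between
  \<open>L\<close> and \<open>H\<close>. Any \<open>x\<close> in \<open>H\<close> outside
  \<open>L\<close> then generates \<open>H\<close> over \<open>L\<close>, and chains below
  \<open>L\<close> are shorter by one because \<open>H\<close> extends them.\<close>

lemma filtration_if_chain_length_le:
  assumes m: "ideal m R" "\<one> \<notin> m" "\<And>t. t \<in> carrier R \<Longrightarrow> t \<notin> m \<Longrightarrow> t \<in> Units R"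
    and K: "submodule K R M"
    and "submodule H R M" "K \<subseteq> H"
    and "\<And>xs. sorted_wrt (\<subset>) xs \<Longrightarrow> (\<And>A. A \<in> set xs \<Longrightarrow> submodule A R M \<and> K \<subseteq> A \<and> A \<subseteq> H) \<Longrightarrow> length xs \<le> Suc n"
  shows "filtration R M m K H n"
  using assms(5-)
proof (induction n arbitrary: H)
  case 0
  have "K = H"
  proof (rule ccontr)
    assume "K \<noteq> H"
    then show False using "0.prems"(3)[of "[K, H]"] "0.prems"(1,2) K by auto
  qed
  then show ?case using K filtration.base by blast
next
  case (Suc n)
  show ?case
  proof (cases "K = H")
    case True
    then show ?thesis using K filtration_refl_mono by blast
  next
    case False
    \<comment> \<open>The nonempty chains strictly below \<open>H\<close>: \<open>[K]\<close> is one
      of them and their lengths are bounded, so a longest one exists.\<close>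
    define P where "P xs \<longleftrightarrow> xs \<noteq> [] \<and> sorted_wrt (\<subset>) xs \<and> (\<forall>A\<in>set xs. submodule A R M \<and> K \<subseteq> A \<and> A \<subset> H)" for xs
    have "P [K]" using False Suc.prems K unfolding P_def by auto
    moreover have "\<forall>xs. P xs \<longrightarrow> length xs < Suc (Suc (Suc n))"
      using Suc.prems(3) unfolding P_def by (meson le_imp_less_Suc psubset_imp_subset)
    ultimately obtain xs where xs: "P xs" "\<And>ys. P ys \<Longrightarrow> length ys \<le> length xs"
      using ex_has_greatest_nat[of P _ length] by blast
    define L where "L = last xs"
    have Lin: "L \<in> set xs" and L: "submodule L R M" "K \<subseteq> L" "L \<subset> H"
      using xs(1) unfolding P_def L_def by auto
    have topL: "A \<subseteq> L" if "A \<in> set xs" for A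
    proof -
      have "xs = butlast xs @ [L]" using xs(1) unfolding P_def L_def by simp
      then have "sorted_wrt (\<subset>) (butlast xs @ [L])" "A \<in> set (butlast xs @ [L])"
        using xs(1) that unfolding P_def by auto
      then show ?thesis by (auto simp: sorted_wrt_append)
    qed
    have max: "adjoin R M L y = H" if y: "y \<in> H" "y \<notin> L" for y
    proof (rule ccontr)
      have yc: "y \<in> carrier M" using y Suc.prems(1) submodule_carrier by blast
      assume "adjoin R M L y \<noteq> H"
      then have "adjoin R M L y \<subset> H" using adjoin_minimal[OF Suc.prems(1), of L y] L y by blast
      moreover have "L \<subset> adjoin R M L y"
        using subset_adjoin[OF L(1) yc] mem_adjoin[OF L(1) yc] y by blast
      ultimately have "P (xs @ [adjoin R M L y])"
        using xs(1) adjoin_submodule[OF L(1) yc] L(2) topL unfolding P_def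
        by (auto simp: sorted_wrt_append) blast+
      then show False using xs(2) by fastforce
    qed
    obtain x where x: "x \<in> H" "x \<notin> L" using L by blast
    then have xc: "x \<in> carrier M" using Suc.prems(1) submodule_carrier by blast
    have KL: "filtration R M m K L n"
    proof (rule Suc.IH)
      fix ys assume ys: "sorted_wrt (\<subset>) ys" "\<And>A. A \<in> set ys \<Longrightarrow> submodule A R M \<and> K \<subseteq> A \<and> A \<subseteq> L"
      have "length (ys @ [H]) \<le> Suc (Suc n)"
        by (rule Suc.prems(3)) (use ys L Suc.prems in \<open>auto simp: sorted_wrt_append\<close>, blast+)
      then show "length ys \<le> Suc n" by simp
    qed (use L in auto)
    \<comment> \<open>Nakayama's argument: otherwise \<open>x = l + b a x\<close> with
      \<open>l\<close> in \<open>L\<close>, and \<open>1 - b a\<close> is outside \<open>m\<close>,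
      hence a unit, which forces \<open>x\<close> into \<open>L\<close>.\<close>
    have mx: "a *\<^sub>M x \<in> L" if a: "a \<in> carrier R" "a \<in> m" for a
    proof (rule ccontr)
      assume "a *\<^sub>M x \<notin> L"
      then have "x \<in> adjoin R M L (a *\<^sub>M x)"
        using max submodule_smult[OF Suc.prems(1) a(1) x(1)] x by blast
      then obtain l b where l: "l \<in> L" "b \<in> carrier R" "x = l +\<^sub>M b *\<^sub>M (a *\<^sub>M x)"
        unfolding adjoin_def by blast
      define u where "u = \<one> \<ominus> b \<otimes> a"
      have uc: "u \<in> carrier R" using l a by (simp add: u_def)
      have ba: "b \<otimes> a \<in> m" using ideal.I_l_closed[OF m(1) a(2) l(2)] .
      have "u \<notin> m"
      proof
        assume "u \<in> m"
        then have "u \<oplus> b \<otimes> a \<in> m" using ba additive_subgroup.a_closed[OF ideal.axioms(1)[OF m(1)]] by blast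
        moreover have "u \<oplus> b \<otimes> a = \<one>" using l a unfolding u_def by (simp add: R.minus_eq R.a_assoc R.l_neg)
        ultimately show False using m(2) by simp
      qed
      then have u: "u \<in> Units R" using m(3) uc by blast
      have "u *\<^sub>M x = x +\<^sub>M \<ominus>\<^bsub>M\<^esub> (b *\<^sub>M (a *\<^sub>M x))"
        using l a xc unfolding u_def by (simp add: R.minus_eq smult_l_distr smult_l_minus smult_assoc1)
      also have "\<dots> = (l +\<^sub>M b *\<^sub>M (a *\<^sub>M x)) +\<^sub>M \<ominus>\<^bsub>M\<^esub> (b *\<^sub>M (a *\<^sub>M x))"
        using l(3) by simp
      also have "\<dots> = l"
        using l(1,2) a xc submodule_carrier[OF L(1)] by (simp add: M.a_assoc M.r_neg)
      finally have "u *\<^sub>M x \<in> L" using l by simp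
      then have "inv u *\<^sub>M (u *\<^sub>M x) \<in> L" using submodule_smult[OF L(1)] u by blast
      then show False using x(2) smult_assoc1[OF R.Units_inv_closed[OF u] uc xc] u xc by simp
    qed
    have "filtration R M m K (adjoin R M L x) (Suc n)"
      by (rule filtration.step[OF KL xc mx])
    then show ?thesis using max x by simp
  qed
qed


end

section \<open>Quotient modules and the correspondence of submodules\<close>

context module
begin

lemma coset_add:
  assumes K: "submodule K R M" and "x \<in> carrier M" "y \<in> carrier M"
  shows "(K +>\<^bsub>M\<^esub> x) <+>\<^bsub>M\<^esub> (K +>\<^bsub>M\<^esub> y) = K +>\<^bsub>M\<^esub> (x +\<^sub>M y)"
proof -
  have "abelian_subgroup K M"
    using submodule.axioms(1)[OF K] M.abelian_group_axioms by (rule abelian_subgroupI3[OF additive_subgroupI])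
  then show ?thesis by (rule abelian_subgroup.a_rcos_sum) (rule assms)+
qed

lemma coset_eq_iff:
  assumes K: "submodule K R M" and x: "x \<in> carrier M" and y: "y \<in> carrier M"
  shows "K +>\<^bsub>M\<^esub> x = K +>\<^bsub>M\<^esub> y \<longleftrightarrow> (\<exists>k\<in>K. x = k +\<^sub>M y)"
proof -
  interpret K: abelian_subgroup K M
    using submodule.axioms(1)[OF K] M.abelian_group_axioms by (rule abelian_subgroupI3[OF additive_subgroupI])
  have "x \<in> K +>\<^bsub>M\<^esub> x" using K.a_rcos_self x by blast
  moreover have "K +>\<^bsub>M\<^esub> x = K +>\<^bsub>M\<^esub> y" if "x \<in> K +>\<^bsub>M\<^esub> y"
    using K.a_repr_independence' that y by simp
  ultimately show ?thesis unfolding a_r_coset_def' by auto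
qed

lemma coset_smult:
  assumes K: "submodule K R M" and x: "x \<in> carrier M" and a: "a \<in> carrier R"
  shows "(\<Union>y\<in>K +>\<^bsub>M\<^esub> x. K +>\<^bsub>M\<^esub> (a *\<^sub>M y)) = K +>\<^bsub>M\<^esub> (a *\<^sub>M x)"
proof -
  have "K +>\<^bsub>M\<^esub> (a *\<^sub>M y) = K +>\<^bsub>M\<^esub> (a *\<^sub>M x)" if y: "y \<in> K +>\<^bsub>M\<^esub> x" for y
  proof -
    obtain k where k: "k \<in> K" "y = k +\<^sub>M x" using y unfolding a_r_coset_def' by blast
    have kc: "k \<in> carrier M" using submodule_carrier[OF K] k by blast
    have "a *\<^sub>M y = a *\<^sub>M k +\<^sub>M a *\<^sub>M x" using k kc x a by (simp add: smult_r_distr)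
    then show ?thesis
      using coset_eq_iff[OF K, of "a *\<^sub>M y" "a *\<^sub>M x"] submodule_smult[OF K a k(1)] k kc x a by auto
  qed
  moreover have "0\<^sub>M +\<^sub>M x \<in> K +>\<^bsub>M\<^esub> x"
    unfolding a_r_coset_def' using submodule_zero[OF K] by blast
  ultimately show ?thesis by blast
qed

lemma carrier_quot_module: "carrier (quot_module M K) = (\<lambda>x. K +>\<^bsub>M\<^esub> x) ` carrier M"
  by (auto simp: quot_module_def A_RCOSETS_def')

lemma module_quot_module:
  assumes K: "submodule K R M"
  shows "module R (quot_module M K)"
proof -
  let ?Q = "quot_module M K"
  note car = carrier_quot_module[of K]
  have add: "(K +>\<^bsub>M\<^esub> x) \<oplus>\<^bsub>?Q\<^esub> (K +>\<^bsub>M\<^esub> y) = K +>\<^bsub>M\<^esub> (x +\<^sub>M y)"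
    if "x \<in> carrier M" "y \<in> carrier M" for x y
    using coset_add[OF K that] by (simp add: quot_module_def)
  have smult: "a \<odot>\<^bsub>?Q\<^esub> (K +>\<^bsub>M\<^esub> x) = K +>\<^bsub>M\<^esub> (a *\<^sub>M x)" if "x \<in> carrier M" "a \<in> carrier R" for a x
    using coset_smult[OF K that] by (simp add: quot_module_def)
  have "K +>\<^bsub>M\<^esub> 0\<^sub>M = K"
    using submodule_carrier[OF K] by (auto simp: a_r_coset_def')
  then have zero: "\<zero>\<^bsub>?Q\<^esub> = K +>\<^bsub>M\<^esub> 0\<^sub>M" by (simp add: quot_module_def)
  show ?thesis
  proof (rule moduleI)
    show "abelian_group ?Q"
    proof (rule abelian_groupI)
      show "\<exists>y\<in>carrier ?Q. y \<oplus>\<^bsub>?Q\<^esub> x = \<zero>\<^bsub>?Q\<^esub>" if "x \<in> carrier ?Q" for x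
      proof -
        obtain z where z: "x = K +>\<^bsub>M\<^esub> z" "z \<in> carrier M" using \<open>x \<in> carrier ?Q\<close> unfolding car by blast
        then have "(K +>\<^bsub>M\<^esub> (\<ominus>\<^bsub>M\<^esub> z)) \<oplus>\<^bsub>?Q\<^esub> x = \<zero>\<^bsub>?Q\<^esub>" using add zero by (simp add: M.l_neg)
        then show ?thesis using z unfolding car by blast
      qed
    qed (auto simp: car add zero M.a_ac)
  qed (auto simp: car add smult R.cring_axioms smult_l_distr smult_r_distr smult_assoc1)
qed

text \<open>Preimages and images under the quotient map both preserve strict inclusion, so chains
  can be carried in both directions and neither height exceeds the other.\<close>

lemma module_length_quot_module:
  assumes K: "submodule K R M"
  shows "module_length R (quot_module M K) = chain_height {A. submodule A R M \<and> K \<subseteq> A}"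
proof (rule antisym)
  let ?Q = "quot_module M K" and ?f = "\<lambda>x. K +>\<^bsub>M\<^esub> x"
  interpret Q: module R ?Q by (rule module_quot_module[OF K])
  note car = carrier_quot_module[of K]
  have add: "(K +>\<^bsub>M\<^esub> x) \<oplus>\<^bsub>?Q\<^esub> (K +>\<^bsub>M\<^esub> y) = K +>\<^bsub>M\<^esub> (x +\<^sub>M y)"
    if "x \<in> carrier M" "y \<in> carrier M" for x y
    using coset_add[OF K that] by (simp add: quot_module_def)
  have smult: "a \<odot>\<^bsub>?Q\<^esub> (K +>\<^bsub>M\<^esub> x) = K +>\<^bsub>M\<^esub> (a *\<^sub>M x)" if "x \<in> carrier M" "a \<in> carrier R" for a x
    using coset_smult[OF K that] by (simp add: quot_module_def)
  have ker: "?f k = \<zero>\<^bsub>?Q\<^esub>" if "k \<in> K" for k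
  proof -
    have "K +>\<^bsub>M\<^esub> 0\<^sub>M = K" using submodule_carrier[OF K] by (auto simp: a_r_coset_def')
    moreover have "?f k = ?f 0\<^sub>M"
      using coset_eq_iff[OF K, of k "0\<^sub>M"] that submodule_carrier[OF K that] by (auto intro!: bexI[of _ k])
    ultimately show ?thesis by (simp add: quot_module_def)
  qed
  have zero: "?f 0\<^sub>M = \<zero>\<^bsub>?Q\<^esub>" by (rule ker[OF submodule_zero[OF K]])
  show "module_length R ?Q \<le> chain_height {A. submodule A R M \<and> K \<subseteq> A}"
    unfolding module_length_def
  proof (rule chain_height_map_le[where f = "\<lambda>Y. {x \<in> carrier M. ?f x \<in> Y}"])
    fix A assume "A \<in> {H. submodule H R ?Q}"
    then have A: "submodule A R ?Q" by simp
    have "submodule {x \<in> carrier M. ?f x \<in> A} R M"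
    proof (rule submodule_intro)
      show "0\<^sub>M \<in> {x \<in> carrier M. ?f x \<in> A}" using Q.submodule_zero[OF A] zero by simp
    qed (use add[symmetric] smult[symmetric] Q.submodule_add[OF A] Q.submodule_smult[OF A] in auto)
    moreover have "K \<subseteq> {x \<in> carrier M. ?f x \<in> A}"
      using ker Q.submodule_zero[OF A] submodule_carrier[OF K] by auto
    ultimately show "{x \<in> carrier M. ?f x \<in> A} \<in> {A. submodule A R M \<and> K \<subseteq> A}" by simp
  next
    fix A B assume "A \<in> {H. submodule H R ?Q}" "B \<in> {H. submodule H R ?Q}" and AB: "A \<subset> B"
    \<comment> \<open>Every element of the quotient has a representative in \<open>M\<close>, so
      strictness of \<open>A \<subset> B\<close> is visible on preimages.\<close>
    then have "B \<subseteq> ?f ` carrier M" using Q.submodule_carrier car by blast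
    then obtain z where "z \<in> carrier M" "?f z \<in> B" "?f z \<notin> A" using AB by blast
    then show "{x \<in> carrier M. ?f x \<in> A} \<subset> {x \<in> carrier M. ?f x \<in> B}" using AB by blast
  qed
  show "chain_height {A. submodule A R M \<and> K \<subseteq> A} \<le> module_length R ?Q"
    unfolding module_length_def
  proof (rule chain_height_map_le[where f = "\<lambda>Y. ?f ` Y"])
    fix A assume "A \<in> {A. submodule A R M \<and> K \<subseteq> A}"
    then have A: "submodule A R M" by simp
    note Ac = submodule_carrier[OF A]
    have "submodule (?f ` A) R ?Q"
    proof (rule Q.submodule_intro)
      show "?f ` A \<subseteq> carrier ?Q" using Ac unfolding car by blast
      show "\<zero>\<^bsub>?Q\<^esub> \<in> ?f ` A" using zero submodule_zero[OF A] by force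
    next
      fix y z assume "y \<in> ?f ` A" "z \<in> ?f ` A"
      then show "y \<oplus>\<^bsub>?Q\<^esub> z \<in> ?f ` A" using add[OF Ac Ac] submodule_add[OF A] by force
    next
      fix a y assume "a \<in> carrier R" "y \<in> ?f ` A"
      then show "a \<odot>\<^bsub>?Q\<^esub> y \<in> ?f ` A" using smult[OF Ac] submodule_smult[OF A] by force
    qed
    then show "?f ` A \<in> {H. submodule H R ?Q}" by simp
  next
    fix A B assume "A \<in> {A. submodule A R M \<and> K \<subseteq> A}" "B \<in> {A. submodule A R M \<and> K \<subseteq> A}" and AB: "A \<subset> B"
    then have A: "submodule A R M" "K \<subseteq> A" and B: "submodule B R M" by auto
    obtain b where b: "b \<in> B" "b \<notin> A" using AB by blast
    have "?f b \<notin> ?f ` A"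
    proof
      assume "?f b \<in> ?f ` A"
      then obtain a where a: "a \<in> A" "?f b = ?f a" by blast
      then obtain k where "k \<in> K" "b = k +\<^sub>M a"
        using coset_eq_iff[OF K submodule_carrier[OF B b(1)] submodule_carrier[OF A(1) a(1)]] by blast
      then show False using b(2) submodule_add[OF A(1) _ a(1), of k] A(2) by blast
    qed
    then show "?f ` A \<subset> ?f ` B" using AB b by blast
  qed
qed

lemma submodule_restrict_iff:
  assumes "submodule H R M"
  shows "submodule A R (M\<lparr>carrier := H\<rparr>) \<longleftrightarrow> submodule A R M \<and> A \<subseteq> H"
proof -
  interpret H: module R "M\<lparr>carrier := H\<rparr>"
    using submodule.submodule_is_module[OF assms module_axioms] .
  show ?thesis
  proof
    assume A: "submodule A R (M\<lparr>carrier := H\<rparr>)"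
    then have sub: "A \<subseteq> H" using H.submodule_carrier by auto
    have "submodule A R M"
      using sub submodule_carrier[OF assms] H.submodule_zero[OF A] H.submodule_add[OF A] H.submodule_smult[OF A]
      by (intro submodule_intro) auto
    with sub show "submodule A R M \<and> A \<subseteq> H" by blast
  next
    assume "submodule A R M \<and> A \<subseteq> H"
    then have A: "submodule A R M" "A \<subseteq> H" by auto
    show "submodule A R (M\<lparr>carrier := H\<rparr>)"
      using A(2) submodule_zero[OF A(1)] submodule_add[OF A(1)] submodule_smult[OF A(1)]
      by (intro H.submodule_intro) auto
  qed
qed

text \<open>This gives access to the lengths in the theorem: chains in the subquotient correspond to
  chains of submodules of \<open>M\<close> between \<open>K\<close> and \<open>H\<close>.\<close>

lemma module_length_subquotient:
  assumes "submodule K R M" "submodule H R M" "K \<subseteq> H"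
  shows "module_length R (subquotient M H K) = chain_height {A. submodule A R M \<and> K \<subseteq> A \<and> A \<subseteq> H}"
proof -
  interpret H: module R "M\<lparr>carrier := H\<rparr>"
    using submodule.submodule_is_module[OF assms(2) module_axioms] .
  have "submodule K R (M\<lparr>carrier := H\<rparr>)" using assms submodule_restrict_iff by blast
  from H.module_length_quot_module[OF this] show ?thesis
    unfolding subquotient_def submodule_restrict_iff[OF assms(2)]
    by (simp add: conj_assoc conj_commute[of "_ \<subseteq> H"])
qed

end


section \<open>Localization\<close>

locale localization = module R M + S: submonoid S R for R (structure) and M (structure) and S
begin

abbreviation fr where "fr \<equiv> frac R S M"

lemmas smult_norm = smult_r_distr smult_l_distr smult_assoc1[symmetric] R.m_ac M.a_ac

text \<open>Transitivity of the relation behind fractions. The multipliers \<open>u\<close> and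
  \<open>v\<close> of the two given relations have to be joined by the middle denominator
  \<open>t\<close>, which occurs in both and cannot be cancelled.\<close>

lemma frac_trans:
  assumes "x \<in> carrier M" "y \<in> carrier M" "z \<in> carrier M" "s \<in> S" "t \<in> S" "r \<in> S" "u \<in> S" "v \<in> S"
    and "u *\<^sub>M (t *\<^sub>M x) = u *\<^sub>M (s *\<^sub>M y)" "v *\<^sub>M (r *\<^sub>M y) = v *\<^sub>M (t *\<^sub>M z)"
  shows "(u \<otimes> v \<otimes> t) *\<^sub>M (r *\<^sub>M x) = (u \<otimes> v \<otimes> t) *\<^sub>M (s *\<^sub>M z)"
proof -
  have "(u \<otimes> v \<otimes> t) *\<^sub>M (r *\<^sub>M x) = (v \<otimes> r) *\<^sub>M (u *\<^sub>M (t *\<^sub>M x))"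
    using assms(1-8) by (simp add: smult_norm)
  also have "\<dots> = (u \<otimes> s) *\<^sub>M (v *\<^sub>M (r *\<^sub>M y))"
    unfolding assms(9) using assms(1-8) by (simp add: smult_norm)
  also have "\<dots> = (u \<otimes> v \<otimes> t) *\<^sub>M (s *\<^sub>M z)"
    unfolding assms(10) using assms(1-8) by (simp add: smult_norm)
  finally show ?thesis .
qed

lemma frac_eq_iff:
  assumes "x \<in> carrier M" "y \<in> carrier M" "s \<in> S" "t \<in> S"
  shows "fr x s = fr y t \<longleftrightarrow> (\<exists>u\<in>S. u *\<^sub>M (t *\<^sub>M x) = u *\<^sub>M (s *\<^sub>M y))"
proof
  assume "fr x s = fr y t"
  moreover have "(y, t) \<in> fr y t"
    unfolding frac_def using assms S.one_closed by blast
  ultimately show "\<exists>u\<in>S. u *\<^sub>M (t *\<^sub>M x) = u *\<^sub>M (s *\<^sub>M y)"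
    unfolding frac_def by blast
next
  have *: "fr y t \<subseteq> fr x s" if that: "x \<in> carrier M" "y \<in> carrier M" "s \<in> S" "t \<in> S"
    and ex: "\<exists>u\<in>S. u *\<^sub>M (t *\<^sub>M x) = u *\<^sub>M (s *\<^sub>M y)" for x y s t
  proof clarify
    fix z r assume "(z, r) \<in> fr y t"
    then obtain v where v: "z \<in> carrier M" "r \<in> S" "v \<in> S" "v *\<^sub>M (r *\<^sub>M y) = v *\<^sub>M (t *\<^sub>M z)"
      unfolding frac_def by blast
    obtain u where u: "u \<in> S" "u *\<^sub>M (t *\<^sub>M x) = u *\<^sub>M (s *\<^sub>M y)" using ex by blast
    have "u \<otimes> v \<otimes> t \<in> S" using u(1) v(3) that(4) by simp
    then show "(z, r) \<in> fr x s"
      using frac_trans[OF that(1,2) v(1) that(3,4) v(2) u(1) v(3) u(2) v(4)] v unfolding frac_def by blast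
  qed
  assume **: "\<exists>u\<in>S. u *\<^sub>M (t *\<^sub>M x) = u *\<^sub>M (s *\<^sub>M y)"
  then have ***: "\<exists>u\<in>S. u *\<^sub>M (s *\<^sub>M y) = u *\<^sub>M (t *\<^sub>M x)" by metis
  show "fr x s = fr y t"
    using *[OF assms **] *[OF assms(2,1,4,3) ***] by blast
qed

lemma frac_eqI:
  assumes "x \<in> carrier M" "y \<in> carrier M" "s \<in> S" "t \<in> S" "t *\<^sub>M x = s *\<^sub>M y"
  shows "fr x s = fr y t"
  using assms frac_eq_iff[OF assms(1-4)] S.one_closed by metis

lemma frac_mem:
  assumes "x \<in> carrier M" "s \<in> S"
  shows "(x, s) \<in> fr x s"
  unfolding frac_def using assms S.one_closed by blast

lemma frac_memD:
  assumes "(y, t) \<in> fr x s" "x \<in> carrier M" "s \<in> S"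
  shows "y \<in> carrier M" "t \<in> S" "fr y t = fr x s"
proof -
  show y: "y \<in> carrier M" and t: "t \<in> S" using assms(1) unfolding frac_def by auto
  show "fr y t = fr x s"
    using assms(1) frac_eq_iff[OF assms(2) y assms(3) t] unfolding frac_def by auto
qed

lemma frac_add_cong:
  assumes "x \<in> carrier M" "y \<in> carrier M" "s \<in> S" "t \<in> S" "x' \<in> carrier M" "y' \<in> carrier M" "s' \<in> S" "t' \<in> S"
    and "fr x s = fr x' s'" "fr y t = fr y' t'"
  shows "fr (t *\<^sub>M x +\<^sub>M s *\<^sub>M y) (s \<otimes> t) = fr (t' *\<^sub>M x' +\<^sub>M s' *\<^sub>M y') (s' \<otimes> t')"
proof -
  obtain u where u: "u \<in> S" "u *\<^sub>M (s' *\<^sub>M x) = u *\<^sub>M (s *\<^sub>M x')"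
    using assms frac_eq_iff[of x x' s s'] by blast
  obtain v where v: "v \<in> S" "v *\<^sub>M (t' *\<^sub>M y) = v *\<^sub>M (t *\<^sub>M y')"
    using assms frac_eq_iff[of y y' t t'] by blast
  have "(u \<otimes> v) *\<^sub>M ((s' \<otimes> t') *\<^sub>M (t *\<^sub>M x +\<^sub>M s *\<^sub>M y)) =
      (v \<otimes> t \<otimes> t') *\<^sub>M (u *\<^sub>M (s' *\<^sub>M x)) +\<^sub>M (u \<otimes> s \<otimes> s') *\<^sub>M (v *\<^sub>M (t' *\<^sub>M y))"
    using assms(1-8) u(1) v(1) by (simp add: smult_norm)
  also have "\<dots> = (u \<otimes> v) *\<^sub>M ((s \<otimes> t) *\<^sub>M (t' *\<^sub>M x' +\<^sub>M s' *\<^sub>M y'))"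
    unfolding u(2) v(2) using assms(1-8) u(1) v(1) by (simp add: smult_norm)
  finally have e: "(u \<otimes> v) *\<^sub>M ((s' \<otimes> t') *\<^sub>M (t *\<^sub>M x +\<^sub>M s *\<^sub>M y)) =
      (u \<otimes> v) *\<^sub>M ((s \<otimes> t) *\<^sub>M (t' *\<^sub>M x' +\<^sub>M s' *\<^sub>M y'))" .
  show ?thesis
    using assms(1-8) u(1) v(1) e
    by (subst frac_eq_iff) (auto intro!: bexI[of _ "u \<otimes> v"])
qed

lemma loc_module_simps:
  "carrier (loc_module R S M) = {fr x s | x s. x \<in> carrier M \<and> s \<in> S}"
  "\<zero>\<^bsub>loc_module R S M\<^esub> = fr 0\<^sub>M \<one>"
  by (simp_all add: loc_module_def)

text \<open>Operations on fractions are defined as unions over all representatives. Such a union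
  collapses to a single value as soon as the value does not depend on the representative.\<close>

lemma UN_frac_eqI:
  assumes "x \<in> carrier M" "s \<in> S"
    and "\<And>x' s'. x' \<in> carrier M \<Longrightarrow> s' \<in> S \<Longrightarrow> fr x' s' = fr x s \<Longrightarrow> f (x', s') = A"
  shows "\<Union> (f ` fr x s) = A"
proof -
  have 1: "f p = A" if p: "p \<in> fr x s" for p
  proof -
    obtain x' s' where q: "p = (x', s')" by fastforce
    show ?thesis
      unfolding q by (rule assms(3); rule frac_memD[OF p[unfolded q] assms(1,2)])
  qed
  have "(\<Union>p\<in>fr x s. f p) = (\<Union>p\<in>fr x s. A)" by (rule SUP_cong[OF refl 1])
  also have "\<dots> = A" using frac_mem[OF assms(1,2)] by auto
  finally show ?thesis .
qed

lemma loc_add: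
  assumes "x \<in> carrier M" "y \<in> carrier M" "s \<in> S" "t \<in> S"
  shows "fr x s \<oplus>\<^bsub>loc_module R S M\<^esub> fr y t = fr (t *\<^sub>M x +\<^sub>M s *\<^sub>M y) (s \<otimes> t)"
  unfolding loc_module_def ring_record_simps
  by (rule UN_frac_eqI[OF assms(1,3)], unfold prod.case, rule UN_frac_eqI[OF assms(2,4)], unfold prod.case,
      rule frac_add_cong) (use assms in auto)

lemma loc_closed: "x \<in> carrier M \<Longrightarrow> s \<in> S \<Longrightarrow> fr x s \<in> carrier (loc_module R S M)"
  unfolding loc_module_simps by blast

lemma loc_cases:
  assumes "x \<in> carrier (loc_module R S M)"
  obtains z s where "x = fr z s" "z \<in> carrier M" "s \<in> S"
  using assms unfolding loc_module_simps by blast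

lemma abelian_group_loc_module: "abelian_group (loc_module R S M)" (is "abelian_group ?L")
proof (rule abelian_groupI)
  fix x y assume x: "x \<in> carrier (?L)" and y: "y \<in> carrier (?L)"
  obtain x' s where x': "x = fr x' s" "x' \<in> carrier M" "s \<in> S" using x by (rule loc_cases)
  obtain y' t where y': "y = fr y' t" "y' \<in> carrier M" "t \<in> S" using y by (rule loc_cases)
  show "x \<oplus>\<^bsub>?L\<^esub> y \<in> carrier (?L)"
    using x' y' by (simp add: loc_add loc_closed)
  show "x \<oplus>\<^bsub>?L\<^esub> y = y \<oplus>\<^bsub>?L\<^esub> x"
    using x' y' by (simp add: loc_add M.a_comm R.m_comm)
  fix z assume z: "z \<in> carrier (?L)"
  obtain z' r where z': "z = fr z' r" "z' \<in> carrier M" "r \<in> S" using z by (rule loc_cases)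
  show "x \<oplus>\<^bsub>?L\<^esub> y \<oplus>\<^bsub>?L\<^esub> z = x \<oplus>\<^bsub>?L\<^esub> (y \<oplus>\<^bsub>?L\<^esub> z)"
    using x' y' z' by (simp add: loc_add smult_norm)
next
  show "\<zero>\<^bsub>?L\<^esub> \<in> carrier (?L)"
    by (simp add: loc_module_simps(2) loc_closed)
next
  fix x assume x: "x \<in> carrier (?L)"
  obtain z s where z: "x = fr z s" "z \<in> carrier M" "s \<in> S" using x by (rule loc_cases)
  show "\<zero>\<^bsub>?L\<^esub> \<oplus>\<^bsub>?L\<^esub> x = x"
    using z by (simp add: loc_module_simps(2) loc_add)
  have "fr (\<ominus>\<^bsub>M\<^esub> z) s \<oplus>\<^bsub>?L\<^esub> x = fr 0\<^sub>M \<one>"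
    using z by (simp add: loc_add smult_r_minus M.l_neg) (rule frac_eqI, auto)
  then show "\<exists>y\<in>carrier (?L). y \<oplus>\<^bsub>?L\<^esub> x = \<zero>\<^bsub>?L\<^esub>"
    using z loc_closed[of "\<ominus>\<^bsub>M\<^esub> z" s] by (auto simp: loc_module_simps(2))
qed

end

locale ring_localization = cring R + S: submonoid S R for R (structure) and S
begin

text \<open>The ring of fractions has the same carrier and addition as the localization of
  \<open>self_module R\<close>, so additive facts are inherited from modules and only the product
  has to be treated separately.\<close>

sublocale L: localization R "self_module R" S
  by (intro localization.intro module_self_module S.submonoid_axioms)

abbreviation fr where "fr \<equiv> frac R S (self_module R)"

lemma loc_ring_simps:
  "carrier (loc_ring R S) = carrier (loc_module R S (self_module R))"
  "add (loc_ring R S) = add (loc_module R S (self_module R))"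
  "\<zero>\<^bsub>loc_ring R S\<^esub> = fr \<zero> \<one>"
  "\<one>\<^bsub>loc_ring R S\<^esub> = fr \<one> \<one>"
  by (simp_all add: loc_ring_def loc_module_def Let_def)

lemma ring_frac_closed: "a \<in> carrier R \<Longrightarrow> s \<in> S \<Longrightarrow> fr a s \<in> carrier (loc_ring R S)"
  using L.loc_closed by (simp add: loc_ring_simps)

lemma ring_frac_cases:
  assumes "x \<in> carrier (loc_ring R S)"
  obtains a s where "x = fr a s" "a \<in> carrier R" "s \<in> S"
  using assms L.loc_cases unfolding loc_ring_simps by auto

lemma ring_frac_eq_iff:
  assumes "a \<in> carrier R" "b \<in> carrier R" "s \<in> S" "t \<in> S"
  shows "fr a s = fr b t \<longleftrightarrow> (\<exists>u\<in>S. u \<otimes> (t \<otimes> a) = u \<otimes> (s \<otimes> b))"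
  using L.frac_eq_iff[of a b s t] assms by simp

lemma ring_frac_eqI:
  assumes "a \<in> carrier R" "b \<in> carrier R" "s \<in> S" "t \<in> S" "t \<otimes> a = s \<otimes> b"
  shows "fr a s = fr b t"
  using L.frac_eqI[of a b s t] assms by simp

lemma loc_ring_add:
  assumes "a \<in> carrier R" "b \<in> carrier R" "s \<in> S" "t \<in> S"
  shows "fr a s \<oplus>\<^bsub>loc_ring R S\<^esub> fr b t = fr (t \<otimes> a \<oplus> s \<otimes> b) (s \<otimes> t)"
  using L.loc_add[of a b s t] assms by (simp add: loc_ring_simps)

end

context localization
begin

sublocale RS: ring_localization R S
  by (intro ring_localization.intro R.cring_axioms S.submonoid_axioms)

lemma frac_smult_cong:
  assumes "a \<in> carrier R" "y \<in> carrier M" "s \<in> S" "t \<in> S" "a' \<in> carrier R" "y' \<in> carrier M" "s' \<in> S" "t' \<in> S"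
    and "RS.fr a s = RS.fr a' s'" "fr y t = fr y' t'"
  shows "fr (a *\<^sub>M y) (s \<otimes> t) = fr (a' *\<^sub>M y') (s' \<otimes> t')"
proof -
  obtain u where u: "u \<in> S" "u \<otimes> (s' \<otimes> a) = u \<otimes> (s \<otimes> a')"
    using assms RS.ring_frac_eq_iff[of a a' s s'] by blast
  obtain v where v: "v \<in> S" "v *\<^sub>M (t' *\<^sub>M y) = v *\<^sub>M (t *\<^sub>M y')"
    using assms frac_eq_iff[of y y' t t'] by blast
  have "(u \<otimes> v) *\<^sub>M ((s' \<otimes> t') *\<^sub>M (a *\<^sub>M y)) = (u \<otimes> (s' \<otimes> a)) *\<^sub>M (v *\<^sub>M (t' *\<^sub>M y))"
    using assms(1-8) u(1) v(1) by (simp add: smult_norm)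
  also have "\<dots> = (u \<otimes> v) *\<^sub>M ((s \<otimes> t) *\<^sub>M (a' *\<^sub>M y'))"
    unfolding u(2) v(2) using assms(1-8) u(1) v(1) by (simp add: smult_norm)
  finally show ?thesis
    using assms(1-8) u(1) v(1) by (subst frac_eq_iff) (auto intro!: bexI[of _ "u \<otimes> v"])
qed

lemma loc_smult:
  assumes "a \<in> carrier R" "y \<in> carrier M" "s \<in> S" "t \<in> S"
  shows "RS.fr a s \<odot>\<^bsub>loc_module R S M\<^esub> fr y t = fr (a *\<^sub>M y) (s \<otimes> t)"
  unfolding loc_module_def module.simps
  by (rule RS.L.UN_frac_eqI, simp add: assms, rule assms, unfold prod.case, rule UN_frac_eqI[OF assms(2,4)],
      unfold prod.case, rule frac_smult_cong) (use assms in auto)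

end

context ring_localization
begin

text \<open>The product of two fractions is by definition their scalar product in the localization
  of \<open>self_module R\<close>, so the formula comes from \<open>loc_smult\<close>.\<close>

lemma loc_ring_mult:
  assumes "a \<in> carrier R" "b \<in> carrier R" "s \<in> S" "t \<in> S"
  shows "fr a s \<otimes>\<^bsub>loc_ring R S\<^esub> fr b t = fr (a \<otimes> b) (s \<otimes> t)"
proof -
  have "fr a s \<otimes>\<^bsub>loc_ring R S\<^esub> fr b t = fr a s \<odot>\<^bsub>loc_module R S (self_module R)\<^esub> fr b t"
    by (simp add: loc_ring_def loc_module_def Let_def)
  then show ?thesis using L.loc_smult[of a b s t] assms by simp
qed

lemmas ring_norm = l_distr r_distr m_ac a_ac

lemma cring_loc_ring: "cring (loc_ring R S)" (is "cring ?R")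
proof (rule cringI)
  interpret A: abelian_group "loc_module R S (self_module R)" by (rule L.abelian_group_loc_module)
  have zero: "\<zero>\<^bsub>?R\<^esub> = \<zero>\<^bsub>loc_module R S (self_module R)\<^esub>"
    by (simp add: loc_ring_simps(3) L.loc_module_simps(2))
  show "abelian_group (?R)"
  proof (rule abelian_groupI)
    show "\<exists>y\<in>carrier (?R). y \<oplus>\<^bsub>?R\<^esub> x = \<zero>\<^bsub>?R\<^esub>"
      if "x \<in> carrier (?R)" for x
      using that A.l_neg[of x] A.a_inv_closed[of x] unfolding zero loc_ring_simps(1,2) by blast
  qed (auto simp: zero loc_ring_simps(1,2) A.a_ac)
  show "comm_monoid (?R)"
  proof (rule comm_monoidI)
    fix x y assume x: "x \<in> carrier (?R)" and y: "y \<in> carrier (?R)"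
    obtain a s where a: "x = fr a s" "a \<in> carrier R" "s \<in> S" using x by (rule ring_frac_cases)
    obtain b t where b: "y = fr b t" "b \<in> carrier R" "t \<in> S" using y by (rule ring_frac_cases)
    show "x \<otimes>\<^bsub>?R\<^esub> y \<in> carrier (?R)"
      using a b by (simp add: loc_ring_mult ring_frac_closed)
    show "x \<otimes>\<^bsub>?R\<^esub> y = y \<otimes>\<^bsub>?R\<^esub> x"
      using a b by (simp add: loc_ring_mult m_comm)
    fix z assume z: "z \<in> carrier (?R)"
    obtain c r where c: "z = fr c r" "c \<in> carrier R" "r \<in> S" using z by (rule ring_frac_cases)
    show "x \<otimes>\<^bsub>?R\<^esub> y \<otimes>\<^bsub>?R\<^esub> z = x \<otimes>\<^bsub>?R\<^esub> (y \<otimes>\<^bsub>?R\<^esub> z)"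
      using a b c by (simp add: loc_ring_mult m_assoc)
  next
    fix x assume x: "x \<in> carrier (?R)"
    obtain a s where a: "x = fr a s" "a \<in> carrier R" "s \<in> S" using x by (rule ring_frac_cases)
    show "\<one>\<^bsub>?R\<^esub> \<otimes>\<^bsub>?R\<^esub> x = x"
      using a by (simp add: loc_ring_simps(4) loc_ring_mult)
  qed (simp add: loc_ring_simps(4) ring_frac_closed)
  fix x y z assume x: "x \<in> carrier (?R)" and y: "y \<in> carrier (?R)"
    and z: "z \<in> carrier (?R)"
  obtain a s where a: "x = fr a s" "a \<in> carrier R" "s \<in> S" using x by (rule ring_frac_cases)
  obtain b t where b: "y = fr b t" "b \<in> carrier R" "t \<in> S" using y by (rule ring_frac_cases)
  obtain c r where c: "z = fr c r" "c \<in> carrier R" "r \<in> S" using z by (rule ring_frac_cases)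
  show "(x \<oplus>\<^bsub>?R\<^esub> y) \<otimes>\<^bsub>?R\<^esub> z =
      x \<otimes>\<^bsub>?R\<^esub> z \<oplus>\<^bsub>?R\<^esub> y \<otimes>\<^bsub>?R\<^esub> z"
    using a b c by (simp add: loc_ring_mult loc_ring_add, intro ring_frac_eqI) (auto simp: ring_norm)
qed

end

context localization
begin

lemma module_loc_module: "module (loc_ring R S) (loc_module R S M)" (is "module ?R ?L")
proof (rule moduleI)
  show "cring (?R)" by (rule RS.cring_loc_ring)
  show "abelian_group (?L)" by (rule abelian_group_loc_module)
  fix a x assume a: "a \<in> carrier (?R)" and x: "x \<in> carrier (?L)"
  obtain a' s where a': "a = RS.fr a' s" "a' \<in> carrier R" "s \<in> S" using a by (rule RS.ring_frac_cases)
  obtain x' t where x': "x = fr x' t" "x' \<in> carrier M" "t \<in> S" using x by (rule loc_cases)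
  show "a \<odot>\<^bsub>?L\<^esub> x \<in> carrier (?L)"
    using a' x' by (simp add: loc_smult loc_closed)
  { fix b assume b: "b \<in> carrier (?R)"
    obtain b' r where b': "b = RS.fr b' r" "b' \<in> carrier R" "r \<in> S" using b by (rule RS.ring_frac_cases)
    show "(a \<oplus>\<^bsub>?R\<^esub> b) \<odot>\<^bsub>?L\<^esub> x =
        a \<odot>\<^bsub>?L\<^esub> x \<oplus>\<^bsub>?L\<^esub> b \<odot>\<^bsub>?L\<^esub> x"
      using a' b' x' by (simp add: RS.loc_ring_add loc_smult loc_add, intro frac_eqI) (auto simp: smult_norm R.l_distr R.r_distr)
    show "(a \<otimes>\<^bsub>?R\<^esub> b) \<odot>\<^bsub>?L\<^esub> x =
        a \<odot>\<^bsub>?L\<^esub> (b \<odot>\<^bsub>?L\<^esub> x)"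
      using a' b' x' by (simp add: RS.loc_ring_mult loc_smult smult_assoc1 R.m_assoc) }
  fix y assume y: "y \<in> carrier (?L)"
  obtain y' r where y': "y = fr y' r" "y' \<in> carrier M" "r \<in> S" using y by (rule loc_cases)
  show "a \<odot>\<^bsub>?L\<^esub> (x \<oplus>\<^bsub>?L\<^esub> y) =
      a \<odot>\<^bsub>?L\<^esub> x \<oplus>\<^bsub>?L\<^esub> a \<odot>\<^bsub>?L\<^esub> y"
    using a' x' y' by (simp add: loc_smult loc_add, intro frac_eqI) (auto simp: smult_norm)
next
  fix x assume x: "x \<in> carrier (?L)"
  obtain x' t where x': "x = fr x' t" "x' \<in> carrier M" "t \<in> S" using x by (rule loc_cases)
  show "\<one>\<^bsub>?R\<^esub> \<odot>\<^bsub>?L\<^esub> x = x"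
    using x' by (simp add: RS.loc_ring_simps(4) loc_smult)
qed

end


section \<open>Ideals bounding the Frobenius powers of a prime\<close>

context ring_localization
begin

lemma loc_map_closed: "a \<in> carrier R \<Longrightarrow> loc_map R S a \<in> carrier (loc_ring R S)"
  by (simp add: loc_map_def ring_frac_closed)

lemma loc_map_hom: "loc_map R S \<in> ring_hom R (loc_ring R S)"
  by (rule ring_hom_memI) (auto simp: ring_frac_closed loc_map_def loc_ring_mult loc_ring_add loc_ring_simps(4))

lemma frac_mult_loc_map:
  assumes "a \<in> carrier R" "s \<in> S"
  shows "fr a s \<otimes>\<^bsub>loc_ring R S\<^esub> loc_map R S s = loc_map R S a"
  using assms unfolding loc_map_def by (simp add: loc_ring_mult, intro ring_frac_eqI) (auto simp: m_comm)

lemma loc_map_unit: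
  assumes "s \<in> S"
  shows "loc_map R S s \<in> Units (loc_ring R S)"
proof -
  interpret Q: cring "loc_ring R S" by (rule cring_loc_ring)
  have "fr \<one> s \<otimes>\<^bsub>loc_ring R S\<^esub> loc_map R S s = \<one>\<^bsub>loc_ring R S\<^esub>"
    using frac_mult_loc_map[of \<one> s] assms by (simp add: loc_map_def loc_ring_simps(4))
  moreover have "loc_map R S s \<in> carrier (loc_ring R S)" "fr \<one> s \<in> carrier (loc_ring R S)"
    using assms loc_map_closed ring_frac_closed by auto
  ultimately show ?thesis
    using Q.m_comm[of "fr \<one> s" "loc_map R S s"] unfolding Units_def by auto
qed

end

context localization
begin

lemma loc_map_smult:
  assumes "a \<in> carrier R" "x \<in> carrier M"
  shows "loc_map R S a \<odot>\<^bsub>loc_module R S M\<^esub> fr x \<one> = fr (a *\<^sub>M x) \<one>"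
  using assms by (simp add: loc_map_def loc_smult)

lemma frac_add_one:
  assumes "y \<in> carrier M" "x \<in> carrier M"
  shows "fr x \<one> \<oplus>\<^bsub>loc_module R S M\<^esub> fr y \<one> = fr (x +\<^sub>M y) \<one>"
  using assms by (simp add: loc_add)

lemma frac_decomp:
  assumes "s \<in> S" "x \<in> carrier M"
  shows "RS.fr \<one> s \<odot>\<^bsub>loc_module R S M\<^esub> fr x \<one> = fr x s"
  using assms by (simp add: loc_smult)

lemma frac_one_eq_zero_iff:
  assumes "x \<in> carrier M"
  shows "fr x \<one> = \<zero>\<^bsub>loc_module R S M\<^esub> \<longleftrightarrow> (\<exists>u\<in>S. u *\<^sub>M x = 0\<^sub>M)"
  using assms frac_eq_iff[of x "0\<^sub>M" \<one> \<one>] by (auto simp: loc_module_simps(2))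

text \<open>The elements \<open>x\<close> with \<open>x/1\<close> in \<open>H\<close> form a
  submodule of \<open>M\<close> containing \<open>U\<close>, hence are all of \<open>M\<close>; and
  \<open>x/s\<close> is \<open>1/s\<close> times \<open>x/1\<close>.\<close>

lemma loc_module_generated:
  assumes U: "U \<subseteq> carrier M" "submodule_span R M U = carrier M"
    and H: "submodule H (loc_ring R S) (loc_module R S M)" "\<And>u. u \<in> U \<Longrightarrow> fr u \<one> \<in> H"
  shows "carrier (loc_module R S M) \<subseteq> H"
proof -
  interpret N: module "loc_ring R S" "loc_module R S M" by (rule module_loc_module)
  let ?H = "{x \<in> carrier M. fr x \<one> \<in> H}"
  have smult: "fr (a *\<^sub>M x) \<one> \<in> H" if "a \<in> carrier R" "x \<in> carrier M" "fr x \<one> \<in> H" for a x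
    using N.submodule_smult[OF H(1) RS.loc_map_closed that(3), of a] that loc_map_smult by simp
  have "submodule ?H R M"
  proof (rule submodule_intro)
    show "0\<^sub>M \<in> ?H"
      using N.submodule_zero[OF H(1)] by (simp add: loc_module_simps(2))
    fix x assume x: "x \<in> ?H"
    show "x +\<^sub>M y \<in> ?H" if "y \<in> ?H" for y
      using x that N.submodule_add[OF H(1), of "fr x \<one>" "fr y \<one>"] frac_add_one[of y x] by simp
    show "a *\<^sub>M x \<in> ?H" if "a \<in> carrier R" for a
      using smult[of a x] x that by simp
  qed auto
  then have sub: "carrier M \<subseteq> ?H"
    using U H(2) unfolding submodule_span_def by blast
  show ?thesis
  proof
    fix y assume "y \<in> carrier (loc_module R S M)"
    then obtain x s where x: "y = fr x s" "x \<in> carrier M" "s \<in> S" by (rule loc_cases)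
    then have "RS.fr \<one> s \<odot>\<^bsub>loc_module R S M\<^esub> fr x \<one> \<in> H"
      using N.submodule_smult[OF H(1) RS.ring_frac_closed[of \<one> s], of "fr x \<one>"] sub by auto
    then show "y \<in> H" using frac_decomp x by simp
  qed
qed

end

section \<open>Colon ideals, Noetherian induction and witnesses of non-primality\<close>

lemma (in cring) ideal_intro:
  assumes "I \<subseteq> carrier R" "\<zero> \<in> I" "\<And>a b. a \<in> I \<Longrightarrow> b \<in> I \<Longrightarrow> a \<oplus> b \<in> I"
    and "\<And>r a. r \<in> carrier R \<Longrightarrow> a \<in> I \<Longrightarrow> r \<otimes> a \<in> I"
  shows "ideal I R"
proof -
  interpret N: module R "self_module R" by (rule module_self_module)
  have "submodule I R (self_module R)" by (rule N.submodule_intro) (use assms in auto)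
  then show ?thesis by (simp add: submodule_self_module_iff)
qed

lemma (in cring) ideal_colon:
  assumes "ideal I R" "x \<in> carrier R"
  shows "ideal {c \<in> carrier R. c \<otimes> x \<in> I} R"
proof -
  interpret I: ideal I R by fact
  show ?thesis
    using assms(2) I.I_l_closed by (intro ideal_intro) (auto simp: l_distr m_assoc)
qed

text \<open>A maximal counterexample exists by Zorn's lemma: in a Noetherian ring a nonempty chain
  of ideals contains its own union.\<close>

lemma (in noetherian_ring) noetherian_induct [consumes 1, case_names step]:
  assumes "ideal I R"
    and "\<And>I. ideal I R \<Longrightarrow> (\<And>J. ideal J R \<Longrightarrow> I \<subset> J \<Longrightarrow> Q J) \<Longrightarrow> Q I"
  shows "Q I"
proof (rule ccontr)
  assume "\<not> Q I"
  let ?A = "{I. ideal I R \<and> \<not> Q I}"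
  have "\<exists>J\<in>?A. \<forall>K\<in>?A. J \<subseteq> K \<longrightarrow> K = J"
  proof (rule subset_Zorn)
    fix C assume C: "subset.chain ?A C"
    show "\<exists>U\<in>?A. \<forall>K\<in>C. K \<subseteq> U"
    proof (cases "C = {}")
      case True
      then show ?thesis using \<open>\<not> Q I\<close> assms(1) by blast
    next
      case False
      moreover have "subset.chain {I. ideal I R} C"
        using C unfolding subset_chain_def by blast
      ultimately have "\<Union>C \<in> C" by (rule ideal_chain_is_trivial)
      moreover have "C \<subseteq> ?A" using C unfolding subset_chain_def by simp
      ultimately have "\<Union>C \<in> ?A" by (rule rev_subsetD)
      then show ?thesis by (intro bexI[of _ "\<Union>C"]) auto
    qed
  qed
  then show False using assms(2) by blast
qed

lemma (in cring) not_primeE: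
  assumes "ideal I R" "I \<noteq> carrier R" "\<not> primeideal I R"
  obtains a b where "a \<in> carrier R" "b \<in> carrier R" "a \<otimes> b \<in> I" "a \<notin> I" "b \<notin> I"
  using primeidealI[OF assms(1) cring_axioms] assms(2,3) by blast

text \<open>Describes \<open>S\<close> as a localization of \<open>B\<close> at \<open>P\<close>
  through the map \<open>\<theta>\<close> alone. The kernel of \<open>\<theta>\<close> is not
  prescribed, so every nonzero quotient of \<open>B_P\<close> fits; \<open>proper\<close> rules out
  the zero ring. In this way \<open>R_P\<close> can be used directly, although it is constructed
  from \<open>R\<close> and not from \<open>B\<close>.\<close>

locale prime_localization = B?: cring B + S: cring S + P: primeideal P B
  for B :: "('b, 'u) ring_scheme" (structure) and P and S :: "('s, 'v) ring_scheme" and \<theta> +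
  assumes hom: "\<theta> \<in> ring_hom B S"
    and unit: "\<And>b. b \<in> carrier B \<Longrightarrow> b \<notin> P \<Longrightarrow> \<theta> b \<in> Units S"
    and fraction: "\<And>t. t \<in> carrier S \<Longrightarrow> \<exists>b\<in>carrier B. \<exists>w\<in>carrier B - P. t \<otimes>\<^bsub>S\<^esub> \<theta> w = \<theta> b"
    and proper: "\<one>\<^bsub>S\<^esub> \<notin> Idl\<^bsub>S\<^esub> (\<theta> ` P)"
begin

sublocale H: ring_hom_ring B S \<theta>
  by (rule ring_hom_ringI2[OF B.ring_axioms S.ring_axioms hom])

abbreviation maxi where "maxi \<equiv> Idl\<^bsub>S\<^esub> (\<theta> ` P)"

lemma image_P: "\<theta> ` P \<subseteq> carrier S"
  using P.Icarr by auto

lemma maxi_ideal: "ideal maxi S"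
  by (rule S.genideal_ideal[OF image_P])

lemma not_maxi_unit:
  assumes "t \<in> carrier S" "t \<notin> maxi"
  shows "t \<in> Units S"
proof -
  obtain b w where b: "b \<in> carrier B" "w \<in> carrier B" "w \<notin> P" "t \<otimes>\<^bsub>S\<^esub> \<theta> w = \<theta> b"
    using fraction[OF assms(1)] by blast
  have w: "\<theta> w \<in> Units S" using unit b by blast
  have t: "t = \<theta> b \<otimes>\<^bsub>S\<^esub> inv\<^bsub>S\<^esub> (\<theta> w)"
    using w assms(1) b(4) by (metis S.Units_closed S.Units_inv_closed S.Units_r_inv S.m_assoc S.r_one)
  have "b \<notin> P"
  proof
    assume "b \<in> P"
    then have "\<theta> b \<in> maxi" using S.genideal_self[OF image_P] by blast
    then show False
      using t assms(2) ideal.I_r_closed[OF maxi_ideal _ S.Units_inv_closed[OF w]] by blast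
  qed
  then show ?thesis using t unit b w by (simp add: S.Units_m_closed)
qed

text \<open>This is \<open>IS\<close> together with the \<open>q\<close>-th powers of the images of
  the elements of \<open>P\<close>. It makes sense for every \<open>q\<close>; only
  \<open>filtration_frobenius\<close> takes \<open>q\<close> to be a power of
  \<open>p\<close>.\<close>

definition bound_ideal :: "'b set \<Rightarrow> nat \<Rightarrow> 's set" where
  "bound_ideal I q = Idl\<^bsub>S\<^esub> (\<theta> ` I \<union> (\<lambda>b. \<theta> b [^]\<^bsub>S\<^esub> q) ` P)"

context
  fixes I and q :: nat assumes I: "ideal I B"
begin

lemma bound_gens: "\<theta> ` I \<union> (\<lambda>b. \<theta> b [^]\<^bsub>S\<^esub> q) ` P \<subseteq> carrier S"
  using P.Icarr ideal.Icarr[OF I] by auto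

lemma bound_ideal: "ideal (bound_ideal I q) S"
  unfolding bound_ideal_def by (rule S.genideal_ideal[OF bound_gens])

lemma mem_bound_ideal: "x \<in> I \<Longrightarrow> \<theta> x \<in> bound_ideal I q" "b \<in> P \<Longrightarrow> \<theta> b [^]\<^bsub>S\<^esub> q \<in> bound_ideal I q"
  unfolding bound_ideal_def using S.genideal_self[OF bound_gens] by blast+

lemma bound_ideal_minimal:
  assumes "ideal J S" "\<And>x. x \<in> I \<Longrightarrow> \<theta> x \<in> J" "\<And>b. b \<in> P \<Longrightarrow> \<theta> b [^]\<^bsub>S\<^esub> q \<in> J"
  shows "bound_ideal I q \<subseteq> J"
  unfolding bound_ideal_def by (rule S.genideal_minimal[OF assms(1)]) (use assms in blast)

end

lemma image_Idl_insert:
  assumes "ideal J S" "I \<subseteq> carrier B" "a \<in> carrier B" "\<And>x. x \<in> I \<Longrightarrow> \<theta> x \<in> J" "\<theta> a \<in> J"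
    and "x \<in> Idl (insert a I)"
  shows "\<theta> x \<in> J"
proof -
  have "ideal {r \<in> carrier B. \<theta> r \<in> J} B" by (rule H.ideal_vimage[OF assms(1)])
  then have "Idl (insert a I) \<subseteq> {r \<in> carrier B. \<theta> r \<in> J}"
    using assms by (intro B.genideal_minimal) auto
  then show ?thesis using assms by blast
qed

lemma insert_ideal: "ideal I B \<Longrightarrow> a \<in> carrier B \<Longrightarrow> ideal (Idl (insert a I)) B"
  using ideal.Icarr[of I B] by (intro B.genideal_ideal) auto

abbreviation len where "len \<equiv> filtration S (self_module S) maxi"

lemma bound_ideal_insert:
  assumes I: "ideal I B" and a: "a \<in> carrier B"
  shows "bound_ideal (Idl (insert a I)) q \<subseteq> Idl\<^bsub>S\<^esub> (insert (\<theta> a) (bound_ideal I q))"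
proof -
  have sub: "insert (\<theta> a) (bound_ideal I q) \<subseteq> carrier S"
    using a ideal.Icarr[OF bound_ideal[OF I]] by auto
  note self = S.genideal_self[OF sub] and id = S.genideal_ideal[OF sub]
  show ?thesis
    by (rule bound_ideal_minimal[OF insert_ideal[OF I a] id], rule image_Idl_insert[OF id _ a, of I])
      (use self mem_bound_ideal[OF I] ideal.Icarr[OF I] in auto)
qed

lemma len_bound_insert:
  assumes I: "ideal I B" and a: "a \<in> carrier B"
    and len: "len (bound_ideal (Idl (insert a I)) q) (carrier S) n"
  shows "len (Idl\<^bsub>S\<^esub> (insert (\<theta> a) (bound_ideal I q))) (carrier S) n"
proof -
  interpret N: module S "self_module S" by (rule S.module_self_module)
  have sub: "insert (\<theta> a) (bound_ideal I q) \<subseteq> carrier S"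
    using a ideal.Icarr[OF bound_ideal[OF I]] by auto
  note id = S.genideal_ideal[OF sub]
  show ?thesis
    by (rule N.filtration_enlarge[OF len _ bound_ideal_insert[OF I a]])
      (use id ideal.Icarr[OF id] S.submodule_self_module_iff in auto)
qed

text \<open>With \<open>K\<close> the bound ideal of \<open>I\<close>, the length of
  \<open>S/K\<close> is split along \<open>K + (\<theta> a)\<close>. The upper part is a quotient of
  the one for \<open>I + (a)\<close>. The lower part is cyclic, and its annihilator, the colon ideal
  of \<open>K\<close> by \<open>\<theta> a\<close>, contains the bound ideal of
  \<open>I + (b)\<close> because \<open>a b\<close> is in \<open>I\<close>.\<close>

lemma len_bound_split:
  assumes I: "ideal I B" and ab: "a \<in> carrier B" "b \<in> carrier B" "a \<otimes> b \<in> I"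
    and len: "len (bound_ideal (Idl (insert a I)) q) (carrier S) n"
      "len (bound_ideal (Idl (insert b I)) q) (carrier S) n'"
  shows "len (bound_ideal I q) (carrier S) (n' + n)"
proof -
  interpret N: module S "self_module S" by (rule S.module_self_module)
  let ?K = "bound_ideal I q"
  note K = bound_ideal[OF I, of q]
  have colon: "ideal {c \<in> carrier S. c \<otimes>\<^bsub>S\<^esub> \<theta> a \<in> ?K} S"
    using ab by (intro S.ideal_colon[OF K]) auto
  have "bound_ideal (Idl (insert b I)) q \<subseteq> {c \<in> carrier S. c \<otimes>\<^bsub>S\<^esub> \<theta> a \<in> ?K}"
  proof (rule bound_ideal_minimal[OF insert_ideal[OF I ab(2)] colon], rule image_Idl_insert[OF colon _ ab(2), of I])
    show "I \<subseteq> carrier B" using ideal.Icarr[OF I] by blast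
    have "\<theta> (a \<otimes> b) \<in> ?K" using mem_bound_ideal[OF I] ab by blast
    then show "\<theta> b \<in> {c \<in> carrier S. c \<otimes>\<^bsub>S\<^esub> \<theta> a \<in> ?K}" using ab by (simp add: S.m_comm)
    show "\<theta> x \<in> {c \<in> carrier S. c \<otimes>\<^bsub>S\<^esub> \<theta> a \<in> ?K}" if "x \<in> I" for x
      using ideal.I_r_closed[OF K mem_bound_ideal(1)[OF I that]] ab ideal.Icarr[OF I that] by auto
    show "\<theta> x [^]\<^bsub>S\<^esub> q \<in> {c \<in> carrier S. c \<otimes>\<^bsub>S\<^esub> \<theta> a \<in> ?K}" if "x \<in> P" for x
      using ideal.I_r_closed[OF K mem_bound_ideal(2)[OF I that]] ab P.Icarr[OF that] by auto
  qed
  then have "len ?K (adjoin S (self_module S) ?K (\<theta> a)) n'"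
    by (intro N.filtration_cyclic[OF len(2)]) (use K ab S.submodule_self_module_iff in auto)
  moreover have "adjoin S (self_module S) ?K (\<theta> a) = Idl\<^bsub>S\<^esub> (insert (\<theta> a) ?K)"
    using S.adjoin_self_module[OF K] ab by simp
  ultimately show ?thesis
    using N.filtration_trans[OF len_bound_insert[OF I ab(1) len(1)]] by simp
qed

text \<open>An element of \<open>I\<close> outside \<open>P\<close> becomes a unit, so the bound
  ideal is all of \<open>S\<close>.\<close>

lemma len_bound_not_subset:
  assumes I: "ideal I B" and "\<not> I \<subseteq> P"
  shows "len (bound_ideal I q) (carrier S) 0"
proof -
  obtain x where x: "x \<in> I" "x \<notin> P" using assms(2) by blast
  have xc: "x \<in> carrier B" using ideal.Icarr[OF I x(1)] .
  have "\<theta> x \<otimes>\<^bsub>S\<^esub> inv\<^bsub>S\<^esub> (\<theta> x) \<in> bound_ideal I q"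
    using ideal.I_r_closed[OF bound_ideal[OF I] mem_bound_ideal(1)[OF I x(1)]] S.Units_inv_closed[OF unit[OF xc x(2)]] .
  then have "bound_ideal I q = carrier S"
    using ideal.one_imp_carrier[OF bound_ideal[OF I]] S.Units_r_inv[OF unit[OF xc x(2)]] by simp
  then show ?thesis
    using filtration.base[of "carrier S" S "self_module S"] S.submodule_self_module_iff S.oneideal by simp
qed

lemma len_bound_power:
  assumes I: "ideal I B" and f: "f \<in> P"
    and len: "len (bound_ideal (Idl (insert f I)) q) (carrier S) n"
  shows "len (bound_ideal I q) (carrier S) (q * n)"
  using S.filtration_power[OF len_bound_insert[OF I P.Icarr[OF f] len] bound_ideal[OF I]]
    mem_bound_ideal(2)[OF I f] P.Icarr[OF f] by simp

text \<open>Modulo the bound ideal \<open>K\<close>, the images of \<open>F\<close> generate the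
  maximal ideal, since the multipliers \<open>s\<close> become units. So the quotient of
  \<open>S\<close> by \<open>K + (\<theta> F)\<close> has length at most 1, and as the
  \<open>q\<close>-th powers of \<open>\<theta> F\<close> lie in \<open>K\<close>, each element of
  \<open>F\<close> costs a factor \<open>q\<close>.\<close>

lemma len_bound_regular:
  assumes I: "ideal I B" and F: "finite F" "F \<subseteq> P"
    and gen: "\<And>b. b \<in> P \<Longrightarrow> \<exists>s\<in>carrier B - P. s \<otimes> b \<in> Idl (F \<union> I)"
    and q: "q \<ge> 1"
  shows "len (bound_ideal I q) (carrier S) (q ^ card F)"
proof -
  interpret N: module S "self_module S" by (rule S.module_self_module)
  let ?K = "bound_ideal I q" and ?J = "Idl\<^bsub>S\<^esub> (bound_ideal I q \<union> \<theta> ` F)"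
  note K = bound_ideal[OF I, of q]
  have Fc: "F \<subseteq> carrier B" using F P.Icarr by blast
  have sub: "?K \<union> \<theta> ` F \<subseteq> carrier S" using ideal.Icarr[OF K] Fc by auto
  note J = S.genideal_ideal[OF sub] and J_self = S.genideal_self[OF sub]
  have "ideal {r \<in> carrier B. \<theta> r \<in> ?J} B" by (rule H.ideal_vimage[OF J])
  then have "Idl (F \<union> I) \<subseteq> {r \<in> carrier B. \<theta> r \<in> ?J}"
    using Fc ideal.Icarr[OF I] J_self mem_bound_ideal(1)[OF I] by (intro B.genideal_minimal) auto
  have "\<theta> ` P \<subseteq> ?J"
  proof
    fix t assume "t \<in> \<theta> ` P"
    then obtain b where b: "b \<in> P" "t = \<theta> b" by blast
    obtain s where s: "s \<in> carrier B" "s \<notin> P" "s \<otimes> b \<in> Idl (F \<union> I)" using gen[OF b(1)] by blast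
    then have "\<theta> (s \<otimes> b) \<in> ?J" using \<open>Idl (F \<union> I) \<subseteq> _\<close> by blast
    then have sb: "\<theta> s \<otimes>\<^bsub>S\<^esub> t \<in> ?J" using s b P.Icarr by simp
    have tc: "t \<in> carrier S" and u: "\<theta> s \<in> Units S" using b P.Icarr unit s by auto
    have "inv\<^bsub>S\<^esub> (\<theta> s) \<otimes>\<^bsub>S\<^esub> (\<theta> s \<otimes>\<^bsub>S\<^esub> t) = t"
      using u tc S.m_assoc[of "inv\<^bsub>S\<^esub> (\<theta> s)" "\<theta> s" t] by (simp add: S.Units_closed)
    then show "t \<in> ?J" using ideal.I_l_closed[OF J sb S.Units_inv_closed[OF u]] by simp
  qed
  then have mJ: "maxi \<subseteq> ?J" by (rule S.genideal_minimal[OF J])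
  have m: "submodule maxi S (self_module S)" using maxi_ideal S.submodule_self_module_iff by blast
  have "len maxi (adjoin S (self_module S) maxi \<one>\<^bsub>S\<^esub>) 1"
    by (rule N.filtration_adjoin[OF m]) auto
  moreover have "adjoin S (self_module S) maxi \<one>\<^bsub>S\<^esub> = carrier S"
    using N.mem_adjoin[OF m, of "\<one>\<^bsub>S\<^esub>"] N.adjoin_submodule[OF m, of "\<one>\<^bsub>S\<^esub>"] S.submodule_self_module_iff
      ideal.one_imp_carrier by fastforce
  ultimately have "len maxi (carrier S) 1" by simp
  then have "len ?J (carrier S) 1"
    by (rule N.filtration_enlarge) (use mJ J ideal.Icarr[OF J] S.submodule_self_module_iff in auto)
  then have "len ?K (carrier S) (q ^ card (\<theta> ` F) * 1)"
    by (intro S.filtration_powers[OF _ _ K]) (use F Fc mem_bound_ideal(2)[OF I] in auto)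
  \<comment> \<open>\<open>\<theta>\<close> may identify elements of \<open>F\<close>, so
    \<open>q \<ge> 1\<close> is needed to return to \<open>card F\<close>.\<close>
  moreover have "q ^ card (\<theta> ` F) \<le> q ^ card F"
    by (rule power_increasing[OF card_image_le[OF F(1)] q])
  ultimately show ?thesis using N.filtration_mono by simp
qed

end


section \<open>Noetherian induction over the ideals of a ring\<close>

definition prime_interval :: "('a, 'c) ring_scheme \<Rightarrow> 'a set \<Rightarrow> 'a set \<Rightarrow> 'a set set" where
  "prime_interval B I P = {Q. primeideal Q B \<and> I \<subseteq> Q \<and> Q \<subseteq> P}"

lemma (in cring) Idl_insert_facts:
  assumes "ideal I R" "a \<in> carrier R"
  shows "ideal (Idl (insert a I)) R" "I \<subseteq> Idl (insert a I)" "a \<in> Idl (insert a I)"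
    "\<And>J. ideal J R \<Longrightarrow> I \<subseteq> J \<Longrightarrow> a \<in> J \<Longrightarrow> Idl (insert a I) \<subseteq> J"
proof -
  have sub: "insert a I \<subseteq> carrier R" using assms(2) ideal.Icarr[OF assms(1)] by blast
  show "ideal (Idl (insert a I)) R" by (rule genideal_ideal[OF sub])
  show "I \<subseteq> Idl (insert a I)" "a \<in> Idl (insert a I)" using genideal_self[OF sub] by auto
  show "Idl (insert a I) \<subseteq> J" if "ideal J R" "I \<subseteq> J" "a \<in> J" for J
    using that by (intro genideal_minimal) auto
qed

text \<open>If \<open>I\<close> is prime, catenarity bounds the chains from \<open>I\<close> to
  \<open>P\<close>, and a chain in the interval can be completed to one of these. If
  \<open>I\<close> is not prime, with \<open>a b\<close> in \<open>I\<close>, the smallest member of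
  a chain contains \<open>a\<close> or \<open>b\<close>; then all members do, and the chain lies
  over a larger ideal.\<close>

lemma prime_chains_bounded:
  fixes B (structure)
  assumes "cring B" "noetherian_ring B" "catenary B" "primeideal P B" "ideal I B"
  shows "\<exists>N. \<forall>xs. sorted_wrt (\<subset>) xs \<and> set xs \<subseteq> prime_interval B I P \<longrightarrow> length xs \<le> N"
proof -
  interpret B: cring B by fact
  interpret B: noetherian_ring B by fact
  show ?thesis using assms(5)
  proof (induction rule: B.noetherian_induct)
    case (step I)
    show ?case
    proof (cases "primeideal I B")
      case prime: True
      show ?thesis
      proof (cases "I \<subset> P")
        case True
        then obtain n where n: "\<And>xs. xs \<in> prime_chains B I P \<Longrightarrow> length xs \<le> n"
          using assms(3,4) prime unfolding catenary_def by blast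
        have "length xs \<le> n + 2" if xs: "sorted_wrt (\<subset>) xs" "set xs \<subseteq> prime_interval B I P" for xs
        proof -
          \<comment> \<open>The chain \<open>xs\<close> may or may not contain the endpoints, so
            they are removed before \<open>I\<close> and \<open>P\<close> are put at the two
            ends.\<close>
          define ys where "ys = filter (\<lambda>Q. Q \<noteq> I \<and> Q \<noteq> P) xs"
          have ys: "Q \<in> set ys \<Longrightarrow> primeideal Q B \<and> I \<subset> Q \<and> Q \<subset> P" for Q
            using xs(2) unfolding ys_def prime_interval_def by auto
          have "sorted_wrt (\<subset>) ys" unfolding ys_def by (rule sorted_wrt_filter[OF xs(1)])
          then have "I # ys @ [P] \<in> prime_chains B I P"
            using ys True assms(4) prime unfolding prime_chains_def by (auto simp: sorted_wrt_append)
          then have "length ys + 2 \<le> n" using n by fastforce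
          moreover have "length xs \<le> length ys + 2"
          proof -
            have "distinct xs" using xs(1) by (induction xs) auto
            then have "length xs = card (set xs)" by (simp add: distinct_card)
            also have "\<dots> \<le> card (set ys \<union> {I, P})" by (rule card_mono) (auto simp: ys_def)
            also have "\<dots> \<le> card (set ys) + card {I, P}" by (rule card_Un_le)
            also have "\<dots> \<le> length ys + 2" by (intro add_mono card_length) (auto simp: card_insert_if)
            finally show ?thesis .
          qed
          ultimately show ?thesis by simp
        qed
        then show ?thesis by blast
      next
        case False
        have "length xs \<le> 1" if xs: "sorted_wrt (\<subset>) xs" "set xs \<subseteq> prime_interval B I P" for xs
        proof (rule ccontr)
          assume "\<not> length xs \<le> 1"
          then obtain C D ys where "xs = C # D # ys" by (cases xs rule: remdups_adj.cases) auto
          then show False using xs False unfolding prime_interval_def by auto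
        qed
        then show ?thesis by blast
      qed
    next
      case notprime: False
      show ?thesis
      proof (cases "I = carrier B")
        case True
        then have "prime_interval B I P = {}"
          using primeideal.I_notcarr[OF assms(4)] ideal.Icarr[OF primeideal.axioms(1)[OF assms(4)]]
          unfolding prime_interval_def by blast
        then show ?thesis by (intro exI[of _ 0]) auto
      next
        case False
        obtain a b where ab: "a \<in> carrier B" "b \<in> carrier B" "a \<otimes> b \<in> I" "a \<notin> I" "b \<notin> I"
          using B.not_primeE[OF step(1) False notprime] by blast
        note fa = B.Idl_insert_facts[OF step(1) ab(1)] and fb = B.Idl_insert_facts[OF step(1) ab(2)]
        obtain Na where Na: "\<And>xs. sorted_wrt (\<subset>) xs \<Longrightarrow> set xs \<subseteq> prime_interval B (Idl (insert a I)) P \<Longrightarrow> length xs \<le> Na"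
          using step(2)[OF fa(1)] fa(2,3) ab(4) by blast
        obtain Nb where Nb: "\<And>xs. sorted_wrt (\<subset>) xs \<Longrightarrow> set xs \<subseteq> prime_interval B (Idl (insert b I)) P \<Longrightarrow> length xs \<le> Nb"
          using step(2)[OF fb(1)] fb(2,3) ab(5) by blast
        have "length xs \<le> Na + Nb" if xs: "sorted_wrt (\<subset>) xs" "set xs \<subseteq> prime_interval B I P" for xs
        proof (cases xs)
          case (Cons Q ys)
          have Q: "primeideal Q B" "I \<subseteq> Q" using xs(2) Cons unfolding prime_interval_def by auto
          have up: "Q \<subseteq> Q'" if "Q' \<in> set xs" for Q' using that xs(1) Cons by auto
          have mem: "primeideal Q' B" "ideal Q' B" "I \<subseteq> Q'" "Q' \<subseteq> P" if "Q' \<in> set xs" for Q'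
            using subsetD[OF xs(2) that] primeideal.axioms(1)[of Q' B] unfolding prime_interval_def by auto
          have "a \<in> Q \<or> b \<in> Q" using primeideal.I_prime[OF Q(1) ab(1,2)] ab(3) Q(2) by blast
          then show ?thesis
          proof
            assume "a \<in> Q"
            then have "set xs \<subseteq> prime_interval B (Idl (insert a I)) P"
              using fa(4)[OF mem(2,3)] up mem(1,4) unfolding prime_interval_def by blast
            then show ?thesis using Na[OF xs(1)] by simp
          next
            assume "b \<in> Q"
            then have "set xs \<subseteq> prime_interval B (Idl (insert b I)) P"
              using fb(4)[OF mem(2,3)] up mem(1,4) unfolding prime_interval_def by blast
            then show ?thesis using Nb[OF xs(1)] by simp
          qed
        qed simp
        then show ?thesis by blast
      qed
    qed
  qed
qed

text \<open>HOL cannot quantify over types, so the localizations \<open>S\<close> range over the rings of one given type.\<close>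

definition bounded_by ::
    "('b, 'u) ring_scheme \<Rightarrow> 'b set \<Rightarrow> 'b set \<Rightarrow> ('s, 'v) ring_scheme itself \<Rightarrow> nat \<Rightarrow> nat \<Rightarrow> bool" where
  "bounded_by B P I (_ :: ('s, 'v) ring_scheme itself) C h \<longleftrightarrow>
     (\<forall>q (S :: ('s, 'v) ring_scheme) \<theta>. q \<ge> 1 \<longrightarrow> prime_localization B P S \<theta> \<longrightarrow>
        filtration S (self_module S) (Idl\<^bsub>S\<^esub> (\<theta> ` P)) (prime_localization.bound_ideal P S \<theta> I q) (carrier S)
          (C * q ^ h))"

text \<open>\<open>C\<close> must be found before \<open>P\<close>, while the exponent
  \<open>h\<close> and its chain may depend on \<open>P\<close>. Carrying the chain itself through
  the induction avoids any comparison of heights: each case only has to exhibit a chain matching its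
  exponent. The assumption \<open>regular\<close> has the form in which
  \<open>generic_parameters\<close> delivers generic regularity.\<close>

lemma uniform_bound:
  fixes B :: "('b, 'u) ring_scheme" (structure) and T :: "('s, 'v) ring_scheme itself"
  assumes "cring B" "noetherian_ring B"
    and regular: "\<And>p. primeideal p B \<Longrightarrow> \<exists>f\<in>carrier B - p. \<forall>P. primeideal P B \<longrightarrow> p \<subseteq> P \<longrightarrow> f \<notin> P \<longrightarrow>
        (\<exists>F xs. finite F \<and> F \<subseteq> P \<and> length xs = Suc (card F) \<and> sorted_wrt (\<subset>) xs \<and>
           set xs \<subseteq> prime_interval B p P \<and> (\<forall>b\<in>P. \<exists>s\<in>carrier B - P. s \<otimes> b \<in> Idl (F \<union> p)))"
    and I: "ideal I B"
  shows "\<exists>C. \<forall>P. primeideal P B \<longrightarrow> I \<subseteq> P \<longrightarrow>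
      (\<exists>h xs. length xs = Suc h \<and> sorted_wrt (\<subset>) xs \<and> set xs \<subseteq> prime_interval B I P \<and> bounded_by B P I T C h)"
proof -
  interpret B: cring B by fact
  interpret B: noetherian_ring B by fact
  let ?ex = "\<lambda>I K P C. \<exists>h xs. length xs = Suc h \<and> sorted_wrt (\<subset>) xs \<and> set xs \<subseteq> prime_interval B I P \<and>
    bounded_by B P K T C h"
  show ?thesis using I
  proof (induction rule: B.noetherian_induct)
    case (step I)
    consider "I = carrier B" | "I \<noteq> carrier B" "\<not> primeideal I B" | "primeideal I B" by blast
    then show ?case
    proof cases
      case 1
      have False if "primeideal P B" "I \<subseteq> P" for P
        using primeideal.I_notcarr[OF that(1)] ideal.Icarr[OF primeideal.axioms(1)[OF that(1)]] that(2) 1 by blast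
      then show ?thesis by blast
    next
      case 2
      obtain a b where ab: "a \<in> carrier B" "b \<in> carrier B" "a \<otimes> b \<in> I" "a \<notin> I" "b \<notin> I"
        using B.not_primeE[OF step(1) 2] by blast
      have *: "\<exists>C. \<forall>P. primeideal P B \<longrightarrow> I \<subseteq> P \<longrightarrow>
          ?ex I (Idl (insert c I)) P C" if c: "c \<in> carrier B" "c \<notin> I" for c
      proof -
        note fc = B.Idl_insert_facts[OF step(1) c(1)]
        obtain C where C: "\<And>P. primeideal P B \<Longrightarrow> Idl (insert c I) \<subseteq> P \<Longrightarrow>
          ?ex (Idl (insert c I)) (Idl (insert c I)) P C"
          using step(2)[OF fc(1)] fc(2,3) c(2) by blast
        have "?ex I (Idl (insert c I)) P C" if P: "primeideal P B" "I \<subseteq> P" for P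
        proof (cases "Idl (insert c I) \<subseteq> P")
          case True
          have "prime_interval B (Idl (insert c I)) P \<subseteq> prime_interval B I P"
            using fc(2) unfolding prime_interval_def by blast
          then show ?thesis using C[OF P(1) True] by blast
        next
          case False
          \<comment> \<open>Here the bound ideal is the unit ideal, so the length is 0 and the
            one-member chain \<open>[P]\<close> is long enough.\<close>
          have "bounded_by B P (Idl (insert c I)) T C 0"
            unfolding bounded_by_def
          proof (intro allI impI)
            fix q :: nat and S :: "('s, 'v) ring_scheme" and \<theta>
            assume "prime_localization B P S \<theta>"
            then interpret prime_localization B P S \<theta> .
            interpret N: module S "self_module S" by (rule S.module_self_module)
            show "len (bound_ideal (Idl (insert c I)) q) (carrier S) (C * q ^ 0)"
              by (rule N.filtration_mono[OF len_bound_not_subset[OF fc(1) False]]) simp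
          qed
          moreover have "set [P] \<subseteq> prime_interval B I P" using P unfolding prime_interval_def by simp
          ultimately show ?thesis by (intro exI[of _ 0] exI[of _ "[P]"]) simp
        qed
        then show ?thesis by blast
      qed
      obtain Ca where Ca: "\<And>P. primeideal P B \<Longrightarrow> I \<subseteq> P \<Longrightarrow>
          ?ex I (Idl (insert a I)) P Ca"
        using *[OF ab(1,4)] by blast
      obtain Cb where Cb: "\<And>P. primeideal P B \<Longrightarrow> I \<subseteq> P \<Longrightarrow>
          ?ex I (Idl (insert b I)) P Cb"
        using *[OF ab(2,5)] by blast
      have "?ex I I P (Ca + Cb)" if P: "primeideal P B" "I \<subseteq> P" for P
      proof -
        obtain ha xa where xa: "length xa = Suc ha" "sorted_wrt (\<subset>) xa" "set xa \<subseteq> prime_interval B I P"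
          and ba: "bounded_by B P (Idl (insert a I)) T Ca ha" using Ca[OF P] by blast
        obtain hb xb where xb: "length xb = Suc hb" "sorted_wrt (\<subset>) xb" "set xb \<subseteq> prime_interval B I P"
          and bb: "bounded_by B P (Idl (insert b I)) T Cb hb" using Cb[OF P] by blast
        \<comment> \<open>Since \<open>q \<ge> 1\<close>, both bounds persist for a larger exponent,
          so the longer of the two chains serves for the sum.\<close>
        have bound: "bounded_by B P I T (Ca + Cb) h" if h: "ha \<le> h" "hb \<le> h" for h
          unfolding bounded_by_def
        proof (intro allI impI)
          fix q :: nat and S :: "('s, 'v) ring_scheme" and \<theta>
          assume q: "q \<ge> 1" and "prime_localization B P S \<theta>"
          then interpret prime_localization B P S \<theta> by simp
          interpret N: module S "self_module S" by (rule S.module_self_module)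
          have "len (bound_ideal I q) (carrier S) (Cb * q ^ hb + Ca * q ^ ha)"
            using ba bb q prime_localization_axioms
            unfolding bounded_by_def by (intro len_bound_split[OF step(1) ab(1-3)]) auto
          moreover have "Cb * q ^ hb + Ca * q ^ ha \<le> (Ca + Cb) * q ^ h"
            using h q by (simp add: add_mult_distrib add.commute add_mono power_increasing)
          ultimately show "len (bound_ideal I q) (carrier S) ((Ca + Cb) * q ^ h)"
            by (rule N.filtration_mono)
        qed
        show ?thesis
        proof (cases "ha \<le> hb")
          case True
          then show ?thesis using xb bound[of hb] by blast
        next
          case False
          then show ?thesis using xa bound[of ha] by auto
        qed
      qed
      then show ?thesis by blast
    next
      case 3
      obtain f where f: "f \<in> carrier B" "f \<notin> I" and reg: "\<And>P. primeideal P B \<Longrightarrow> I \<subseteq> P \<Longrightarrow> f \<notin> P \<Longrightarrow>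
        (\<exists>F xs. finite F \<and> F \<subseteq> P \<and> length xs = Suc (card F) \<and> sorted_wrt (\<subset>) xs \<and>
           set xs \<subseteq> prime_interval B I P \<and> (\<forall>b\<in>P. \<exists>s\<in>carrier B - P. s \<otimes> b \<in> Idl (F \<union> I)))"
        using regular[OF 3] by blast
      let ?J = "Idl (insert f I)"
      note ff = B.Idl_insert_facts[OF step(1) f(1)]
      obtain C where C: "\<And>P. primeideal P B \<Longrightarrow> ?J \<subseteq> P \<Longrightarrow>
          ?ex ?J ?J P C"
        using step(2)[OF ff(1)] ff(2,3) f(2) by blast
      \<comment> \<open>\<open>C\<close> serves the primes containing \<open>f\<close>, 1 serves the
        others, and \<open>C + 1\<close> dominates both.\<close>
      have "?ex I I P (C + 1)" if P: "primeideal P B" "I \<subseteq> P" for P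
      proof (cases "f \<in> P")
        case True
        have "?J \<subseteq> P" by (rule ff(4)[OF primeideal.axioms(1)[OF P(1)] P(2) True])
        then obtain h xs where xs: "length xs = Suc h" "sorted_wrt (\<subset>) xs" "set xs \<subseteq> prime_interval B ?J P"
          and b: "bounded_by B P ?J T C h" using C[OF P(1)] by blast
        have "\<forall>Q\<in>set xs. I \<subset> Q" using xs(3) ff(2,3) f(2) unfolding prime_interval_def by blast
        then have "sorted_wrt (\<subset>) (I # xs)" using xs(2) by simp
        moreover have "set (I # xs) \<subseteq> prime_interval B I P"
          using xs(3) ff(2) 3 P unfolding prime_interval_def by auto
        moreover have "bounded_by B P I T (C + 1) (Suc h)"
          unfolding bounded_by_def
        proof (intro allI impI)
          fix q :: nat and S :: "('s, 'v) ring_scheme" and \<theta>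
          assume q: "q \<ge> 1" and "prime_localization B P S \<theta>"
          then interpret prime_localization B P S \<theta> by simp
          interpret N: module S "self_module S" by (rule S.module_self_module)
          have "len (bound_ideal I q) (carrier S) (q * (C * q ^ h))"
            using b q prime_localization_axioms
            unfolding bounded_by_def by (intro len_bound_power[OF step(1) True]) auto
          then show "len (bound_ideal I q) (carrier S) ((C + 1) * q ^ Suc h)"
            by (rule N.filtration_mono) simp
        qed
        ultimately show ?thesis using xs(1) by (intro exI[of _ "Suc h"] exI[of _ "I # xs"]) simp
      next
        case False
        obtain F xs where F: "finite F" "F \<subseteq> P" "length xs = Suc (card F)" "sorted_wrt (\<subset>) xs"
           "set xs \<subseteq> prime_interval B I P" "\<And>b. b \<in> P \<Longrightarrow> \<exists>s\<in>carrier B - P. s \<otimes> b \<in> Idl (F \<union> I)"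
          using reg[OF P False] by blast
        have "bounded_by B P I T (C + 1) (card F)"
          unfolding bounded_by_def
        proof (intro allI impI)
          fix q :: nat and S :: "('s, 'v) ring_scheme" and \<theta>
          assume q: "q \<ge> 1" and "prime_localization B P S \<theta>"
          then interpret prime_localization B P S \<theta> by simp
          interpret N: module S "self_module S" by (rule S.module_self_module)
          show "len (bound_ideal I q) (carrier S) ((C + 1) * q ^ card F)"
            by (rule N.filtration_mono[OF len_bound_regular[OF step(1) F(1,2,6) q]]) simp_all
        qed
        then show ?thesis using F by blast
      qed
      then show ?thesis by blast
    qed
  qed
qed


section \<open>Parameters at regular points\<close>

lemma chain_height_singleton:
  assumes "F \<subseteq> {A}"
  shows "chain_height F = 0"
proof -
  have "chain_height F \<le> enat 0"
  proof (rule chain_height_leI, rule ccontr)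
    fix xs assume xs: "sorted_wrt (\<subset>) xs" "set xs \<subseteq> F" and "\<not> length xs \<le> Suc 0"
    then obtain C D ys where "xs = C # D # ys" by (cases xs rule: remdups_adj.cases) auto
    then have "C = A" "D = A" "C \<subset> D" using xs assms by auto
    then show False by blast
  qed
  then show ?thesis by (simp add: enat_0)
qed

section \<open>Ideals and primes under localization\<close>

lemma (in ring_localization) extension_ideal:
  assumes "ideal I R"
  shows "ideal {fr a s | a s. a \<in> I \<and> s \<in> S} (loc_ring R S)"
proof -
  let ?S = "loc_ring R S" and ?E = "{fr a s | a s. a \<in> I \<and> s \<in> S}"
  interpret I: ideal I R by fact
  interpret Q: cring "?S" by (rule cring_loc_ring)
  show ?thesis
  proof (rule Q.ideal_intro)
    show "?E \<subseteq> carrier (?S)"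
      using ring_frac_closed I.Icarr by auto
    show "\<zero>\<^bsub>?S\<^esub> \<in> ?E"
      using I.zero_closed S.one_closed unfolding loc_ring_simps(3) by blast
  next
    fix x y assume "x \<in> ?E" "y \<in> ?E"
    then obtain a s b t where x: "x = fr a s" "a \<in> I" "s \<in> S" "y = fr b t" "b \<in> I" "t \<in> S" by blast
    then have "x \<oplus>\<^bsub>?S\<^esub> y = fr (t \<otimes> a \<oplus> s \<otimes> b) (s \<otimes> t)"
      using I.Icarr by (simp add: loc_ring_add)
    moreover have "t \<otimes> a \<oplus> s \<otimes> b \<in> I" "s \<otimes> t \<in> S"
      using x I.I_l_closed I.a_closed by auto
    ultimately show "x \<oplus>\<^bsub>?S\<^esub> y \<in> ?E" by blast
  next
    fix r x assume r: "r \<in> carrier (?S)" and "x \<in> ?E"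
    then obtain a s where a: "x = fr a s" "a \<in> I" "s \<in> S" by blast
    obtain b t where b: "r = fr b t" "b \<in> carrier R" "t \<in> S" using r by (rule ring_frac_cases)
    note x = a b
    then have "r \<otimes>\<^bsub>?S\<^esub> x = fr (b \<otimes> a) (t \<otimes> s)"
      using I.Icarr by (simp add: loc_ring_mult)
    moreover have "b \<otimes> a \<in> I" "t \<otimes> s \<in> S" using x I.I_l_closed by auto
    ultimately show "r \<otimes>\<^bsub>?S\<^esub> x \<in> ?E" by blast
  qed
qed

lemma (in ring_localization) Idl_loc_map:
  assumes "ideal I R"
  shows "Idl\<^bsub>loc_ring R S\<^esub> (loc_map R S ` I) = {fr a s | a s. a \<in> I \<and> s \<in> S}"
    (is "?I = ?E")
proof
  interpret I: ideal I R by fact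
  interpret Q: cring "loc_ring R S" by (rule cring_loc_ring)
  have sub: "loc_map R S ` I \<subseteq> carrier (loc_ring R S)" using I.Icarr loc_map_closed by auto
  have "loc_map R S a \<in> ?E" if "a \<in> I" for a
    using that S.one_closed unfolding loc_map_def by blast
  then show "?I \<subseteq> ?E"
    by (intro Q.genideal_minimal extension_ideal assms) auto
  show "?E \<subseteq> ?I"
  proof clarify
    fix a s assume a: "a \<in> I" "s \<in> S"
    have "fr \<one> s \<otimes>\<^bsub>loc_ring R S\<^esub> loc_map R S a = fr a s"
      using a I.Icarr by (simp add: loc_map_def loc_ring_mult)
    moreover have "loc_map R S a \<in> ?I"
      using Q.genideal_self[OF sub] a by blast
    ultimately show "fr a s \<in> ?I"
      using ideal.I_l_closed[OF Q.genideal_ideal[OF sub], of "loc_map R S a" "fr \<one> s"] ring_frac_closed a by simp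
  qed
qed

lemma (in primeideal) submonoid_compl: "submonoid (carrier R - I) R"
proof
  show "\<one> \<in> carrier R - I" using one_imp_carrier I_notcarr by auto
  show "x \<otimes> y \<in> carrier R - I" if "x \<in> carrier R - I" "y \<in> carrier R - I" for x y
    using that I_prime by auto
qed auto

lemma (in primeideal) ring_localization_compl: "ring_localization R (carrier R - I)"
  by (intro ring_localization.intro is_cring submonoid_compl)

lemma (in primeideal) prime_localization_loc_at:
  "prime_localization R I (loc_at R I) (loc_map R (carrier R - I))"
proof -
  interpret L: ring_localization R "carrier R - I" by (rule ring_localization_compl)
  note [simp del] = L.S.mem_carrier
  interpret Q: cring "loc_at R I" by (rule L.cring_loc_ring)
  show ?thesis
  proof (rule prime_localization.intro[OF is_cring Q.cring_axioms primeideal], rule prime_localization_axioms.intro)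
    show "loc_map R (carrier R - I) \<in> ring_hom R (loc_at R I)" by (rule L.loc_map_hom)
    show "loc_map R (carrier R - I) b \<in> Units (loc_at R I)" if "b \<in> carrier R" "b \<notin> I" for b
      by (rule L.loc_map_unit) (use that in blast)
    show "\<exists>b\<in>carrier R. \<exists>w\<in>carrier R - I. t \<otimes>\<^bsub>loc_at R I\<^esub> loc_map R (carrier R - I) w = loc_map R (carrier R - I) b"
      if t: "t \<in> carrier (loc_at R I)" for t
    proof -
      obtain a s where "t = L.fr a s" "a \<in> carrier R" "s \<in> carrier R - I" using t by (rule L.ring_frac_cases)
      then show ?thesis using L.frac_mult_loc_map by blast
    qed
    show "\<one>\<^bsub>loc_at R I\<^esub> \<notin> Idl\<^bsub>loc_at R I\<^esub> (loc_map R (carrier R - I) ` I)"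
    proof
      assume "\<one>\<^bsub>loc_at R I\<^esub> \<in> Idl\<^bsub>loc_at R I\<^esub> (loc_map R (carrier R - I) ` I)"
      then obtain a s where a: "a \<in> I" "s \<in> carrier R - I" "L.fr \<one> \<one> = L.fr a s"
        unfolding L.Idl_loc_map[OF is_ideal] L.loc_ring_simps(4) by blast
      then obtain u where u: "u \<in> carrier R - I" "u \<otimes> (s \<otimes> \<one>) = u \<otimes> (\<one> \<otimes> a)"
        using L.ring_frac_eq_iff[OF one_closed Icarr[OF a(1)] L.S.one_closed a(2)] by blast
      then have "u \<otimes> s \<in> I" using I_l_closed[OF a(1), of u] Icarr[OF a(1)] a(2) by simp
      then show False using u a I_prime[of u s] by auto
    qed
  qed
qed

lemma primeideal_vimage:
  assumes "ring_hom_ring R S h" "cring R" "primeideal P S"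
  shows "primeideal {r \<in> carrier R. h r \<in> P} R"
proof -
  interpret h: ring_hom_ring R S h by fact
  interpret P: primeideal P S by fact
  have "ideal {r \<in> carrier R. h r \<in> P} R" by (rule h.ideal_vimage[OF P.is_ideal])
  then show ?thesis
  proof (rule primeidealI[OF _ assms(2)])
    have "\<one>\<^bsub>S\<^esub> \<notin> P" using P.one_imp_carrier P.I_notcarr by blast
    then show "carrier R \<noteq> {r \<in> carrier R. h r \<in> P}" using h.hom_one h.R.one_closed by force
    show "a \<in> {r \<in> carrier R. h r \<in> P} \<or> b \<in> {r \<in> carrier R. h r \<in> P}"
      if "a \<in> carrier R" "b \<in> carrier R" "a \<otimes>\<^bsub>R\<^esub> b \<in> {r \<in> carrier R. h r \<in> P}" for a b
      using that P.I_prime[of "h a" "h b"] by auto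
  qed
qed

lemma (in primeideal) not_Unit: 
  assumes "x \<in> I"
  shows "x \<notin> Units R"
proof
  assume x: "x \<in> Units R"
  then have "inv x \<otimes> x \<in> I" using I_l_closed assms by blast
  then show False using x one_imp_carrier I_notcarr by simp
qed

context prime_localization
begin

lemma contract_prime:
  assumes "primeideal Q S"
  shows "primeideal {b \<in> carrier B. \<theta> b \<in> Q} B" "{b \<in> carrier B. \<theta> b \<in> Q} \<subseteq> P"
  using primeideal_vimage[OF H.ring_hom_ring_axioms B.cring_axioms assms] unit primeideal.not_Unit[OF assms] by auto

text \<open>An element of \<open>Q'\<close> outside \<open>Q\<close> differs from its numerator by a
  unit factor, so the numerator separates the contractions.\<close>

lemma contract_strict:
  assumes Q: "ideal Q S" "ideal Q' S" "Q \<subset> Q'"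
  shows "{b \<in> carrier B. \<theta> b \<in> Q} \<subset> {b \<in> carrier B. \<theta> b \<in> Q'}"
proof -
  obtain t where t: "t \<in> Q'" "t \<notin> Q" using Q by blast
  have tc: "t \<in> carrier S" using ideal.Icarr[OF Q(2) t(1)] .
  obtain b w where b: "b \<in> carrier B" "w \<in> carrier B" "w \<notin> P" "t \<otimes>\<^bsub>S\<^esub> \<theta> w = \<theta> b"
    using fraction[OF tc] by blast
  have w: "\<theta> w \<in> Units S" using unit b by blast
  have "\<theta> b \<in> Q'" using ideal.I_r_closed[OF Q(2) t(1)] b by (metis H.hom_closed)
  moreover have "\<theta> b \<notin> Q"
  proof
    assume "\<theta> b \<in> Q"
    then have "t \<otimes>\<^bsub>S\<^esub> \<theta> w \<otimes>\<^bsub>S\<^esub> inv\<^bsub>S\<^esub> (\<theta> w) \<in> Q"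
      using ideal.I_r_closed[OF Q(1)] w b by (metis S.Units_inv_closed)
    then show False using t(2) tc w by (simp add: S.m_assoc S.Units_closed)
  qed
  ultimately show ?thesis using b Q(3) by blast
qed

lemma maximalideal_eq:
  assumes "maximalideal J S"
  shows "J = maxi"
proof -
  interpret J: maximalideal J S by fact
  have "J \<subseteq> maxi"
  proof (rule ccontr)
    assume "\<not> J \<subseteq> maxi"
    then obtain t where t: "t \<in> J" "t \<notin> maxi" by blast
    then have u: "t \<in> Units S" using not_maxi_unit[of t] J.Icarr[of t] by simp
    have "\<one>\<^bsub>S\<^esub> \<in> J"
      using J.I_l_closed[OF t(1) S.Units_inv_closed[OF u]] S.Units_l_inv[OF u] by simp
    then show False using J.one_imp_carrier J.I_notcarr by simp
  qed
  moreover have "maxi \<noteq> carrier S" using proper S.one_closed by blast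
  ultimately show ?thesis
    using J.I_maximal[OF maxi_ideal] ideal.Icarr[OF maxi_ideal] by blast
qed

end

text \<open>Denominators are cleared: the numerators of a regular system of parameters generate
  \<open>Q\<close> up to multipliers outside \<open>Q\<close>, and a longest chain of primes of the
  local ring is contracted to \<open>D\<close>. Generators and chain can be matched in number
  because the Krull dimension equals the number of parameters.\<close>

lemma regular_local_ring_parameters:
  fixes D (structure)
  assumes "cring D" and Q: "primeideal Q D" and reg: "regular_local_ring (loc_at D Q)"
  obtains F xs where "finite F" "F \<subseteq> Q" "length xs = Suc (card F)" "sorted_wrt (\<subset>) xs"
    "\<And>P. P \<in> set xs \<Longrightarrow> primeideal P D \<and> P \<subseteq> Q" "\<And>b. b \<in> Q \<Longrightarrow> \<exists>s\<in>carrier D - Q. s \<otimes> b \<in> Idl F"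
proof -
  interpret Q: primeideal Q D by fact
  interpret L: ring_localization D "carrier D - Q" by (rule Q.ring_localization_compl)
  note [simp del] = L.S.mem_carrier
  let ?\<theta> = "loc_map D (carrier D - Q)" and ?S = "loc_at D Q"
  interpret T: prime_localization D Q ?S ?\<theta> by (rule Q.prime_localization_loc_at)
  obtain U where U: "finite U" "U \<subseteq> carrier ?S" "enat (card U) = krull_dim ?S" "maximalideal (Idl\<^bsub>?S\<^esub> U) ?S"
    using reg unfolding regular_local_ring_def by blast
  have max: "Idl\<^bsub>?S\<^esub> U = T.maxi" by (rule T.maximalideal_eq[OF U(4)])
  have maxE: "T.maxi = {L.fr a s | a s. a \<in> Q \<and> s \<in> carrier D - Q}" by (rule L.Idl_loc_map[OF Q.is_ideal])
  have "\<forall>u\<in>U. \<exists>a s. u = L.fr a s \<and> a \<in> Q \<and> s \<in> carrier D - Q"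
    using T.S.genideal_self[OF U(2)] unfolding max maxE by blast
  then obtain num den where nd: "\<And>u. u \<in> U \<Longrightarrow> u = L.fr (num u) (den u) \<and> num u \<in> Q \<and> den u \<in> carrier D - Q"
    by metis
  define F where "F = num ` U"
  \<comment> \<open>Distinct parameters may share a numerator, so equality of the cardinalities is
    not claimed.\<close>
  have F: "finite F" "F \<subseteq> Q" "card F \<le> card U"
    using U(1) nd card_image_le unfolding F_def by auto
  have Fc: "F \<subseteq> carrier D" using F(2) Q.Icarr by blast
  note I = Q.genideal_ideal[OF Fc] and self = Q.genideal_self[OF Fc]
  have gen: "\<exists>s\<in>carrier D - Q. s \<otimes> b \<in> Idl F" if b: "b \<in> Q" for b
  proof -
    have bc: "b \<in> carrier D" using Q.Icarr[OF b] .
    have "U \<subseteq> {L.fr a s | a s. a \<in> Idl F \<and> s \<in> carrier D - Q}"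
      using nd self unfolding F_def by blast
    then have "Idl\<^bsub>?S\<^esub> U \<subseteq> {L.fr a s | a s. a \<in> Idl F \<and> s \<in> carrier D - Q}"
      by (rule T.S.genideal_minimal[OF L.extension_ideal[OF I]])
    moreover have "?\<theta> b \<in> T.maxi" using T.S.genideal_self[OF T.image_P] b by blast
    ultimately obtain a s where a: "?\<theta> b = L.fr a s" "a \<in> Idl F" "s \<in> carrier D" "s \<notin> Q"
      unfolding max by blast
    have ac: "a \<in> carrier D" using ideal.Icarr[OF I a(2)] .
    \<comment> \<open>Equality of \<open>b/1\<close> and \<open>a/s\<close> only holds in
      \<open>D\<close> after multiplication by some \<open>u\<close>, so the multiplier of
      \<open>b\<close> is \<open>u s\<close>.\<close>
    obtain u where u: "u \<in> carrier D" "u \<notin> Q" "u \<otimes> (s \<otimes> b) = u \<otimes> (\<one> \<otimes> a)"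
      using a L.ring_frac_eq_iff[of b a "\<one>" s] bc ac L.S.one_closed unfolding loc_map_def by auto
    then have "(u \<otimes> s) \<otimes> b \<in> Idl F"
      using ideal.I_l_closed[OF I a(2) u(1)] ac bc a(3) by (simp add: Q.m_assoc)
    moreover have "u \<otimes> s \<in> carrier D - Q" using L.S.m_closed u a by simp
    ultimately show ?thesis by blast
  qed
  have "enat (card U) = chain_height {P. primeideal P ?S}" using U(3) unfolding krull_dim_def .
  moreover have "{P. primeideal P ?S} \<noteq> {}" using T.S.maximalideal_prime[OF U(4)] by blast
  ultimately obtain ys where ys: "sorted_wrt (\<subset>) ys" "set ys \<subseteq> {P. primeideal P ?S}" "length ys = Suc (card U)"
    using chain_height_attained by metis
  \<comment> \<open>The contracted chain has \<open>card U + 1\<close> members and is cut to the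
    \<open>card F + 1\<close> that the conclusion asks for.\<close>
  define xs where "xs = take (Suc (card F)) (map (\<lambda>P. {b \<in> carrier D. ?\<theta> b \<in> P}) ys)"
  have prime: "primeideal P ?S" if "P \<in> set ys" for P using ys(2) that by blast
  have "sorted_wrt (\<lambda>A C. {b \<in> carrier D. ?\<theta> b \<in> A} \<subset> {b \<in> carrier D. ?\<theta> b \<in> C}) ys"
    by (rule sorted_wrt_mono_rel[OF _ ys(1)], rule T.contract_strict) (use prime primeideal.axioms(1) in auto)
  then have "sorted_wrt (\<subset>) xs" unfolding xs_def by (intro sorted_wrt_take) (simp add: sorted_wrt_map)
  moreover have "length xs = Suc (card F)" unfolding xs_def using ys(3) F(3) by simp
  moreover have "primeideal P D \<and> P \<subseteq> Q" if "P \<in> set xs" for P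
    using in_set_takeD[OF that[unfolded xs_def]] T.contract_prime prime by auto
  ultimately show thesis using that F gen by blast
qed

text \<open>The localization is the field of fractions, regular with the empty system of parameters.
  It puts the zero ideal into the regular locus of a domain, so that the open set provided by
  \<open>J_2\<close> is nonempty.\<close>

lemma (in domain) regular_local_ring_generic: "regular_local_ring (loc_at R {\<zero>})"
proof -
  interpret Z: primeideal "{\<zero>}" R by (rule zeroprimeideal)
  interpret L: ring_localization R "carrier R - {\<zero>}" by (rule Z.ring_localization_compl)
  note [simp del] = L.S.mem_carrier
  let ?S = "loc_at R {\<zero>}"
  interpret T: prime_localization R "{\<zero>}" ?S "loc_map R (carrier R - {\<zero>})" by (rule Z.prime_localization_loc_at)
  have maxi: "T.maxi = {\<zero>\<^bsub>?S\<^esub>}" by (simp add: T.S.genideal_zero)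
  have "field ?S"
  proof (rule T.S.cring_fieldI)
    show "Units ?S = carrier ?S - {\<zero>\<^bsub>?S\<^esub>}"
    proof
      show "carrier ?S - {\<zero>\<^bsub>?S\<^esub>} \<subseteq> Units ?S"
        using T.not_maxi_unit unfolding maxi by blast
      have "\<zero>\<^bsub>?S\<^esub> \<notin> Units ?S"
      proof
        assume u: "\<zero>\<^bsub>?S\<^esub> \<in> Units ?S"
        then have "\<one>\<^bsub>?S\<^esub> = \<zero>\<^bsub>?S\<^esub>"
          using T.S.Units_l_inv[OF u] T.S.r_null[OF T.S.Units_inv_closed[OF u]] by simp
        then show False using T.proper unfolding maxi by simp
      qed
      then show "Units ?S \<subseteq> carrier ?S - {\<zero>\<^bsub>?S\<^esub>}" using T.S.Units_closed by auto
    qed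
  qed
  then interpret K: field ?S .
  have max: "maximalideal {\<zero>\<^bsub>?S\<^esub>} ?S" by (rule K.zeromaximalideal)
  have Idl_empty: "Idl\<^bsub>?S\<^esub> {} = {\<zero>\<^bsub>?S\<^esub>}"
  proof
    show "Idl\<^bsub>?S\<^esub> {} \<subseteq> {\<zero>\<^bsub>?S\<^esub>}" by (rule T.S.genideal_minimal[OF T.S.zeroideal]) simp
    have "ideal (Idl\<^bsub>?S\<^esub> {}) ?S" by (rule T.S.genideal_ideal) simp
    then show "{\<zero>\<^bsub>?S\<^esub>} \<subseteq> Idl\<^bsub>?S\<^esub> {}"
      using additive_subgroup.zero_closed[OF ideal.axioms(1)] by blast
  qed
  have noeth: "noetherian_ring ?S"
  proof (rule T.S.noetherian_ringI)
    fix I assume "ideal I ?S"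
    then consider "I = {\<zero>\<^bsub>?S\<^esub>}" | "I = carrier ?S" using K.all_ideals by blast
    then show "\<exists>A\<subseteq>carrier ?S. finite A \<and> I = Idl\<^bsub>?S\<^esub> A"
    proof cases
      case 1
      then show ?thesis using Idl_empty by (intro exI[of _ "{}"]) auto
    next
      case 2
      then show ?thesis using T.S.genideal_one by (intro exI[of _ "{\<one>\<^bsub>?S\<^esub>}"]) auto
    qed
  qed
  have "local_ring ?S"
    unfolding local_ring_def using T.S.cring_axioms max T.maximalideal_eq maxi by metis
  moreover have "krull_dim ?S = enat 0"
  proof -
    have "P = {\<zero>\<^bsub>?S\<^esub>}" if "primeideal P ?S" for P
      using K.all_ideals primeideal.axioms(1)[OF that] primeideal.I_notcarr[OF that] by blast
    then have "{P. primeideal P ?S} \<subseteq> {{\<zero>\<^bsub>?S\<^esub>}}" by auto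
    then show ?thesis unfolding krull_dim_def using chain_height_singleton by (simp add: enat_0)
  qed
  ultimately show ?thesis
    unfolding regular_local_ring_def using noeth max Idl_empty
    by (intro conjI exI[of _ "{}"]) auto
qed

section \<open>Generic regularity of the quotients of \<open>B\<close> by primes\<close>

lemma (in ring) generate_ring_hom_image:
  assumes "ring_hom_ring R S h" "K \<subseteq> carrier R"
  shows "h ` generate_ring R K \<subseteq> generate_ring S (h ` K)"
proof -
  interpret h: ring_hom_ring R S h by fact
  have "h x \<in> generate_ring S (h ` K)" if "x \<in> generate_ring R K" for x
    using that
  proof induction
    case (a_inv x)
    then show ?case using generate_ring_in_carrier[OF assms(2)] generate_ring.a_inv by fastforce
  next
    case (eng_add x y)
    then show ?case using generate_ring_in_carrier[OF assms(2)] generate_ring.eng_add by fastforce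
  next
    case (eng_mult x y)
    then show ?case using generate_ring_in_carrier[OF assms(2)] generate_ring.eng_mult by fastforce
  qed (auto intro: generate_ring.one generate_ring.incl)
  then show ?thesis by blast
qed

text \<open>The quotient by \<open>p\<close> is realised on a set of coset representatives, so that its elements have
  the type required by \<^const>\<open>J_2\<close>.\<close>

lemma (in primeideal) quotient_on_representatives:
  obtains c :: "'a \<Rightarrow> 'a" where "domain (image_ring c R)" "ring_hom_ring R (image_ring c R) c"
    "\<And>a. a \<in> carrier R \<Longrightarrow> c a = \<zero>\<^bsub>image_ring c R\<^esub> \<longleftrightarrow> a \<in> I" "carrier (image_ring c R) = c ` carrier R"
proof -
  \<comment> \<open>The choice depends on the coset alone, so \<open>c\<close> is constant on
    cosets; it separates them because it picks a member.\<close>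
  define c where "c a = (SOME x. x \<in> I +> a)" for a
  have c: "c a \<in> I +> a" if "a \<in> carrier R" for a
    unfolding c_def using a_rcos_self[OF that] by (rule someI)
  have "weak_ring_morphism c I R"
  proof (rule weak_ring_morphismI[OF is_ideal])
    fix a b assume ab: "a \<in> carrier R" "b \<in> carrier R"
    have iff: "a \<ominus> b \<in> I \<longleftrightarrow> I +> a = I +> b"
      by (rule quotient_eq_iff_same_a_r_cos[OF is_ideal ab])
    show "c a = c b \<longleftrightarrow> a \<ominus> b \<in> I"
    proof
      assume "c a = c b"
      then have "c a \<in> I +> a" "c a \<in> I +> b" using c ab by metis+
      then show "a \<ominus> b \<in> I"
        unfolding iff using a_repr_independence'[of "c a" a] a_repr_independence'[of "c a" b] ab by simp
    qed (simp add: iff c_def)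
  qed
  note w = this
  have 1: "domain (image_ring c R)"
    using domain.ring_iso_imp_img_domain[OF quotient_is_domain weak_ring_morphism_is_iso[OF w]]
    unfolding image_ring_zero'[OF w] by simp
  have 2: "ring_hom_ring R (image_ring c R) c" by (rule weak_ring_morphism_ring_hom[OF w])
  have 3: "c a = \<zero>\<^bsub>image_ring c R\<^esub> \<longleftrightarrow> a \<in> I" if "a \<in> carrier R" for a
    using weak_ring_morphism_ker[OF w] that unfolding a_kernel_def' by auto
  show thesis using that[OF 1 2 3] image_ring_carrier[of c R] by blast
qed

text \<open>\<open>J_2\<close> is applied to \<open>D = B/p\<close>. The regular locus consists of
  the primes not containing some ideal \<open>E\<close>, and the zero ideal belongs to it, so
  \<open>E\<close> has a nonzero element; any preimage \<open>g\<close> of it works. Parameters and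
  chains found in \<open>D\<close> are lifted to \<open>B\<close>.\<close>

lemma generic_parameters:
  fixes A :: "'a ring" and B :: "'a ft_algebra" (structure)
  assumes "J_2 A" "finite_type A f B" "primeideal p B"
  shows "\<exists>g\<in>carrier B - p. \<forall>P. primeideal P B \<longrightarrow> p \<subseteq> P \<longrightarrow> g \<notin> P \<longrightarrow>
        (\<exists>F xs. finite F \<and> F \<subseteq> P \<and> length xs = Suc (card F) \<and> sorted_wrt (\<subset>) xs \<and>
           set xs \<subseteq> prime_interval B p P \<and> (\<forall>b\<in>P. \<exists>s\<in>carrier B - P. s \<otimes> b \<in> Idl (F \<union> p)))"
proof -
  interpret p: primeideal p B by fact
  obtain c :: "(nat multiset \<Rightarrow> 'a) set \<Rightarrow> (nat multiset \<Rightarrow> 'a) set" where dom: "domain (image_ring c B)" and hom: "ring_hom_ring B (image_ring c B) c"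
    and ker: "\<And>a. a \<in> carrier B \<Longrightarrow> c a = \<zero>\<^bsub>image_ring c B\<^esub> \<longleftrightarrow> a \<in> p"
    and surj: "carrier (image_ring c B) = c ` carrier B"
    by (rule p.quotient_on_representatives) (rule that)
  define D where "D = image_ring c B"
  interpret D: domain D using dom unfolding D_def .
  interpret c: ring_hom_ring B D c using hom unfolding D_def .
  note ker = ker[folded D_def] and surj = surj[folded D_def]
  have "finite_type A (c \<circ> f) D"
  proof -
    obtain U where U: "f \<in> ring_hom A B" "finite U" "U \<subseteq> carrier B" "generate_ring B (f ` carrier A \<union> U) = carrier B"
      using assms(2) unfolding finite_type_def by blast
    have fU: "f ` carrier A \<union> U \<subseteq> carrier B" using U(1,3) ring_hom_closed by fastforce
    have "carrier D \<subseteq> generate_ring D (c ` (f ` carrier A \<union> U))"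
      using p.generate_ring_hom_image[OF c.ring_hom_ring_axioms fU] U(4) surj by simp
    moreover have "generate_ring D (c ` (f ` carrier A \<union> U)) \<subseteq> carrier D"
      by (rule D.generate_ring_incl) (use fU in auto)
    ultimately have "generate_ring D ((c \<circ> f) ` carrier A \<union> c ` U) = carrier D"
      by (simp add: image_Un image_comp)
    moreover have "c \<circ> f \<in> ring_hom A D" by (rule ring_hom_trans[OF U(1) c.homh])
    ultimately show ?thesis
      unfolding finite_type_def using D.is_cring U(2,3)
      by (intro conjI exI[of _ "c ` U"]) auto
  qed
  then have "J_1 D" using assms(1) unfolding J_2_def D_def by blast
  then obtain E where E: "ideal E D"
    "{P. primeideal P D \<and> regular_local_ring (loc_at D P)} = {P. primeideal P D \<and> \<not> E \<subseteq> P}"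
    unfolding J_1_def by blast
  have "\<not> E \<subseteq> {\<zero>\<^bsub>D\<^esub>}"
    using D.zeroprimeideal D.regular_local_ring_generic E(2) by blast
  then obtain e where e: "e \<in> E" "e \<noteq> \<zero>\<^bsub>D\<^esub>" by blast
  then obtain g where g: "g \<in> carrier B" "e = c g" using ideal.Icarr[OF E(1)] surj by blast
  have gp: "g \<notin> p" using ker g e by blast
  have "\<exists>F xs. finite F \<and> F \<subseteq> P \<and> length xs = Suc (card F) \<and> sorted_wrt (\<subset>) xs \<and>
           set xs \<subseteq> prime_interval B p P \<and> (\<forall>b\<in>P. \<exists>s\<in>carrier B - P. s \<otimes> b \<in> Idl (F \<union> p))"
    if P: "primeideal P B" "p \<subseteq> P" "g \<notin> P" for P
  proof -
    interpret P: primeideal P B by fact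
    \<comment> \<open>Membership in \<open>P\<close> can be tested after applying \<open>c\<close>,
      since the kernel \<open>p\<close> is contained in \<open>P\<close>.\<close>
    have img: "c b \<in> c ` P \<longleftrightarrow> b \<in> P" if b: "b \<in> carrier B" for b
    proof
      assume "c b \<in> c ` P"
      then obtain b' where b': "b' \<in> P" "c b = c b'" by blast
      have bc: "b' \<in> carrier B" using P.Icarr[OF b'(1)] .
      have "c (b \<ominus> b') = \<zero>\<^bsub>D\<^esub>" using b bc b'(2) by (simp add: p.minus_eq D.r_neg)
      then have "b \<ominus> b' \<in> P" using ker[of "b \<ominus> b'"] b bc P(2) by auto
      then have "(b \<ominus> b') \<oplus> b' \<in> P" using b'(1) P.a_closed by blast
      then show "b \<in> P" using b bc by (simp add: p.minus_eq p.a_assoc p.l_neg)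
    qed blast
    have surjE: "\<exists>b\<in>carrier B. d = c b" if "d \<in> carrier D" for d using that surj by blast
    have image_ideal: "ideal (c ` J) D" if J: "ideal J B" for J
    proof (rule D.ideal_intro)
      note Jc = ideal.Icarr[OF J]
      show "c ` J \<subseteq> carrier D" using Jc by auto
      show "\<zero>\<^bsub>D\<^esub> \<in> c ` J"
        using additive_subgroup.zero_closed[OF ideal.axioms(1)[OF J]] c.hom_zero by (metis imageI)
      show "x \<oplus>\<^bsub>D\<^esub> y \<in> c ` J" if xy: "x \<in> c ` J" "y \<in> c ` J" for x y
      proof -
        obtain x' y' where x': "x = c x'" "y = c y'" "x' \<in> J" "y' \<in> J" using xy by blast
        then have "x \<oplus>\<^bsub>D\<^esub> y = c (x' \<oplus> y')" using Jc by simp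
        then show ?thesis using additive_subgroup.a_closed[OF ideal.axioms(1)[OF J] x'(3,4)] by blast
      qed
      show "r \<otimes>\<^bsub>D\<^esub> x \<in> c ` J" if rx: "r \<in> carrier D" "x \<in> c ` J" for r x
      proof -
        obtain r' x' where x': "r = c r'" "x = c x'" "r' \<in> carrier B" "x' \<in> J" using rx surjE by blast
        then have "r \<otimes>\<^bsub>D\<^esub> x = c (r' \<otimes> x')" using Jc by simp
        then show ?thesis using ideal.I_l_closed[OF J x'(4,3)] by blast
      qed
    qed
    have Q: "primeideal (c ` P) D"
    proof (rule primeidealI[OF image_ideal[OF P.is_ideal] D.is_cring])
      have "\<one> \<notin> P" using P.one_imp_carrier P.I_notcarr by blast
      then have "c \<one> \<notin> c ` P" using img by blast
      then show "carrier D \<noteq> c ` P" using c.hom_closed[of "\<one>"] by blast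
      show "x \<in> c ` P \<or> y \<in> c ` P" if xy: "x \<in> carrier D" "y \<in> carrier D" "x \<otimes>\<^bsub>D\<^esub> y \<in> c ` P" for x y
      proof -
        obtain x' y' where x': "x = c x'" "y = c y'" "x' \<in> carrier B" "y' \<in> carrier B" using xy surjE by blast
        then have "c (x' \<otimes> y') \<in> c ` P" using xy(3) by simp
        then have "x' \<otimes> y' \<in> P" using img[of "x' \<otimes> y'"] x' by simp
        then show ?thesis using P.I_prime[OF x'(3,4)] x' by blast
      qed
    qed
    have "\<not> E \<subseteq> c ` P" using e g P(3) img by blast
    then have reg: "regular_local_ring (loc_at D (c ` P))" using E(2) Q by blast
    obtain F xs where F: "finite F" "F \<subseteq> c ` P" "length xs = Suc (card F)" "sorted_wrt (\<subset>) xs"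
      "\<And>Q. Q \<in> set xs \<Longrightarrow> primeideal Q D \<and> Q \<subseteq> c ` P"
      "\<And>b. b \<in> c ` P \<Longrightarrow> \<exists>s\<in>carrier D - c ` P. s \<otimes>\<^bsub>D\<^esub> b \<in> Idl\<^bsub>D\<^esub> F"
      using regular_local_ring_parameters[OF D.is_cring Q reg] by blast
    \<comment> \<open>Lifting injectively preserves the number of elements, which the length of the
      chain has to match.\<close>
    obtain F' where F': "F' \<subseteq> P" "inj_on c F'" "F = c ` F'"
      using F(2) by (meson subset_image_inj)
    define G where "G = Idl (F' \<union> p)"
    have sub: "F' \<union> p \<subseteq> carrier B" using F'(1) P.Icarr p.Icarr by blast
    have G: "ideal G B" "F' \<subseteq> G" "p \<subseteq> G"
      unfolding G_def using p.genideal_ideal[OF sub] p.genideal_self[OF sub] by auto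
    define ys where "ys = map (\<lambda>Q. {b \<in> carrier B. c b \<in> Q}) xs"
    have "sorted_wrt (\<lambda>Q Q'. {b \<in> carrier B. c b \<in> Q} \<subset> {b \<in> carrier B. c b \<in> Q'}) xs"
    proof (rule sorted_wrt_mono_rel[OF _ F(4)])
      fix Q Q' assume "Q \<in> set xs" "Q' \<in> set xs" "Q \<subset> Q'"
      moreover from this have "Q' \<subseteq> c ` carrier B" using F(5) P.Icarr by blast
      ultimately show "{b \<in> carrier B. c b \<in> Q} \<subset> {b \<in> carrier B. c b \<in> Q'}" by blast
    qed
    then have "sorted_wrt (\<subset>) ys" unfolding ys_def by (simp add: sorted_wrt_map)
    moreover have "length ys = Suc (card F')"
      unfolding ys_def using F(3) F'(2,3) by (simp add: card_image)
    moreover have "set ys \<subseteq> prime_interval B p P"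
    proof
      fix Y assume "Y \<in> set ys"
      then obtain Q where Q: "Q \<in> set xs" "Y = {b \<in> carrier B. c b \<in> Q}" unfolding ys_def by auto
      have pQ: "primeideal Q D" "Q \<subseteq> c ` P" using F(5)[OF Q(1)] by auto
      have Y: "primeideal Y B" unfolding Q(2) by (rule primeideal_vimage[OF c.ring_hom_ring_axioms p.is_cring pQ(1)])
      have zero: "\<zero>\<^bsub>D\<^esub> \<in> Q"
        using additive_subgroup.zero_closed[OF ideal.axioms(1)[OF primeideal.axioms(1)[OF pQ(1)]]] .
      have "c x \<in> Q" if "x \<in> p" for x using ker[OF p.Icarr[OF that]] that zero by simp
      then have "p \<subseteq> Y" unfolding Q(2) using p.Icarr by blast
      moreover have "Y \<subseteq> P" unfolding Q(2) using img pQ(2) by blast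
      ultimately show "Y \<in> prime_interval B p P" using Y unfolding prime_interval_def by simp
    qed
    moreover have "\<exists>s\<in>carrier B - P. s \<otimes> b \<in> G" if b: "b \<in> P" for b
    proof -
      have bc: "b \<in> carrier B" using P.Icarr[OF b] .
      obtain s where s: "s \<in> carrier D" "s \<notin> c ` P" "s \<otimes>\<^bsub>D\<^esub> c b \<in> Idl\<^bsub>D\<^esub> F" using F(6) b by blast
      obtain s' where s': "s' \<in> carrier B" "s = c s'" using surjE[OF s(1)] by blast
      have "F \<subseteq> c ` G" using F'(3) G(2) by blast
      then have "Idl\<^bsub>D\<^esub> F \<subseteq> c ` G" by (rule D.genideal_minimal[OF image_ideal[OF G(1)]])
      then obtain z where z: "z \<in> G" "s \<otimes>\<^bsub>D\<^esub> c b = c z" using s(3) by blast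
      have zc: "z \<in> carrier B" using ideal.Icarr[OF G(1) z(1)] .
      \<comment> \<open>Equality in \<open>D\<close> means equality modulo \<open>p\<close>, and
        \<open>p\<close> is contained in \<open>G\<close>.\<close>
      have "c (s' \<otimes> b \<ominus> z) = \<zero>\<^bsub>D\<^esub>"
        using z(2) s' bc zc by (simp add: p.minus_eq D.r_neg)
      then have "s' \<otimes> b \<ominus> z \<in> G"
        using ker[of "s' \<otimes> b \<ominus> z"] s' bc zc G(3) by auto
      then have "(s' \<otimes> b \<ominus> z) \<oplus> z \<in> G"
        using additive_subgroup.a_closed[OF ideal.axioms(1)[OF G(1)]] z(1) by blast
      then have "s' \<otimes> b \<in> G" using s' bc zc by (simp add: p.minus_eq p.a_assoc p.l_neg)
      moreover have "s' \<notin> P" using s(2) s' by blast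
      ultimately show ?thesis using s'(1) by blast
    qed
    moreover have "finite F'" using F(1) F'(2,3) finite_imageD by blast
    ultimately show ?thesis using F'(1) unfolding G_def by blast
  qed
  then show ?thesis using g(1) gp by blast
qed


section \<open>Frobenius powers\<close>

lemma (in cring) binomial:
  assumes a: "a \<in> carrier R" and b: "b \<in> carrier R"
  shows "(a \<oplus> b) [^] (n::nat) = (\<Oplus>i\<in>{..n}. [(n choose i)] \<cdot> (a [^] i \<otimes> b [^] (n - i)))"
proof (induction n)
  case 0
  then show ?case by simp
next
  case (Suc n)
  note [simp] = a b
  let ?s = "\<lambda>i. a [^] Suc i \<otimes> b [^] (n - i)"
  have l: "(\<Oplus>i\<in>{..n}. [(n choose i)] \<cdot> (a [^] i \<otimes> b [^] (n - i))) \<otimes> a = (\<Oplus>i\<in>{..n}. [(n choose i)] \<cdot> ?s i)"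
    by (subst finsum_ldistr) (auto simp: add_pow_rdistr m_ac intro!: finsum_cong')
  have "(\<Oplus>i\<in>{..n}. [(n choose i)] \<cdot> (a [^] i \<otimes> b [^] (n - i))) \<otimes> b =
      (\<Oplus>i\<in>{..n}. [(n choose i)] \<cdot> (a [^] i \<otimes> b [^] (Suc n - i)))"
    by (subst finsum_ldistr) (auto simp: add_pow_ldistr m_assoc Suc_diff_le intro!: finsum_cong')
  \<comment> \<open>The added summand has coefficient \<open>n choose Suc n\<close>, which is
    0.\<close>
  also have "\<dots> = (\<Oplus>i\<in>{..Suc n}. [(n choose i)] \<cdot> (a [^] i \<otimes> b [^] (Suc n - i)))"
    by (simp add: Pi_def binomial_eq_0)
  also have "\<dots> = (\<Oplus>i\<in>{..n}. [(n choose Suc i)] \<cdot> (a [^] Suc i \<otimes> b [^] (Suc n - Suc i))) \<oplus>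
      [(n choose 0)] \<cdot> (a [^] (0::nat) \<otimes> b [^] (Suc n - 0))"
    by (rule finsum_Suc2) auto
  finally have r: "(\<Oplus>i\<in>{..n}. [(n choose i)] \<cdot> (a [^] i \<otimes> b [^] (n - i))) \<otimes> b =
      (\<Oplus>i\<in>{..n}. [(n choose Suc i)] \<cdot> ?s i) \<oplus> b [^] Suc n"
    by simp
  have "(\<Oplus>i\<in>{..Suc n}. [(Suc n choose i)] \<cdot> (a [^] i \<otimes> b [^] (Suc n - i))) =
      (\<Oplus>i\<in>{..n}. [(Suc n choose Suc i)] \<cdot> (a [^] Suc i \<otimes> b [^] (Suc n - Suc i))) \<oplus>
      [(Suc n choose 0)] \<cdot> (a [^] (0::nat) \<otimes> b [^] (Suc n - 0))"
    by (rule finsum_Suc2) auto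
  also have "\<dots> = (\<Oplus>i\<in>{..n}. [((n choose i) + (n choose Suc i))] \<cdot> ?s i) \<oplus> b [^] Suc n"
    by simp
  also have "(\<Oplus>i\<in>{..n}. [((n choose i) + (n choose Suc i))] \<cdot> ?s i) =
      (\<Oplus>i\<in>{..n}. [(n choose i)] \<cdot> ?s i) \<oplus> (\<Oplus>i\<in>{..n}. [(n choose Suc i)] \<cdot> ?s i)"
  proof -
    have "[((n choose i) + (n choose Suc i))] \<cdot> ?s i = [(n choose i)] \<cdot> ?s i \<oplus> [(n choose Suc i)] \<cdot> ?s i" for i
      by (rule add.nat_pow_mult[symmetric]) simp
    then show ?thesis by (simp add: finsum_addf Pi_def)
  qed
  finally have "(\<Oplus>i\<in>{..Suc n}. [(Suc n choose i)] \<cdot> (a [^] i \<otimes> b [^] (Suc n - i))) =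
      (\<Oplus>i\<in>{..n}. [(n choose i)] \<cdot> ?s i) \<oplus> (\<Oplus>i\<in>{..n}. [(n choose Suc i)] \<cdot> ?s i) \<oplus> b [^] Suc n" .
  moreover have "(a \<oplus> b) [^] Suc n = (\<Oplus>i\<in>{..n}. [(n choose i)] \<cdot> ?s i) \<oplus>
      ((\<Oplus>i\<in>{..n}. [(n choose Suc i)] \<cdot> ?s i) \<oplus> b [^] Suc n)"
    unfolding l[symmetric] r[symmetric] Suc.IH[symmetric] by (simp add: r_distr)
  moreover have "(\<Oplus>i\<in>{..n}. [(n choose i)] \<cdot> ?s i) \<in> carrier R" "(\<Oplus>i\<in>{..n}. [(n choose Suc i)] \<cdot> ?s i) \<in> carrier R"
    "b [^] Suc n \<in> carrier R"
    by (auto intro!: finsum_closed)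
  ultimately show ?case by (simp only: a_assoc)
qed

lemma (in cring) add_pow_char_zero:
  fixes p k :: nat
  assumes "[p] \<cdot> \<one> = \<zero>" "p dvd k" "x \<in> carrier R"
  shows "[k] \<cdot> x = \<zero>"
proof -
  obtain j where j: "k = p * j" using assms(2) by blast
  have "[p] \<cdot> x = ([p] \<cdot> \<one>) \<otimes> x" using assms(3) add_pow_ldistr[of \<one> x p] by simp
  then have "[p] \<cdot> x = \<zero>" using assms by simp
  then show ?thesis unfolding j using add.nat_pow_pow[OF assms(3), of j p] by simp
qed

text \<open>For the exponent \<open>p\<close> itself, the inner binomial coefficients are divisible
  by \<open>p\<close> and only the two extreme summands remain; powers of \<open>p\<close> follow by
  iteration.\<close>

lemma (in cring) frobenius_add:
  fixes p :: nat
  assumes p: "Factorial_Ring.prime p" "[p] \<cdot> \<one> = \<zero>" and a: "a \<in> carrier R" and b: "b \<in> carrier R"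
  shows "(a \<oplus> b) [^] (p ^ e) = a [^] (p ^ e) \<oplus> b [^] (p ^ e)"
proof (induction e)
  case 0
  then show ?case using a b by simp
next
  case (Suc e)
  have *: "(x \<oplus> y) [^] p = x [^] p \<oplus> y [^] p" if "x \<in> carrier R" "y \<in> carrier R" for x y
  proof -
    note [simp] = that
    have "p \<ge> 2" using p(1) prime_ge_2_nat by blast
    moreover define m where "m = p - 2"
    ultimately have m: "p = Suc (Suc m)" by simp
    let ?f = "\<lambda>i. [(p choose i)] \<cdot> (x [^] i \<otimes> y [^] (p - i))"
    have zero: "?f (Suc i) = \<zero>" if "i \<le> m" for i
    proof (rule add_pow_char_zero[OF p(2)])
      show "p dvd (p choose Suc i)" by (rule dvd_choose_prime[OF _ _ _ p(1)]) (use \<open>i \<le> m\<close> m in linarith)+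
    qed auto
    have "(x \<oplus> y) [^] p = (\<Oplus>i\<in>{..Suc (Suc m)}. ?f i)"
      using binomial[OF that, of p] m by simp
    also have "\<dots> = ?f p \<oplus> (\<Oplus>i\<in>{..Suc m}. ?f i)"
      unfolding m by (rule finsum_Suc) auto
    also have "(\<Oplus>i\<in>{..Suc m}. ?f i) = (\<Oplus>i\<in>{..m}. ?f (Suc i)) \<oplus> ?f 0"
      by (rule finsum_Suc2) auto
    also have "(\<Oplus>i\<in>{..m}. ?f (Suc i)) = (\<Oplus>i\<in>{..m}. \<zero>)"
      by (rule finsum_cong') (use zero in auto)
    finally show ?thesis by simp
  qed
  have "(a \<oplus> b) [^] (p ^ Suc e) = ((a \<oplus> b) [^] (p ^ e)) [^] p"
    using a b by (simp add: nat_pow_pow mult.commute)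
  also have "\<dots> = (a [^] (p ^ e)) [^] p \<oplus> (b [^] (p ^ e)) [^] p"
    unfolding Suc.IH using a b * by simp
  finally show ?case using a b by (simp add: nat_pow_pow mult.commute)
qed

section \<open>Transporters, spans and products of ideals with modules\<close>

lemma (in module) transporter_ideal:
  assumes H: "submodule H R M"
  shows "ideal {c \<in> carrier R. \<forall>y\<in>carrier M. c *\<^sub>M y \<in> H} R"
  using submodule_zero[OF H] submodule_add[OF H] submodule_smult[OF H]
  by (intro R.ideal_intro) (auto simp: smult_l_distr smult_assoc1)

lemma (in module) annihilator_ideal: "ideal (annihilator R M) R"
proof -
  have "submodule {0\<^sub>M} R M" by (rule submodule_intro) auto
  from transporter_ideal[OF this] show ?thesis unfolding annihilator_def by simp
qed

lemma (in module) submodule_preimage: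
  assumes H: "submodule H R M" and c: "c \<in> carrier R"
  shows "submodule {y \<in> carrier M. c *\<^sub>M y \<in> H} R M" (is "submodule ?X R M")
proof (rule submodule_intro)
  show "r *\<^sub>M y \<in> ?X" if "r \<in> carrier R" "y \<in> ?X" for r y
  proof -
    have "c *\<^sub>M (r *\<^sub>M y) = r *\<^sub>M (c *\<^sub>M y)"
      using that c by (simp add: R.m_comm flip: smult_assoc1)
    then show ?thesis using that submodule_smult[OF H] by simp
  qed
qed (use c submodule_zero[OF H] submodule_add[OF H] in \<open>auto simp: smult_r_distr\<close>)

context module
begin

lemma submodule_span_least:
  "submodule H R M \<Longrightarrow> U \<subseteq> H \<Longrightarrow> submodule_span R M U \<subseteq> H"
  unfolding submodule_span_def by blast

lemma submodule_span_submodule: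
  assumes "U \<subseteq> carrier M"
  shows "submodule (submodule_span R M U) R M" "U \<subseteq> submodule_span R M U"
proof -
  let ?F = "{H. submodule H R M \<and> U \<subseteq> H}"
  have car: "carrier M \<in> ?F" using carrier_is_submodule assms by blast
  show "submodule (submodule_span R M U) R M"
  proof (rule submodule_intro)
    show "submodule_span R M U \<subseteq> carrier M" using car unfolding submodule_span_def by blast
    show "0\<^sub>M \<in> submodule_span R M U"
      unfolding submodule_span_def using submodule_zero by auto
    show "a +\<^sub>M b \<in> submodule_span R M U" if "a \<in> submodule_span R M U" "b \<in> submodule_span R M U" for a b
      using that unfolding submodule_span_def using submodule_add by auto
    show "r *\<^sub>M a \<in> submodule_span R M U" if "r \<in> carrier R" "a \<in> submodule_span R M U" for r a
      using that unfolding submodule_span_def using submodule_smult by auto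
  qed
  show "U \<subseteq> submodule_span R M U" unfolding submodule_span_def by blast
qed

lemma ideal_smult_facts:
  assumes "I \<subseteq> carrier R"
  shows "submodule (ideal_smult R I M) R M"
    "\<And>a x. a \<in> I \<Longrightarrow> x \<in> carrier M \<Longrightarrow> a *\<^sub>M x \<in> ideal_smult R I M"
    "\<And>H. submodule H R M \<Longrightarrow> (\<And>a x. a \<in> I \<Longrightarrow> x \<in> carrier M \<Longrightarrow> a *\<^sub>M x \<in> H) \<Longrightarrow> ideal_smult R I M \<subseteq> H"
proof -
  let ?U = "{a *\<^sub>M x | a x. a \<in> I \<and> x \<in> carrier M}"
  have sub: "?U \<subseteq> carrier M" using assms by auto
  show "submodule (ideal_smult R I M) R M"
    unfolding ideal_smult_def by (rule submodule_span_submodule[OF sub])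
  show "a *\<^sub>M x \<in> ideal_smult R I M" if "a \<in> I" "x \<in> carrier M" for a x
    unfolding ideal_smult_def using submodule_span_submodule(2)[OF sub] that by blast
  show "ideal_smult R I M \<subseteq> H" if "submodule H R M" "\<And>a x. a \<in> I \<Longrightarrow> x \<in> carrier M \<Longrightarrow> a *\<^sub>M x \<in> H" for H
    unfolding ideal_smult_def using that by (intro submodule_span_least) auto
qed

end

lemma (in cring) frobenius_power_facts:
  fixes q :: nat
  assumes "I \<subseteq> carrier R"
  shows "ideal (frobenius_power R q I) R"
    "\<And>x. x \<in> I \<Longrightarrow> x [^] q \<in> frobenius_power R q I"
    "\<And>J. ideal J R \<Longrightarrow> (\<And>x. x \<in> I \<Longrightarrow> x [^] q \<in> J) \<Longrightarrow> frobenius_power R q I \<subseteq> J"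
proof -
  have sub: "(\<lambda>x. x [^] q) ` I \<subseteq> carrier R" using assms by auto
  show "ideal (frobenius_power R q I) R" "\<And>x. x \<in> I \<Longrightarrow> x [^] q \<in> frobenius_power R q I"
    unfolding frobenius_power_def using genideal_ideal[OF sub] genideal_self[OF sub] by auto
  show "frobenius_power R q I \<subseteq> J" if "ideal J R" "\<And>x. x \<in> I \<Longrightarrow> x [^] q \<in> J" for J
    unfolding frobenius_power_def using that by (intro genideal_minimal) auto
qed

text \<open>A step from \<open>L\<close> to \<open>L + Sx\<close> passes to Frobenius powers because
  \<open>(l + c x)^q = l^q + c^q x^q\<close>, which is where \<open>q\<close> has to be a power of
  \<open>p\<close>. The new quotient is generated by the elements \<open>x^q v\<close> with
  \<open>v\<close> in \<open>V\<close>, and each of these costs at most \<open>t\<close> because the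
  bound ideal kills it.\<close>

lemma (in prime_localization) filtration_frobenius:
  fixes p q :: nat
  assumes N: "module S N"
    and p: "Factorial_Ring.prime p" "[p] \<cdot>\<^bsub>S\<^esub> \<one>\<^bsub>S\<^esub> = \<zero>\<^bsub>S\<^esub>" and q: "q = p ^ e"
    and V: "finite V" "V \<subseteq> carrier N" "\<And>H. submodule H S N \<Longrightarrow> V \<subseteq> H \<Longrightarrow> carrier N \<subseteq> H"
    and a: "ideal a B" "\<And>b x. b \<in> a \<Longrightarrow> x \<in> carrier N \<Longrightarrow> \<theta> b \<odot>\<^bsub>N\<^esub> x = \<zero>\<^bsub>N\<^esub>"
    and len: "len (bound_ideal a q) (carrier S) t"
    and filt: "len I J n"
  shows "filtration S N maxi (ideal_smult S (frobenius_power S q I) N) (ideal_smult S (frobenius_power S q J) N)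
      (n * (card V * t))"
proof -
  interpret N: module S N by fact
  interpret SS: module S "self_module S" by (rule S.module_self_module)
  let ?F = "\<lambda>I. ideal_smult S (frobenius_power S q I) N"
  \<comment> \<open>\<open>?F L\<close> is treated as the submodule generated by the elements
    \<open>x^q y\<close>. This is legitimate since the multipliers sending \<open>N\<close> into a
    given \<open>H\<close> form an ideal.\<close>
  have F: "submodule (?F L) S N" "\<And>x y. x \<in> L \<Longrightarrow> y \<in> carrier N \<Longrightarrow> (x [^]\<^bsub>S\<^esub> q) \<odot>\<^bsub>N\<^esub> y \<in> ?F L"
    "\<And>H. submodule H S N \<Longrightarrow> (\<And>x y. x \<in> L \<Longrightarrow> y \<in> carrier N \<Longrightarrow> (x [^]\<^bsub>S\<^esub> q) \<odot>\<^bsub>N\<^esub> y \<in> H) \<Longrightarrow> ?F L \<subseteq> H"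
    if L: "L \<subseteq> carrier S" for L
  proof -
    note f = S.frobenius_power_facts[OF L, where q = q]
    have sub: "frobenius_power S q L \<subseteq> carrier S" using ideal.Icarr[OF f(1)] by blast
    note s = N.ideal_smult_facts[OF sub]
    show "submodule (?F L) S N" by (rule s(1))
    show "(x [^]\<^bsub>S\<^esub> q) \<odot>\<^bsub>N\<^esub> y \<in> ?F L" if "x \<in> L" "y \<in> carrier N" for x y
      by (rule s(2)[OF f(2)]) (use that in auto)
    show "?F L \<subseteq> H" if H: "submodule H S N" "\<And>x y. x \<in> L \<Longrightarrow> y \<in> carrier N \<Longrightarrow> (x [^]\<^bsub>S\<^esub> q) \<odot>\<^bsub>N\<^esub> y \<in> H" for H
    proof (rule s(3)[OF H(1)])
      have "frobenius_power S q L \<subseteq> {c \<in> carrier S. \<forall>y\<in>carrier N. c \<odot>\<^bsub>N\<^esub> y \<in> H}"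
        by (rule f(3)[OF N.transporter_ideal[OF H(1)]]) (use H(2) L in auto)
      then show "c \<odot>\<^bsub>N\<^esub> x \<in> H" if "c \<in> frobenius_power S q L" "x \<in> carrier N" for c x
        using that by blast
    qed
  qed
  from filt show ?thesis
  proof induction
    case (base K)
    then have "K \<subseteq> carrier S" using SS.submodule_carrier by fastforce
    from F(1)[OF this] show ?case using filtration.base by fastforce
  next
    case (step K L n x)
    have L: "submodule L S (self_module S)" using SS.filtration_submodule[OF step.hyps(1)] by blast
    have Lc: "L \<subseteq> carrier S" using SS.submodule_carrier[OF L] by auto
    have x: "x \<in> carrier S" using step.hyps(2) by simp
    let ?L = "adjoin S (self_module S) L x"
    have LL: "submodule ?L S (self_module S)" by (rule SS.adjoin_submodule[OF L step.hyps(2)])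
    have LLc: "?L \<subseteq> carrier S" using SS.submodule_carrier[OF LL] by auto
    have xL: "x \<in> ?L" and sub: "L \<subseteq> ?L"
      using SS.mem_adjoin[OF L step.hyps(2)] SS.subset_adjoin[OF L step.hyps(2)] by auto
    define xq where "xq = x [^]\<^bsub>S\<^esub> q"
    have xq: "xq \<in> carrier S" unfolding xq_def using x by simp
    define U where "U = (\<lambda>v. xq \<odot>\<^bsub>N\<^esub> v) ` V"
    have U: "finite U" "U \<subseteq> carrier N" "card U \<le> card V"
      unfolding U_def using V(1,2) xq card_image_le by auto
    note T = N.transporter_ideal[OF F(1)[OF Lc]]
    note C = S.ideal_colon[OF T xq]
    \<comment> \<open>The ideal of all \<open>c\<close> with \<open>c x^q N\<close> contained in
      \<open>?F L\<close>. For \<open>b\<close> in \<open>P\<close> the filtration condition puts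
      \<open>\<theta> b x\<close> into \<open>L\<close>, so its \<open>q\<close>-th power sends
      \<open>N\<close> into \<open>?F L\<close>.\<close>
    let ?Z = "{c \<in> carrier S. c \<otimes>\<^bsub>S\<^esub> xq \<in> {c \<in> carrier S. \<forall>y\<in>carrier N. c \<odot>\<^bsub>N\<^esub> y \<in> ?F L}}"
    have "bound_ideal a q \<subseteq> ?Z"
    proof (rule bound_ideal_minimal[OF a(1) C])
      fix b assume b: "b \<in> a"
      have bc: "b \<in> carrier B" using ideal.Icarr[OF a(1) b] .
      have "(\<theta> b \<otimes>\<^bsub>S\<^esub> xq) \<odot>\<^bsub>N\<^esub> y \<in> ?F L" if y: "y \<in> carrier N" for y
        using a(2)[OF b, of "xq \<odot>\<^bsub>N\<^esub> y"] N.submodule_zero[OF F(1)[OF Lc]] xq y bc by (simp add: N.smult_assoc1)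
      then show "\<theta> b \<in> ?Z"
        using bc xq by simp
    next
      fix b assume b: "b \<in> P"
      have bc: "\<theta> b \<in> carrier S" using P.Icarr[OF b] by simp
      have "\<theta> b \<in> maxi" using S.genideal_self[OF image_P] b by blast
      then have "\<theta> b \<otimes>\<^bsub>S\<^esub> x \<in> L" using step.hyps(3)[OF bc] by simp
      moreover have "\<theta> b [^]\<^bsub>S\<^esub> q \<otimes>\<^bsub>S\<^esub> xq = (\<theta> b \<otimes>\<^bsub>S\<^esub> x) [^]\<^bsub>S\<^esub> q"
        unfolding xq_def using bc x by (simp add: S.nat_pow_distrib)
      ultimately show "\<theta> b [^]\<^bsub>S\<^esub> q \<in> ?Z"
        using F(2)[OF Lc] bc x by simp
    qed
    then have kill: "c \<odot>\<^bsub>N\<^esub> u \<in> ?F L" if c: "c \<in> bound_ideal a q" and "u \<in> U" for c u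
    proof -
      obtain v where v: "v \<in> V" "u = xq \<odot>\<^bsub>N\<^esub> v" using \<open>u \<in> U\<close> unfolding U_def by blast
      have vc: "v \<in> carrier N" using v V by blast
      have "(c \<otimes>\<^bsub>S\<^esub> xq) \<odot>\<^bsub>N\<^esub> v \<in> ?F L" "c \<in> carrier S"
        using \<open>bound_ideal a q \<subseteq> _\<close> c vc by auto
      then show ?thesis using v vc xq by (simp add: N.smult_assoc1)
    qed
    obtain H where H: "filtration S N maxi (?F L) H (card U * t)" "U \<subseteq> H"
      "\<And>H'. submodule H' S N \<Longrightarrow> ?F L \<subseteq> H' \<Longrightarrow> U \<subseteq> H' \<Longrightarrow> H \<subseteq> H'"
      using N.filtration_finite[OF len F(1)[OF Lc] U(1,2) kill] by blast
    have Hs: "submodule H S N" and KH: "?F L \<subseteq> H" using N.filtration_submodule[OF H(1)] by auto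
    have "H = ?F ?L"
    proof
      show "H \<subseteq> ?F ?L"
      proof (rule H(3)[OF F(1)[OF LLc]])
        show "?F L \<subseteq> ?F ?L" by (rule F(3)[OF Lc F(1)[OF LLc]], rule F(2)[OF LLc]) (use sub in auto)
        show "U \<subseteq> ?F ?L" unfolding U_def xq_def using F(2)[OF LLc xL] V(2) by auto
      qed
      \<comment> \<open>The elements that \<open>x^q\<close> sends into \<open>H\<close> form a
        submodule, so it is enough to test the generators \<open>V\<close>.\<close>
      have "V \<subseteq> {y \<in> carrier N. xq \<odot>\<^bsub>N\<^esub> y \<in> H}" using H(2) V(2) unfolding U_def by auto
      then have xqH: "xq \<odot>\<^bsub>N\<^esub> y \<in> H" if "y \<in> carrier N" for y
        using V(3)[OF N.submodule_preimage[OF Hs xq]] that by blast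
      show "?F ?L \<subseteq> H"
      proof (rule F(3)[OF LLc Hs])
        fix z y assume "z \<in> ?L" and y: "y \<in> carrier N"
        then obtain l c where l: "l \<in> L" "c \<in> carrier S" "z = l \<oplus>\<^bsub>S\<^esub> c \<otimes>\<^bsub>S\<^esub> x"
          unfolding adjoin_def by auto
        have lc: "l \<in> carrier S" using l Lc by blast
        have "z [^]\<^bsub>S\<^esub> q = l [^]\<^bsub>S\<^esub> q \<oplus>\<^bsub>S\<^esub> (c [^]\<^bsub>S\<^esub> q) \<otimes>\<^bsub>S\<^esub> xq"
          unfolding xq_def l(3) q using S.frobenius_add[OF p lc, of "c \<otimes>\<^bsub>S\<^esub> x"] l x by (simp add: S.nat_pow_distrib)
        then have "(z [^]\<^bsub>S\<^esub> q) \<odot>\<^bsub>N\<^esub> y = (l [^]\<^bsub>S\<^esub> q) \<odot>\<^bsub>N\<^esub> y \<oplus>\<^bsub>N\<^esub> (c [^]\<^bsub>S\<^esub> q) \<odot>\<^bsub>N\<^esub> (xq \<odot>\<^bsub>N\<^esub> y)"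
          using l lc xq y by (simp add: N.smult_l_distr N.smult_assoc1)
        moreover have "(l [^]\<^bsub>S\<^esub> q) \<odot>\<^bsub>N\<^esub> y \<in> H" using F(2)[OF Lc l(1) y] KH by blast
        moreover have "(c [^]\<^bsub>S\<^esub> q) \<odot>\<^bsub>N\<^esub> (xq \<odot>\<^bsub>N\<^esub> y) \<in> H"
          using N.submodule_smult[OF Hs _ xqH[OF y]] l(2) by simp
        ultimately show "(z [^]\<^bsub>S\<^esub> q) \<odot>\<^bsub>N\<^esub> y \<in> H" using N.submodule_add[OF Hs] by simp
      qed
    qed
    then have "filtration S N maxi (?F L) (?F ?L) (card V * t)"
      using N.filtration_mono[OF H(1)] U(3) by simp
    from N.filtration_trans[OF this step.IH] show ?case by (simp add: add.commute)
  qed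
qed


section \<open>Dimension of a localized module\<close>

lemma FactRing_zero: "\<zero>\<^bsub>R Quot I\<^esub> = I"
  by (simp add: FactRing_def)

text \<open>\<open>E\<close> is the extension of \<open>Q\<close>. The map may have a kernel, and
  \<open>ker\<close> guarantees that \<open>E\<close> still contracts to \<open>Q\<close>: a kernel
  element multiplied by some \<open>w\<close> outside \<open>P\<close> lies in \<open>Q\<close>, and
  as \<open>w\<close> is not in \<open>Q\<close> the element itself does.\<close>

lemma extend_prime:
  fixes B (structure)
  assumes hom: "ring_hom_ring B T \<theta>" and cr: "cring B" "cring T"
    and frac: "\<And>t. t \<in> carrier T \<Longrightarrow> \<exists>b\<in>carrier B. \<exists>w\<in>carrier B - P. t \<otimes>\<^bsub>T\<^esub> \<theta> w = \<theta> b"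
    and P: "primeideal P B" and Q: "primeideal Q B" "Q \<subseteq> P"
    and ker: "\<And>b. b \<in> carrier B \<Longrightarrow> \<theta> b = \<zero>\<^bsub>T\<^esub> \<Longrightarrow> \<exists>w\<in>carrier B - P. w \<otimes> b \<in> Q"
  defines "E \<equiv> {t \<in> carrier T. \<exists>b\<in>Q. \<exists>w\<in>carrier B - P. t \<otimes>\<^bsub>T\<^esub> \<theta> w = \<theta> b}"
  shows "primeideal E T" "\<And>b. b \<in> carrier B \<Longrightarrow> \<theta> b \<in> E \<longleftrightarrow> b \<in> Q"
proof -
  interpret B: cring B by fact
  interpret T: cring T by fact
  interpret \<theta>: ring_hom_ring B T \<theta> by fact
  interpret P: primeideal P B by fact
  interpret Q: primeideal Q B by fact
  have PW: "w \<otimes> w' \<in> carrier B - P" if "w \<in> carrier B - P" "w' \<in> carrier B - P" for w w'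
    using that P.I_prime[of w w'] by auto
  have iff: "\<theta> b \<in> E \<longleftrightarrow> b \<in> Q" if b: "b \<in> carrier B" for b
  proof
    assume "b \<in> Q"
    moreover have "\<theta> b \<otimes>\<^bsub>T\<^esub> \<theta> \<one> = \<theta> b" using b by simp
    moreover have "\<one> \<in> carrier B - P" using P.one_imp_carrier P.I_notcarr by auto
    ultimately show "\<theta> b \<in> E" unfolding E_def using b \<theta>.hom_closed by blast
  next
    assume "\<theta> b \<in> E"
    then obtain c w where c: "c \<in> Q" "w \<in> carrier B" "w \<notin> P" "\<theta> b \<otimes>\<^bsub>T\<^esub> \<theta> w = \<theta> c"
      unfolding E_def by blast
    have cc: "c \<in> carrier B" using Q.Icarr[OF c(1)] .
    have "\<theta> (b \<otimes> w \<ominus> c) = \<zero>\<^bsub>T\<^esub>"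
      using c b cc by (simp add: B.minus_eq T.r_neg)
    then obtain v where v: "v \<in> carrier B" "v \<notin> P" "v \<otimes> (b \<otimes> w \<ominus> c) \<in> Q"
      using ker[of "b \<otimes> w \<ominus> c"] b c cc by auto
    then have "b \<otimes> w \<ominus> c \<in> Q"
      using Q.I_prime[of v "b \<otimes> w \<ominus> c"] Q(2) b c cc by auto
    then have "(b \<otimes> w \<ominus> c) \<oplus> c \<in> Q" using Q.a_closed c(1) by blast
    then have "b \<otimes> w \<in> Q" using b c cc by (simp add: B.minus_eq B.a_assoc B.l_neg)
    then show "b \<in> Q" using Q.I_prime[OF b c(2)] Q(2) c(3) by blast
  qed
  show "\<theta> b \<in> E \<longleftrightarrow> b \<in> Q" if "b \<in> carrier B" for b using iff that .
  have "ideal E T"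
  proof (rule T.ideal_intro)
    show "E \<subseteq> carrier T" unfolding E_def by blast
    show "\<zero>\<^bsub>T\<^esub> \<in> E" using iff[of "\<zero>"] by simp
    show "t \<oplus>\<^bsub>T\<^esub> t' \<in> E" if "t \<in> E" "t' \<in> E" for t t'
    proof -
      obtain b w where b: "t \<in> carrier T" "b \<in> Q" "w \<in> carrier B - P" "t \<otimes>\<^bsub>T\<^esub> \<theta> w = \<theta> b"
        using \<open>t \<in> E\<close> unfolding E_def by blast
      obtain b' w' where b': "t' \<in> carrier T" "b' \<in> Q" "w' \<in> carrier B - P" "t' \<otimes>\<^bsub>T\<^esub> \<theta> w' = \<theta> b'"
        using \<open>t' \<in> E\<close> unfolding E_def by blast
      have c: "w \<in> carrier B" "w' \<in> carrier B" "b \<in> carrier B" "b' \<in> carrier B"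
        using b b' Q.Icarr by auto
      have "(t \<oplus>\<^bsub>T\<^esub> t') \<otimes>\<^bsub>T\<^esub> \<theta> (w \<otimes> w') = (t \<otimes>\<^bsub>T\<^esub> \<theta> w) \<otimes>\<^bsub>T\<^esub> \<theta> w' \<oplus>\<^bsub>T\<^esub> (t' \<otimes>\<^bsub>T\<^esub> \<theta> w') \<otimes>\<^bsub>T\<^esub> \<theta> w"
        using b(1) b'(1) c by (simp add: T.l_distr T.r_distr T.m_ac)
      also have "\<dots> = \<theta> (b \<otimes> w' \<oplus> b' \<otimes> w)" unfolding b(4) b'(4) using c by simp
      finally have "(t \<oplus>\<^bsub>T\<^esub> t') \<otimes>\<^bsub>T\<^esub> \<theta> (w \<otimes> w') = \<theta> (b \<otimes> w' \<oplus> b' \<otimes> w)" .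
      moreover have "b \<otimes> w' \<oplus> b' \<otimes> w \<in> Q"
        using Q.a_closed[OF Q.I_r_closed[OF b(2) c(2)] Q.I_r_closed[OF b'(2) c(1)]] .
      ultimately show ?thesis
        unfolding E_def using PW[OF b(3) b'(3)] T.a_closed[OF b(1) b'(1)] by blast
    qed
    show "r \<otimes>\<^bsub>T\<^esub> t \<in> E" if "r \<in> carrier T" "t \<in> E" for r t
    proof -
      obtain b w where b: "t \<in> carrier T" "b \<in> Q" "w \<in> carrier B - P" "t \<otimes>\<^bsub>T\<^esub> \<theta> w = \<theta> b"
        using \<open>t \<in> E\<close> unfolding E_def by blast
      obtain b' w' where b': "b' \<in> carrier B" "w' \<in> carrier B - P" "r \<otimes>\<^bsub>T\<^esub> \<theta> w' = \<theta> b'"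
        using frac[OF \<open>r \<in> carrier T\<close>] by blast
      have c: "w \<in> carrier B" "w' \<in> carrier B" "b \<in> carrier B"
        using b b' Q.Icarr by auto
      have "(r \<otimes>\<^bsub>T\<^esub> t) \<otimes>\<^bsub>T\<^esub> \<theta> (w' \<otimes> w) = (r \<otimes>\<^bsub>T\<^esub> \<theta> w') \<otimes>\<^bsub>T\<^esub> (t \<otimes>\<^bsub>T\<^esub> \<theta> w)"
        using b(1) \<open>r \<in> carrier T\<close> c by (simp add: T.m_ac)
      also have "\<dots> = \<theta> (b' \<otimes> b)" unfolding b(4) b'(3) using c b'(1) by simp
      finally show ?thesis
        unfolding E_def using PW[OF b'(2) b(3)] T.m_closed[OF \<open>r \<in> carrier T\<close> b(1)] Q.I_l_closed[OF b(2) b'(1)] by blast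
    qed
  qed
  then show "primeideal E T"
  proof (rule primeidealI[OF _ cr(2)])
    have "\<one> \<notin> Q" using Q.one_imp_carrier Q.I_notcarr by blast
    then show "carrier T \<noteq> E" using iff[of "\<one>"] \<theta>.hom_closed[of "\<one>"] by auto
    fix t t' assume t: "t \<in> carrier T" "t' \<in> carrier T" "t \<otimes>\<^bsub>T\<^esub> t' \<in> E"
    obtain b w where b: "b \<in> carrier B" "w \<in> carrier B - P" "t \<otimes>\<^bsub>T\<^esub> \<theta> w = \<theta> b"
      using frac[OF t(1)] by blast
    obtain b' w' where b': "b' \<in> carrier B" "w' \<in> carrier B - P" "t' \<otimes>\<^bsub>T\<^esub> \<theta> w' = \<theta> b'"
      using frac[OF t(2)] by blast
    have c: "w \<in> carrier B" "w' \<in> carrier B" using b b' by auto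
    have "\<theta> (b \<otimes> b') = (t \<otimes>\<^bsub>T\<^esub> \<theta> w) \<otimes>\<^bsub>T\<^esub> (t' \<otimes>\<^bsub>T\<^esub> \<theta> w')"
      unfolding b(3) b'(3) using b b' by simp
    also have "\<dots> = (t \<otimes>\<^bsub>T\<^esub> t') \<otimes>\<^bsub>T\<^esub> \<theta> (w \<otimes> w')"
      using t c by (simp add: T.m_ac)
    finally have "\<theta> (b \<otimes> b') \<in> E"
      using ideal.I_r_closed[OF \<open>ideal E T\<close> t(3)] c by simp
    then have "b \<otimes> b' \<in> Q" using iff[OF B.m_closed[OF b(1) b'(1)]] by blast
    then have "b \<in> Q \<or> b' \<in> Q" using Q.I_prime b(1) b'(1) by blast
    then show "t \<in> E \<or> t' \<in> E" unfolding E_def using t b b' by blast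
  qed
qed

section \<open>Frobenius powers in localizations, and iterated localization\<close>

lemma (in ring_localization) frac_pow:
  assumes "a \<in> carrier R" "s \<in> S"
  shows "s [^] (q::nat) \<in> S" "fr a s [^]\<^bsub>loc_ring R S\<^esub> q = fr (a [^] q) (s [^] q)"
proof -
  have "s [^] q \<in> S \<and> fr a s [^]\<^bsub>loc_ring R S\<^esub> q = fr (a [^] q) (s [^] q)"
  proof (induction q)
    case 0
    interpret Q: cring "loc_ring R S" by (rule cring_loc_ring)
    show ?case by (simp add: loc_ring_simps(4))
  next
    case (Suc q)
    interpret Q: cring "loc_ring R S" by (rule cring_loc_ring)
    show ?case using Suc assms by (simp add: loc_ring_mult)
  qed
  then show "s [^] q \<in> S" "fr a s [^]\<^bsub>loc_ring R S\<^esub> q = fr (a [^] q) (s [^] q)" by auto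
qed

text \<open>Since \<open>(a/s)^q = a^q/s^q\<close>, powers of fractions with numerator in
  \<open>J\<close> have their numerator in the Frobenius power. Thus the ideals of the theorem,
  extended from \<open>R\<close>, are Frobenius powers formed in the local ring.\<close>

lemma (in ring_localization) frobenius_power_extension:
  fixes q :: nat
  assumes J: "ideal J R"
  shows "Idl\<^bsub>loc_ring R S\<^esub> (loc_map R S ` frobenius_power R q J) =
    frobenius_power (loc_ring R S) q (Idl\<^bsub>loc_ring R S\<^esub> (loc_map R S ` J))"
    (is "?I = frobenius_power ?S q ?E")
proof
  interpret Q: cring "?S" by (rule cring_loc_ring)
  interpret H: ring_hom_ring R "?S" "loc_map R S"
    by (rule ring_hom_ringI2[OF ring_axioms Q.ring_axioms loc_map_hom])
  have Jc: "J \<subseteq> carrier R" using ideal.Icarr[OF J] by blast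
  have sub: "loc_map R S ` J \<subseteq> carrier (?S)" using Jc by auto
  have E: "?E \<subseteq> carrier (?S)" using ideal.Icarr[OF Q.genideal_ideal[OF sub]] by blast
  note f = frobenius_power_facts[OF Jc, where q = q] and F = Q.frobenius_power_facts[OF E, where q = q]
  have "frobenius_power R q J \<subseteq> {r \<in> carrier R. loc_map R S r \<in> frobenius_power (?S) q ?E}"
  proof (rule f(3)[OF H.ideal_vimage[OF F(1)]])
    fix x assume x: "x \<in> J"
    then have "loc_map R S x \<in> ?E" using Q.genideal_self[OF sub] by blast
    from F(2)[OF this] show "x [^] q \<in> {r \<in> carrier R. loc_map R S r \<in> frobenius_power (?S) q ?E}"
      using x Jc by (auto simp: H.hom_nat_pow)
  qed
  then show "?I \<subseteq> frobenius_power (?S) q ?E"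
    by (intro Q.genideal_minimal[OF F(1)]) auto
  show "frobenius_power (?S) q ?E \<subseteq> ?I"
  proof (rule F(3))
    show "ideal (?I) (?S)"
      by (rule Q.genideal_ideal) (use ideal.Icarr[OF f(1)] in auto)
    fix x assume "x \<in> ?E"
    then obtain a s where a: "x = fr a s" "a \<in> J" "s \<in> S" unfolding Idl_loc_map[OF J] by blast
    then show "x [^]\<^bsub>?S\<^esub> q \<in> ?I"
      unfolding Idl_loc_map[OF f(1)] using frac_pow[of a s q] f(2)[OF a(2)] Jc by blast
  qed
qed

lemma (in ring_hom_ring) hom_add_pow_one: "h ([(n::nat)] \<cdot>\<^bsub>R\<^esub> \<one>\<^bsub>R\<^esub>) = [n] \<cdot>\<^bsub>S\<^esub> \<one>\<^bsub>S\<^esub>"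
  by (induction n) auto

text \<open>Localizing a localization: the contraction of \<open>P\<close> is disjoint from
  \<open>W\<close>, and a fraction over \<open>R\<close> becomes a fraction over \<open>B\<close>
  once the denominators of its two entries are cleared. \<open>R\<close> is described through
  \<open>\<psi>\<close>, so it only has to be isomorphic to a ring of fractions.\<close>

lemma prime_localization_comp:
  assumes cr: "cring B" "cring R" and hom: "\<psi> \<in> ring_hom B R" and W: "W \<subseteq> carrier B"
    and unit: "\<And>w. w \<in> W \<Longrightarrow> \<psi> w \<in> Units R"
    and frac: "\<And>r. r \<in> carrier R \<Longrightarrow> \<exists>b\<in>carrier B. \<exists>w\<in>W. r \<otimes>\<^bsub>R\<^esub> \<psi> w = \<psi> b"
    and P: "primeideal P R"
  shows "prime_localization B {b \<in> carrier B. \<psi> b \<in> P} (loc_at R P) (loc_map R (carrier R - P) \<circ> \<psi>)"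
proof -
  interpret B: cring B by fact
  interpret P: primeideal P R by fact
  interpret \<psi>: ring_hom_ring B R \<psi> by (rule ring_hom_ringI2[OF B.ring_axioms P.ring_axioms hom])
  interpret T: prime_localization R P "loc_at R P" "loc_map R (carrier R - P)" by (rule P.prime_localization_loc_at)
  let ?P = "{b \<in> carrier B. \<psi> b \<in> P}" and ?S = "loc_at R P" and ?l = "loc_map R (carrier R - P)"
  have P': "primeideal ?P B" by (rule primeideal_vimage[OF \<psi>.ring_hom_ring_axioms cr(1) P])
  have notP: "\<psi> w \<notin> P" "w \<in> carrier B" if "w \<in> W" for w using unit[OF that] P.not_Unit W that by auto
  show ?thesis
  proof (rule prime_localization.intro[OF cr(1) T.S.cring_axioms P'], rule prime_localization_axioms.intro)
    show "?l \<circ> \<psi> \<in> ring_hom B (?S)" by (rule ring_hom_trans[OF hom T.hom])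
    show "(?l \<circ> \<psi>) b \<in> Units (?S)" if "b \<in> carrier B" "b \<notin> ?P" for b
      using T.unit[of "\<psi> b"] that by simp
    show "\<exists>b\<in>carrier B. \<exists>w\<in>carrier B - ?P. t \<otimes>\<^bsub>?S\<^esub> (?l \<circ> \<psi>) w = (?l \<circ> \<psi>) b"
      if t: "t \<in> carrier (?S)" for t
    proof -
      obtain r s where r: "r \<in> carrier R" "s \<in> carrier R" "s \<notin> P" "t \<otimes>\<^bsub>?S\<^esub> ?l s = ?l r"
        using T.fraction[OF t] by blast
      obtain b w where b: "b \<in> carrier B" "w \<in> W" "r \<otimes>\<^bsub>R\<^esub> \<psi> w = \<psi> b" using frac[OF r(1)] by blast
      obtain b' w' where b': "b' \<in> carrier B" "w' \<in> W" "s \<otimes>\<^bsub>R\<^esub> \<psi> w' = \<psi> b'" using frac[OF r(2)] by blast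
      note c = notP(2)[OF b(2)] notP(2)[OF b'(2)]
      \<comment> \<open>If \<open>t = r/s\<close> with \<open>r = b/w\<close> and
        \<open>s = b'/w'\<close>, then \<open>t = (b w')/(b' w)\<close>.\<close>
      have "t \<otimes>\<^bsub>?S\<^esub> ?l (\<psi> (b' \<otimes>\<^bsub>B\<^esub> w)) = t \<otimes>\<^bsub>?S\<^esub> ?l (\<psi> b' \<otimes>\<^bsub>R\<^esub> \<psi> w)"
        using b'(1) c by simp
      also have "\<dots> = (t \<otimes>\<^bsub>?S\<^esub> ?l s) \<otimes>\<^bsub>?S\<^esub> (?l (\<psi> w') \<otimes>\<^bsub>?S\<^esub> ?l (\<psi> w))"
        unfolding b'(3)[symmetric] using r(2) c t by (simp add: T.S.m_assoc)
      also have "\<dots> = ?l (r \<otimes>\<^bsub>R\<^esub> \<psi> w) \<otimes>\<^bsub>?S\<^esub> ?l (\<psi> w')"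
        unfolding r(4) using r(1) c by (simp add: T.S.m_ac)
      also have "\<dots> = ?l (\<psi> (b \<otimes>\<^bsub>B\<^esub> w'))"
        unfolding b(3) using b(1) c by simp
      finally have "t \<otimes>\<^bsub>?S\<^esub> (?l \<circ> \<psi>) (b' \<otimes>\<^bsub>B\<^esub> w) = (?l \<circ> \<psi>) (b \<otimes>\<^bsub>B\<^esub> w')" by simp
      moreover have "\<psi> b' \<notin> P"
        unfolding b'(3)[symmetric] using P.I_prime[OF r(2) \<psi>.hom_closed[OF c(2)]] r(3) notP(1)[OF b'(2)] by blast
      then have "\<psi> (b' \<otimes>\<^bsub>B\<^esub> w) \<notin> P"
        using P.I_prime[of "\<psi> b'" "\<psi> w"] notP(1)[OF b(2)] b'(1) c by auto
      ultimately show ?thesis using b(1) b'(1) c by blast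
    qed
    have "(?l \<circ> \<psi>) ` ?P \<subseteq> T.maxi" using T.S.genideal_self[OF T.image_P] by auto
    then have "Idl\<^bsub>?S\<^esub> ((?l \<circ> \<psi>) ` ?P) \<subseteq> T.maxi" by (rule T.S.genideal_minimal[OF T.maxi_ideal])
    then show "\<one>\<^bsub>?S\<^esub> \<notin> Idl\<^bsub>?S\<^esub> ((?l \<circ> \<psi>) ` ?P)" using T.proper by blast
  qed
qed

section \<open>Finiteness of the dimension and its lower bound by chains in \<open>B\<close>\<close>

context prime_localization
begin

context
  fixes N :: "('s, 'n, 'd) module_scheme"
  assumes N: "module S N"
begin

interpretation N: module S N by (rule N)
interpretation A: ideal "annihilator S N" S by (rule N.annihilator_ideal)
interpretation Q: cring "S Quot annihilator S N" by (rule A.quotient_is_cring[OF S.cring_axioms])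
interpretation C: ring_hom_ring S "S Quot annihilator S N" "(+>\<^bsub>S\<^esub>) (annihilator S N)"
  by (rule A.rcos_ring_hom_ring)

lemma quotient_surj: "x \<in> carrier (S Quot annihilator S N) \<Longrightarrow> \<exists>s\<in>carrier S. x = annihilator S N +>\<^bsub>S\<^esub> s"
  unfolding FactRing_def A_RCOSETS_def' by auto

text \<open>Primes of \<open>S/Ann(N)\<close> contract to primes of \<open>B\<close> inside
  \<open>P\<close>, with strict inclusions kept, and chains of such primes are bounded. Without
  finiteness \<open>the_enat\<close> in the theorem would have an unspecified value.\<close>

lemma module_dim_finite:
  assumes "noetherian_ring B" "catenary B"
  obtains n where "module_dim S N = enat n"
proof -
  let ?A = "annihilator S N" and ?Q = "S Quot annihilator S N"
  obtain n where n: "\<And>xs. sorted_wrt (\<subset>) xs \<Longrightarrow> set xs \<subseteq> prime_interval B {\<zero>} P \<Longrightarrow> length xs \<le> n"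
    using prime_chains_bounded[OF B.cring_axioms assms P.primeideal B.zeroideal] by blast
  let ?g = "\<lambda>Z. {s \<in> carrier S. ?A +>\<^bsub>S\<^esub> s \<in> Z}"
  have "chain_height {Z. primeideal Z ?Q} \<le> chain_height (prime_interval B {\<zero>} P)"
  proof (rule chain_height_map_le[where f = "\<lambda>Z. {b \<in> carrier B. \<theta> b \<in> ?g Z}"])
    fix Z assume "Z \<in> {Z. primeideal Z ?Q}"
    then have Z: "primeideal (?g Z) S"
      using primeideal_vimage[OF C.ring_hom_ring_axioms S.cring_axioms] by blast
    have "\<zero> \<in> {b \<in> carrier B. \<theta> b \<in> ?g Z}"
      using additive_subgroup.zero_closed[OF ideal.axioms(1)[OF primeideal.axioms(1)[OF contract_prime(1)[OF Z]]]] .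
    then show "{b \<in> carrier B. \<theta> b \<in> ?g Z} \<in> prime_interval B {\<zero>} P"
      unfolding prime_interval_def using contract_prime[OF Z] by blast
  next
    fix Z Y assume XY: "Z \<in> {Z. primeideal Z ?Q}" "Y \<in> {Z. primeideal Z ?Q}" "Z \<subset> Y"
    have id: "ideal (?g Z) S" "ideal (?g Y) S"
      using XY C.ideal_vimage[OF primeideal.axioms(1)] by auto
    obtain y where y: "y \<in> Y" "y \<notin> Z" using XY(3) by blast
    have "primeideal Y ?Q" using XY(2) by simp
    from ideal.Icarr[OF primeideal.axioms(1)[OF this] y(1)] have "y \<in> carrier ?Q" .
    then obtain s where "s \<in> carrier S" "y = ?A +>\<^bsub>S\<^esub> s" using quotient_surj by blast
    then have "?g Z \<subset> ?g Y" using y XY(3) by blast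
    from contract_strict[OF id this]
    show "{b \<in> carrier B. \<theta> b \<in> ?g Z} \<subset> {b \<in> carrier B. \<theta> b \<in> ?g Y}" .
  qed
  also have "\<dots> \<le> enat n" by (rule chain_height_leI, rule le_SucI, rule n)
  finally show thesis
    using that unfolding module_dim_def krull_dim_def by (cases "chain_height {Z. primeideal Z ?Q}") auto
qed

text \<open>Primes between \<open>I\<close> and \<open>P\<close> extend to distinct primes of
  \<open>S/Ann(N)\<close>. The assumption \<open>ker\<close> says that the contraction of the
  annihilator lies in \<open>I\<close> up to multipliers outside \<open>P\<close>, so these primes
  survive in the quotient.\<close>

lemma module_dim_ge:
  assumes ker: "\<And>b. b \<in> carrier B \<Longrightarrow> \<theta> b \<in> annihilator S N \<Longrightarrow> \<exists>w\<in>carrier B - P. w \<otimes> b \<in> I"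
    and xs: "length xs = Suc h" "sorted_wrt (\<subset>) xs" "set xs \<subseteq> prime_interval B I P"
  shows "enat h \<le> module_dim S N"
proof -
  let ?A = "annihilator S N" and ?Q = "S Quot annihilator S N"
  let ?t = "\<lambda>b. ?A +>\<^bsub>S\<^esub> \<theta> b"
  have hom: "ring_hom_ring B ?Q ?t"
    using ring_hom_ringI2[OF B.ring_axioms Q.ring_axioms ring_hom_trans[OF hom C.homh]] by (simp add: comp_def)
  have frac: "\<exists>b\<in>carrier B. \<exists>w\<in>carrier B - P. x \<otimes>\<^bsub>?Q\<^esub> ?t w = ?t b" if x: "x \<in> carrier ?Q" for x
  proof -
    obtain s where s: "s \<in> carrier S" "x = ?A +>\<^bsub>S\<^esub> s" using quotient_surj[OF x] by blast
    obtain b w where b: "b \<in> carrier B" "w \<in> carrier B - P" "s \<otimes>\<^bsub>S\<^esub> \<theta> w = \<theta> b"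
      using fraction[OF s(1)] by blast
    have "x \<otimes>\<^bsub>?Q\<^esub> ?t w = ?t b" unfolding s(2) b(3)[symmetric] using s(1) b(2) by simp
    then show ?thesis using b(1,2) by blast
  qed
  define E where "E Z = {x \<in> carrier ?Q. \<exists>b\<in>Z. \<exists>w\<in>carrier B - P. x \<otimes>\<^bsub>?Q\<^esub> ?t w = ?t b}" for Z
  have E: "primeideal (E Z) ?Q" "\<And>b. b \<in> carrier B \<Longrightarrow> ?t b \<in> E Z \<longleftrightarrow> b \<in> Z" if Z: "Z \<in> prime_interval B I P" for Z
  proof -
    have "\<exists>w\<in>carrier B - P. w \<otimes> b \<in> Z" if b: "b \<in> carrier B" "?t b = \<zero>\<^bsub>?Q\<^esub>" for b
    proof -
      have "?A +>\<^bsub>S\<^esub> \<theta> b = ?A" using b(2) FactRing_zero by (rule trans)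
      then have "\<theta> b \<in> ?A" by (rule A.rcos_const_imp_mem[OF H.hom_closed[OF b(1)]])
      then obtain w where "w \<in> carrier B - P" "w \<otimes> b \<in> I" using ker[OF b(1)] by blast
      then show ?thesis using Z unfolding prime_interval_def by blast
    qed
    note ker' = this
    have Z': "primeideal Z B" "Z \<subseteq> P" using Z unfolding prime_interval_def by auto
    note ext = extend_prime[OF hom B.cring_axioms Q.cring_axioms frac P.primeideal Z' ker', folded E_def]
    show "primeideal (E Z) ?Q" by (rule ext(1))
    show "?t b \<in> E Z \<longleftrightarrow> b \<in> Z" if "b \<in> carrier B" for b by (rule ext(2)) (assumption | rule that)+
  qed
  have "enat h \<le> chain_height (prime_interval B I P)" by (rule chain_height_geI[OF xs(2,3,1)])
  also have "\<dots> \<le> chain_height {Z. primeideal Z ?Q}"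
  proof (rule chain_height_map_le[where f = E])
    show "E Z \<in> {Z. primeideal Z ?Q}" if "Z \<in> prime_interval B I P" for Z using E(1)[OF that] by blast
    fix Z Y assume XY: "Z \<in> prime_interval B I P" "Y \<in> prime_interval B I P" "Z \<subset> Y"
    obtain b where b: "b \<in> Y" "b \<notin> Z" using XY(3) by blast
    have "primeideal Y B" using XY(2) unfolding prime_interval_def by simp
    from ideal.Icarr[OF primeideal.axioms(1)[OF this] b(1)] have "b \<in> carrier B" .
    then have "?t b \<in> E Y" "?t b \<notin> E Z" using E(2)[OF XY(1)] E(2)[OF XY(2)] b by auto
    moreover have "E Z \<subseteq> E Y" unfolding E_def using XY(3) by blast
    ultimately show "E Z \<subset> E Y" by blast
  qed
  finally show ?thesis unfolding module_dim_def krull_dim_def .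
qed

end

end

text \<open>For each of the finitely many generators \<open>u\<close> some element of
  \<open>S\<close> kills \<open>r u\<close>, and the product of these elements kills
  \<open>r M\<close>. Finite generation is what makes annihilators compatible with localization
  here.\<close>

lemma (in localization) loc_module_annihilator:
  assumes U: "finite U" "U \<subseteq> carrier M" "submodule_span R M U = carrier M"
    and r: "r \<in> carrier R" "loc_map R S r \<in> annihilator (loc_ring R S) (loc_module R S M)"
  obtains s where "s \<in> S" "s \<otimes> r \<in> annihilator R M"
proof -
  have each: "\<exists>s\<in>S. s *\<^sub>M (r *\<^sub>M u) = 0\<^sub>M" if u: "u \<in> carrier M" for u
  proof -
    have "fr (r *\<^sub>M u) \<one> = \<zero>\<^bsub>loc_module R S M\<^esub>"
      using r(2) loc_map_smult[OF r(1) u] loc_closed[OF u S.one_closed] unfolding annihilator_def by auto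
    then show ?thesis using frac_one_eq_zero_iff r(1) u by simp
  qed
  have "\<exists>s\<in>S. \<forall>u\<in>U. s *\<^sub>M (r *\<^sub>M u) = 0\<^sub>M"
    using U(1,2)
  proof induction
    case empty
    then show ?case using S.one_closed by blast
  next
    case (insert u U)
    obtain s where s: "s \<in> S" "\<forall>u\<in>U. s *\<^sub>M (r *\<^sub>M u) = 0\<^sub>M" using insert by auto
    obtain s' where s': "s' \<in> S" "s' *\<^sub>M (r *\<^sub>M u) = 0\<^sub>M" using each insert by blast
    have "(s \<otimes> s') *\<^sub>M (r *\<^sub>M u) = 0\<^sub>M"
      using s s' r(1) insert.prems by (simp add: smult_assoc1)
    moreover have "(s \<otimes> s') *\<^sub>M (r *\<^sub>M v) = 0\<^sub>M" if v: "v \<in> U" for v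
    proof -
      have vc: "v \<in> carrier M" using v insert.prems by blast
      have "(s \<otimes> s') *\<^sub>M (r *\<^sub>M v) = s' *\<^sub>M (s *\<^sub>M (r *\<^sub>M v))"
        using s(1) s'(1) r(1) vc by (simp add: R.m_comm[of s s'] smult_assoc1)
      then show ?thesis using s(2) v s'(1) by simp
    qed
    ultimately show ?case using s(1) s'(1) by (intro bexI[of _ "s \<otimes> s'"]) auto
  qed
  then obtain s where s: "s \<in> S" "\<And>u. u \<in> U \<Longrightarrow> s *\<^sub>M (r *\<^sub>M u) = 0\<^sub>M" by blast
  have sr: "s \<otimes> r \<in> carrier R" using s(1) r(1) by simp
  have "submodule {0\<^sub>M} R M" by (rule submodule_intro) auto
  note pre = submodule_preimage[OF this sr]
  have "U \<subseteq> {y \<in> carrier M. (s \<otimes> r) *\<^sub>M y \<in> {0\<^sub>M}}"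
  proof
    fix u assume u: "u \<in> U"
    then have "u \<in> carrier M" using U(2) by blast
    then show "u \<in> {y \<in> carrier M. (s \<otimes> r) *\<^sub>M y \<in> {0\<^sub>M}}"
      using s(2)[OF u] s(1) r(1) by (simp add: smult_assoc1)
  qed
  from submodule_span_least[OF pre this] have "s \<otimes> r \<in> annihilator R M"
    unfolding U(3) annihilator_def using sr by auto
  then show thesis using that s(1) by blast
qed

section \<open>Transfer of the bound from the finite type algebra to the localizations of
  \<open>R\<close>\<close>

theorem proposition4p3:
  fixes p :: nat and A :: "'a ring" and R :: "'r ring" and M :: "('r, 'm) module"
  assumes "Factorial_Ring.prime p"
    and "excellent_ring A" and "local_ring A" and "has_characteristic A p"
    and "cring R" and "noetherian_ring R" and "has_characteristic R p"
    and "essentially_finite_type A R"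
    and "module R M" and "finitely_generated_module R M"
  shows "\<exists>C::real. C > 0 \<and>
    (\<forall>P e q I J.
       primeideal P R \<and> q = p ^ e \<and> ideal I R \<and> ideal J R \<and>
       primary_pair (loc_at R P) (ext_at R P P) (ext_at R P I) (ext_at R P J) \<longrightarrow>
       ennreal_of_enat (module_length (loc_at R P)
         (subquotient (loc_module_at R P M)
            (ideal_smult (loc_at R P) (ext_at R P (frobenius_power R q J)) (loc_module_at R P M))
            (ideal_smult (loc_at R P) (ext_at R P (frobenius_power R q I)) (loc_module_at R P M))))
       \<le> ennreal (C * real q ^ the_enat (module_dim (loc_at R P) (loc_module_at R P M))) *
         ennreal_of_enat (module_length (loc_at R P)
           (subquotient (self_module (loc_at R P)) (ext_at R P J) (ext_at R P I))))"
proof -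
  interpret R: cring R by fact
  interpret M: module R M by fact
  obtain B :: "'a ft_algebra" and f W h where B: "finite_type A f B" "submonoid W B" "h \<in> ring_iso (loc_ring B W) R"
    using assms(8) unfolding essentially_finite_type_def is_ring_iso_def by blast
  interpret B: cring B using B(1) unfolding finite_type_def by blast
  interpret BW: ring_localization B W by (intro ring_localization.intro B.cring_axioms B(2))
  interpret Q: cring "loc_ring B W" by (rule BW.cring_loc_ring)
  \<comment> \<open>The Noetherian property is part of \<open>J_1\<close>, so \<open>J_2\<close>
    also shows that \<open>B\<close> is Noetherian.\<close>
  have J2: "J_2 A" and noeth: "noetherian_ring B" and cat: "catenary B"
    using assms(2) B(1) unfolding excellent_ring_def J_2_def J_1_def universally_catenary_def by blast+
  \<comment> \<open>The canonical map from \<open>B\<close> to \<open>R\<close>; what is kept of the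
    isomorphism is that \<open>\<psi>\<close> turns \<open>W\<close> into units and makes every
    element of \<open>R\<close> a fraction.\<close>
  define \<psi> where "\<psi> = h \<circ> loc_map B W"
  have hom_h: "h \<in> ring_hom (loc_ring B W) R" and bij_h: "bij_betw h (carrier (loc_ring B W)) (carrier R)"
    using B(3) unfolding ring_iso_def by auto
  interpret h: ring_hom_ring "loc_ring B W" R h by (rule ring_hom_ringI2[OF Q.ring_axioms R.ring_axioms hom_h])
  have \<psi>: "\<psi> \<in> ring_hom B R" unfolding \<psi>_def by (rule ring_hom_trans[OF BW.loc_map_hom hom_h])
  interpret \<psi>: ring_hom_ring B R \<psi> by (rule ring_hom_ringI2[OF B.ring_axioms R.ring_axioms \<psi>])
  have unit: "\<psi> w \<in> Units R" if w: "w \<in> W" for w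
  proof -
    note u = BW.loc_map_unit[OF w]
    have "h (inv\<^bsub>loc_ring B W\<^esub> (loc_map B W w)) \<otimes>\<^bsub>R\<^esub> \<psi> w = \<one>\<^bsub>R\<^esub>"
      unfolding \<psi>_def comp_def h.hom_mult[OF Q.Units_inv_closed[OF u] Q.Units_closed[OF u], symmetric] Q.Units_l_inv[OF u]
      by (rule h.hom_one)
    moreover have "\<psi> w \<in> carrier R" "h (inv\<^bsub>loc_ring B W\<^esub> (loc_map B W w)) \<in> carrier R"
      unfolding \<psi>_def comp_def using Q.Units_inv_closed[OF u] Q.Units_closed[OF u] by auto
    ultimately obtain y where "y \<in> carrier R" "y \<otimes>\<^bsub>R\<^esub> \<psi> w = \<one>\<^bsub>R\<^esub>" "\<psi> w \<in> carrier R" by blast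
    then show ?thesis
      using R.m_comm[of "\<psi> w" y] unfolding Units_def by auto
  qed
  have frac: "\<exists>b\<in>carrier B. \<exists>w\<in>W. r \<otimes>\<^bsub>R\<^esub> \<psi> w = \<psi> b" if r: "r \<in> carrier R" for r
  proof -
    obtain x where x: "x \<in> carrier (loc_ring B W)" "r = h x"
      using r bij_h unfolding bij_betw_def by blast
    obtain b w where b: "x = BW.fr b w" "b \<in> carrier B" "w \<in> W" using x(1) by (rule BW.ring_frac_cases)
    have "r \<otimes>\<^bsub>R\<^esub> \<psi> w = h (x \<otimes>\<^bsub>loc_ring B W\<^esub> loc_map B W w)"
      unfolding \<psi>_def comp_def x(2) using x(1) BW.loc_map_closed[of w] b(3) by simp
    also have "\<dots> = \<psi> b" unfolding \<psi>_def comp_def b(1) BW.frac_mult_loc_map[OF b(2,3)] ..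
    finally show ?thesis using b by blast
  qed
  obtain U where U: "finite U" "U \<subseteq> carrier M" "submodule_span R M U = carrier M"
    using assms(10) unfolding finitely_generated_module_def by blast
  \<comment> \<open>The annihilator of \<open>M\<close> contracted to \<open>B\<close>, the ideal
    for which the uniform bound is invoked.\<close>
  define a where "a = {b \<in> carrier B. \<psi> b \<in> annihilator R M}"
  have a: "ideal a B" unfolding a_def by (rule \<psi>.ideal_vimage[OF M.annihilator_ideal])
  \<comment> \<open>The rings \<open>loc_at R P\<close> all have elements of type
    \<open>('r \<times> 'r) set\<close>, so one type instance, and hence one \<open>C\<close>,
    serves every \<open>P\<close>.\<close>
  obtain C where C: "\<And>P. primeideal P B \<Longrightarrow> a \<subseteq> P \<Longrightarrow>
      (\<exists>h xs. length xs = Suc h \<and> sorted_wrt (\<subset>) xs \<and> set xs \<subseteq> prime_interval B a P \<and>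
        bounded_by B P a TYPE(('r \<times> 'r) set ring) C h)"
    using uniform_bound[OF B.cring_axioms noeth generic_parameters[OF J2 B(1)] a, where T = "TYPE(('r \<times> 'r) set ring)"]
    by blast
  \<comment> \<open>\<open>card U\<close> accounts for the generators of \<open>M\<close>, and the
    summand 1 keeps the constant positive even if the product vanishes.\<close>
  define C' where "C' = real (C * card U) + 1"
  have C': "C' > 0" unfolding C'_def by (rule add_nonneg_pos) auto
  show ?thesis
  proof (intro exI[of _ C'] conjI allI impI C', elim conjE, goal_cases)
    case (1 P e q I J)
    then have P: "primeideal P R" and q: "q = p ^ e" and I: "ideal I R" and J: "ideal J R"
      and pair: "primary_pair (loc_at R P) (ext_at R P P) (ext_at R P I) (ext_at R P J)"
      by simp_all
    interpret P: primeideal P R by fact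
    interpret L: localization R M "carrier R - P"
      by (intro localization.intro M.module_axioms P.submonoid_compl)
    note [simp del] = L.S.mem_carrier
    let ?S = "loc_at R P" and ?N = "loc_module_at R P M" and ?l = "loc_map R (carrier R - P)"
    define P' where "P' = {b \<in> carrier B. \<psi> b \<in> P}"
    define \<theta> where "\<theta> = ?l \<circ> \<psi>"
    have loc: "prime_localization B P' ?S \<theta>"
      unfolding P'_def \<theta>_def
      by (rule prime_localization_comp[OF B.cring_axioms R.cring_axioms \<psi> BW.S.subset unit frac P])
    then interpret T: prime_localization B P' ?S \<theta> .
    interpret N: module ?S ?N by (rule L.module_loc_module)
    interpret SS: module ?S "self_module ?S" by (rule T.S.module_self_module)
    have q1: "q \<ge> 1" using q one_le_power[of p e] prime_gt_0_nat[OF assms(1)] by simp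
    obtain d where d: "module_dim ?S ?N = enat d"
      by (rule T.module_dim_finite[OF N.module_axioms noeth cat])
    \<comment> \<open>An element of \<open>B\<close> killing \<open>M_P\<close> kills
      \<open>M\<close> after multiplication by some \<open>s\<close> outside \<open>P\<close>. As
      \<open>s\<close> is a fraction over \<open>B\<close>, its numerator \<open>c\<close> is the
      multiplier in \<open>B\<close>.\<close>
    have ker: "\<exists>w\<in>carrier B - P'. w \<otimes>\<^bsub>B\<^esub> b \<in> a" if b: "b \<in> carrier B" "\<theta> b \<in> annihilator ?S ?N" for b
    proof -
      obtain s where s: "s \<in> carrier R - P" "s \<otimes>\<^bsub>R\<^esub> \<psi> b \<in> annihilator R M"
        using L.loc_module_annihilator[OF U \<psi>.hom_closed[OF b(1)]] b(2) unfolding \<theta>_def comp_def by blast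
      obtain c w where c: "c \<in> carrier B" "w \<in> W" "s \<otimes>\<^bsub>R\<^esub> \<psi> w = \<psi> c" using frac[of s] s(1) by blast
      have w: "\<psi> w \<in> carrier R" "\<psi> w \<notin> P" using unit[OF c(2)] R.Units_closed P.not_Unit by auto
      have "\<psi> c \<notin> P" unfolding c(3)[symmetric] using P.I_prime[of s "\<psi> w"] s(1) w by blast
      then have "c \<in> carrier B - P'" using c(1) unfolding P'_def by blast
      moreover have "\<psi> (c \<otimes>\<^bsub>B\<^esub> b) = \<psi> w \<otimes>\<^bsub>R\<^esub> (s \<otimes>\<^bsub>R\<^esub> \<psi> b)"
        using c(1) b(1) w s(1) by (simp add: c(3)[symmetric] R.m_ac)
      then have "c \<otimes>\<^bsub>B\<^esub> b \<in> a"
        unfolding a_def using ideal.I_l_closed[OF M.annihilator_ideal s(2) w(1)] c(1) b(1) by simp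
      ultimately show ?thesis by blast
    qed
    \<comment> \<open>If \<open>a\<close> is not contained in \<open>P'\<close>, an element outside
      \<open>P\<close> kills \<open>M\<close>, so \<open>M_P = 0\<close> and \<open>t = 0\<close>
      works.\<close>
    obtain t where t: "T.len (T.bound_ideal a q) (carrier ?S) t" "t \<le> C * q ^ d"
    proof (cases "a \<subseteq> P'")
      case True
      then obtain h xs where xs: "length xs = Suc h" "sorted_wrt (\<subset>) xs" "set xs \<subseteq> prime_interval B a P'"
        and b: "bounded_by B P' a TYPE(('r \<times> 'r) set ring) C h" using C[OF T.P.primeideal] by blast
      have "enat h \<le> enat d"
        using T.module_dim_ge[OF N.module_axioms ker xs] d by simp
      then have "C * q ^ h \<le> C * q ^ d" using q1 by (simp add: power_increasing)
      moreover have "T.len (T.bound_ideal a q) (carrier ?S) (C * q ^ h)"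
        using b q1 loc unfolding bounded_by_def by blast
      ultimately show thesis using that by blast
    next
      case False
      show thesis by (rule that[OF T.len_bound_not_subset[OF a False]]) simp
    qed
    define V where "V = (\<lambda>u. L.fr u \<one>\<^bsub>R\<^esub>) ` U"
    have V: "finite V" "V \<subseteq> carrier ?N" "card V \<le> card U"
      unfolding V_def using U(1,2) L.loc_closed L.S.one_closed card_image_le by auto
    have gen: "carrier ?N \<subseteq> H" if "submodule H ?S ?N" "V \<subseteq> H" for H
      using L.loc_module_generated[OF U(2,3) that(1)] that(2) unfolding V_def by blast
    have kill: "\<theta> b \<odot>\<^bsub>?N\<^esub> x = \<zero>\<^bsub>?N\<^esub>" if b: "b \<in> a" and x: "x \<in> carrier ?N" for b x
    proof -
      obtain y s where y: "x = L.fr y s" "y \<in> carrier M" "s \<in> carrier R - P" using x by (rule L.loc_cases)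
      have \<psi>b: "\<psi> b \<in> carrier R" "\<psi> b \<odot>\<^bsub>M\<^esub> y = \<zero>\<^bsub>M\<^esub>"
        using b y(2) unfolding a_def annihilator_def by auto
      have "\<theta> b \<odot>\<^bsub>?N\<^esub> x = L.fr \<zero>\<^bsub>M\<^esub> (\<one>\<^bsub>R\<^esub> \<otimes>\<^bsub>R\<^esub> s)"
        unfolding \<theta>_def comp_def loc_map_def y(1) using L.loc_smult[OF \<psi>b(1) y(2) L.S.one_closed y(3)] \<psi>b(2) by simp
      also have "\<dots> = \<zero>\<^bsub>?N\<^esub>"
        unfolding L.loc_module_simps(2) by (rule L.frac_eqI) (use y(3) L.S.one_closed in auto)
      finally show ?thesis .
    qed
    have char: "[p] \<cdot>\<^bsub>?S\<^esub> \<one>\<^bsub>?S\<^esub> = \<zero>\<^bsub>?S\<^esub>"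
    proof -
      interpret l: ring_hom_ring R ?S ?l by (rule ring_hom_ringI2[OF R.ring_axioms T.S.ring_axioms L.RS.loc_map_hom])
      have "[p] \<cdot>\<^bsub>R\<^esub> \<one>\<^bsub>R\<^esub> = \<zero>\<^bsub>R\<^esub>" using assms(7) unfolding has_characteristic_def by simp
      then show ?thesis using l.hom_add_pow_one[of p] l.hom_zero by simp
    qed
    have ext: "ideal (ext_at R P K) ?S" if K: "ideal K R" for K
      unfolding ext_at_def by (rule T.S.genideal_ideal) (use ideal.Icarr[OF K] L.RS.loc_map_closed in auto)
    have IJ: "submodule (ext_at R P I) ?S (self_module ?S)" "submodule (ext_at R P J) ?S (self_module ?S)"
      "ext_at R P I \<subseteq> ext_at R P J"
      using ext[OF I] ext[OF J] pair T.S.submodule_self_module_iff unfolding primary_pair_def by auto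
    note rhs = SS.module_length_subquotient[OF IJ]
    have frob: "ext_at R P (frobenius_power R q K) = frobenius_power ?S q (ext_at R P K)" if "ideal K R" for K
      unfolding ext_at_def by (rule L.RS.frobenius_power_extension[OF that])
    show ?case
    proof (cases "module_length ?S (subquotient (self_module ?S) (ext_at R P J) (ext_at R P I))")
      case infinity
      \<comment> \<open>An infinite length on the right makes the whole right side infinite, since
        the other factor is positive.\<close>
      have "0 < C' * real q ^ d" using C' q1 by (intro mult_pos_pos zero_less_power) auto
      then have pos: "ennreal (C' * real q ^ d) \<noteq> 0" by (simp only: ennreal_eq_0_iff not_le)
      have "x \<le> ennreal (C' * real q ^ d) * \<infinity>" for x
        using pos by (simp add: ennreal_mult_top)
      then show ?thesis unfolding infinity d by simp
    next
      case (enat n)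
      \<comment> \<open>The length \<open>n\<close> of \<open>JR_P/IR_P\<close> becomes a filtration
        with \<open>n\<close> steps, and Frobenius powers are then taken of its members.\<close>
      have "T.len (ext_at R P I) (ext_at R P J) n"
      proof (rule SS.filtration_if_chain_length_le[OF T.maxi_ideal T.proper T.not_maxi_unit IJ])
        fix xs assume "sorted_wrt (\<subset>) xs"
          "\<And>Z. Z \<in> set xs \<Longrightarrow> submodule Z ?S (self_module ?S) \<and> ext_at R P I \<subseteq> Z \<and> Z \<subseteq> ext_at R P J"
        then show "length xs \<le> Suc n"
          using enat unfolding rhs by (intro chain_height_leD[OF eq_refl]) auto
      qed
      note filt = T.filtration_frobenius[OF N.module_axioms assms(1) char q V(1,2) gen a kill t(1) this]
      let ?K = "ideal_smult ?S (frobenius_power ?S q (ext_at R P I)) ?N"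
      let ?H = "ideal_smult ?S (frobenius_power ?S q (ext_at R P J)) ?N"
      have KH: "submodule ?K ?S ?N" "submodule ?H ?S ?N" "?K \<subseteq> ?H"
        using N.filtration_submodule[OF filt] by auto
      have "module_length ?S (subquotient ?N ?H ?K) \<le> enat (n * (card V * t))"
        unfolding N.module_length_subquotient[OF KH]
      proof (rule chain_height_leI)
        fix xs assume "sorted_wrt (\<subset>) xs" "set xs \<subseteq> {A. submodule A ?S ?N \<and> ?K \<subseteq> A \<and> A \<subseteq> ?H}"
        then show "length xs \<le> Suc (n * (card V * t))"
          by (intro N.chain_length_le_filtration[OF filt T.not_maxi_unit]) auto
      qed
      then have "ennreal_of_enat (module_length ?S (subquotient ?N ?H ?K)) \<le> of_nat (n * (card V * t))"
        by (metis ennreal_of_enat_enat ennreal_of_enat_le_iff)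
      also have "\<dots> \<le> ennreal (C' * real q ^ d) * of_nat n"
      proof -
        \<comment> \<open>Each of the \<open>n\<close> steps has cost \<open>card V\<close>
          generators with \<open>t\<close> for each, and this product stays below
          \<open>C' q^d\<close>.\<close>
        have "card V * t \<le> card U * (C * q ^ d)" by (rule mult_le_mono[OF V(3) t(2)])
        then have "real (card V * t) \<le> real (card U * (C * q ^ d))" by (rule of_nat_mono)
        also have "\<dots> \<le> C' * real q ^ d" unfolding C'_def by (simp add: algebra_simps)
        finally have "real n * real (card V * t) \<le> C' * real q ^ d * real n"
          by (simp add: mult.commute mult_left_mono)
        then have "ennreal (real (n * (card V * t))) \<le> ennreal (C' * real q ^ d * real n)"
          by (intro ennreal_leI) simp
        then show ?thesis
          unfolding ennreal_of_nat_eq_real_of_nat by (subst ennreal_mult'[symmetric]) (use C' in auto)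
      qed
      finally show ?thesis unfolding frob[OF I] frob[OF J] enat d by simp
    qed
  qed
qed

end
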